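(* Let $Q(t)=(Q_1(t),\dots,Q_K(t))^T$, $t\ge 0$, be the queue length process of an ergodic Jackson network with $K$ nodes, routing matrix $P$, arrival rates $\lambda_k>0$ and service rates $\mu_k>0$, with $Q(0)=0$. Let $r\in\mathbb R_+^K$, let $\overline q$ be the fluid trajectory of the dual network with $\overline q(0)=r$, let $T^\ast$ be the first time at which $\overline q$ reaches the origin, and let $q^\ast(t)=\overline q(T^\ast-t)$, $0\le t\le T^\ast$. Then for every $\delta>0$, $$\lim_{\epsilon\to0}\limsup_{n\to\infty}\mathbf P\Bigl(\sup_{t\le T^\ast}\Bigl|\frac{Q(nt)}{n}-q^\ast(t)\Bigr|\ge\delta\ \Big|\ \Bigl|\frac{Q(nT^\ast)}{n}-r\Bigr|\le\epsilon\Bigr)=0 .$$ Moreover, $$\lim_{\epsilon\to0}\limsup_{n\to\infty}\frac1n\ln\mathbf P\Bigl(\Bigl|\frac{Q(nT^\ast)}{n}-r\Bigr|\le\epsilon\Bigr)=\lim_{\epsilon\to0}\liminf_{n\to\infty}\frac1n\ln\mathbf P\Bigl(\Bigl|\frac{Q(nT^\ast)}{n}-r\Bigr|\le\epsilon\Bigr)=-\theta^\ast\cdot r .$$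
   Context: The Jackson network: $Q$ is the continuous-time Markov chain on $\mathbb Z_+^K$ in which customers arrive from outside at node $k$ at rate $\lambda_k$ (Poisson), and, whenever $Q_k>0$, node $k$ completes a service at rate $\mu_k$; the served customer moves to node $l$ with probability $p_{kl}$ and leaves the network with probability $1-\sum_{l=1}^K p_{kl}$. $P=(p_{kl})$ is substochastic (nonnegative entries, row sums at most $1$) with spectral radius less than $1$. Put $\nu=(I-P^T)^{-1}\lambda$ with $\lambda=(\lambda_1,\dots,\lambda_K)^T$, and $\rho_k=\nu_k/\mu_k$; ergodicity means $\rho_k<1$ for all $k$. $\theta^\ast\in\mathbb R^K$ is given by $\theta^\ast_k=-\ln\rho_k$. $|\cdot|$ is a norm on $\mathbb R^K$. The dual network has service rates $\mu_k$, routing matrix $\overline P=(\overline p_{kl})$ with $\overline p_{kl}=\nu_l p_{lk}/\nu_k$, and arrival rates $\overline\lambda_k=\nu_k(1-\sum_{l=1}^K p_{kl})$. Its fluid trajectory started at $r\in\mathbb R_+^K$ is the unique solution $\overline q$ of the oblique reflection problem: $\overline q(t)=r+(\overline\lambda-(I-\overline P^T)\mu)\,t+(I-\overline P^T)\phi(t)\in\mathbb R_+^K$ for $t\ge0$, where $\mu=(\mu_1,\dots,\mu_K)^T$, $\phi(0)=0$, $\phi$ is absolutely continuous and componentwise nondecreasing, and $\overline q_k(t)\dot\phi_k(t)=0$ for a.e. $t$ and all $k$. Under ergodicity it reaches the origin in finite time. *)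

theory Defs
  imports "HOL-Probability.Probability"
begin

definition transition_function :: "(real \<Rightarrow> 's \<Rightarrow> 's \<Rightarrow> real) \<Rightarrow> bool" where
  "transition_function p \<longleftrightarrow>
     (\<forall>t\<ge>0. \<forall>x y. 0 \<le> p t x y) \<and>
     (\<forall>t\<ge>0. \<forall>x. (p t x has_sum 1) UNIV) \<and>
     (\<forall>x y. p 0 x y = of_bool (x = y)) \<and>
     (\<forall>s\<ge>0. \<forall>t\<ge>0. \<forall>x y. ((\<lambda>z. p s x z * p t z y) has_sum p (s + t) x y) UNIV)"

text \<open>Only the off-diagonal values of the rate function \<open>g\<close> matter; the diagonal of the
  generator is determined by requiring its rows to sum to zero.\<close>

definition has_transition_rates ::
  "(real \<Rightarrow> 's \<Rightarrow> 's \<Rightarrow> real) \<Rightarrow> ('s \<Rightarrow> 's \<Rightarrow> real) \<Rightarrow> bool" where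
  "has_transition_rates p g \<longleftrightarrow>
     (\<forall>x y. ((\<lambda>h. (p h x y - p 0 x y) / h) \<longlongrightarrow>
              (if x = y then - (\<Sum>\<^sub>\<infinity>z\<in>- {x}. g x z) else g x y)) (at_right 0))"

text \<open>Right-continuity refers to the topology of the state space; for \<open>nat ^ 'k\<close> this is the
  discrete one, so that the paths are right-continuous step functions.\<close>

definition markov_chain ::
  "'w measure \<Rightarrow> ('s \<Rightarrow> 's \<Rightarrow> real) \<Rightarrow> (real \<Rightarrow> 'w \<Rightarrow> 's::topological_space) \<Rightarrow> bool" where
  "markov_chain M g X \<longleftrightarrow>
     prob_space M \<and>
     (\<forall>t\<ge>0. X t \<in> measurable M (count_space UNIV)) \<and>
     (\<forall>w\<in>space M. \<forall>t\<ge>0. continuous (at_right t) (\<lambda>s. X s w)) \<and>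
     (\<exists>p. transition_function p \<and> has_transition_rates p g \<and>
        (\<forall>n t x. 0 \<le> t 0 \<and> (\<forall>i\<le>n. t i \<le> t (Suc i)) \<longrightarrow>
           \<P>(w in M. \<forall>i\<le>Suc n. X (t i) w = x i) =
           \<P>(w in M. \<forall>i\<le>n. X (t i) w = x i) * p (t (Suc n) - t n) (x n) (x (Suc n))))"

definition spectral_radius :: "real ^ 'k ^ 'k \<Rightarrow> real" where
  "spectral_radius A =
     Sup {cmod c | c. \<exists>v :: complex ^ 'k. v \<noteq> 0 \<and>
                        (\<chi> i j. complex_of_real (A $ i $ j)) *v v = c *s v}"

definition substochastic :: "real ^ 'k ^ 'k \<Rightarrow> bool" where
  "substochastic P \<longleftrightarrow> (\<forall>k l. 0 \<le> P $ k $ l) \<and> (\<forall>k. (\<Sum>l\<in>UNIV. P $ k $ l) \<le> 1)"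

text \<open>Rate of the transition from \<open>x\<close> to \<open>y\<close>, for \<open>x \<noteq> y\<close>. A customer routed back to the node
  just left does not change the state.\<close>

definition jackson_rate ::
  "real ^ 'k \<Rightarrow> real ^ 'k \<Rightarrow> real ^ 'k ^ 'k \<Rightarrow> nat ^ 'k \<Rightarrow> nat ^ 'k \<Rightarrow> real" where
  "jackson_rate lam mu P x y =
     (\<Sum>k\<in>UNIV. lam $ k * of_bool (y = x + axis k 1)) +
     (\<Sum>k\<in>UNIV. \<Sum>l\<in>UNIV. mu $ k * P $ k $ l *
        of_bool (x $ k > 0 \<and> y = x - axis k 1 + axis l 1)) +
     (\<Sum>k\<in>UNIV. mu $ k * (1 - (\<Sum>l\<in>UNIV. P $ k $ l)) *
        of_bool (x $ k > 0 \<and> y = x - axis k 1))"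

definition throughput :: "real ^ 'k \<Rightarrow> real ^ 'k ^ 'k \<Rightarrow> real ^ 'k" where
  "throughput lam P = matrix_inv (mat 1 - transpose P) *v lam"

definition load :: "real ^ 'k \<Rightarrow> real ^ 'k \<Rightarrow> real ^ 'k ^ 'k \<Rightarrow> real ^ 'k" where
  "load lam mu P = (\<chi> k. throughput lam P $ k / mu $ k)"

definition ergodic_jackson_network ::
  "real ^ 'k \<Rightarrow> real ^ 'k \<Rightarrow> real ^ 'k ^ 'k \<Rightarrow> bool" where
  "ergodic_jackson_network lam mu P \<longleftrightarrow>
     (\<forall>k. 0 < lam $ k) \<and> (\<forall>k. 0 < mu $ k) \<and>
     substochastic P \<and> spectral_radius P < 1 \<and>
     (\<forall>k. load lam mu P $ k < 1)"

definition decay_rate :: "real ^ 'k \<Rightarrow> real ^ 'k \<Rightarrow> real ^ 'k ^ 'k \<Rightarrow> real ^ 'k" where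
  "decay_rate lam mu P = (\<chi> k. - ln (load lam mu P $ k))"

definition dual_routing :: "real ^ 'k \<Rightarrow> real ^ 'k ^ 'k \<Rightarrow> real ^ 'k ^ 'k" where
  "dual_routing lam P =
     (\<chi> k l. throughput lam P $ l * P $ l $ k / throughput lam P $ k)"

definition dual_arrival :: "real ^ 'k \<Rightarrow> real ^ 'k ^ 'k \<Rightarrow> real ^ 'k" where
  "dual_arrival lam P = (\<chi> k. throughput lam P $ k * (1 - (\<Sum>l\<in>UNIV. P $ k $ l)))"

definition absolutely_continuous_on_interval ::
  "real \<Rightarrow> real \<Rightarrow> (real \<Rightarrow> 'a::metric_space) \<Rightarrow> bool" where
  "absolutely_continuous_on_interval a b f \<longleftrightarrow>
     (\<forall>e>0. \<exists>d>0. \<forall>I. finite I \<and> (\<forall>(u, v)\<in>I. a \<le> u \<and> u \<le> v \<and> v \<le> b) \<and>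
        disjoint_family_on (\<lambda>(u, v). {u<..<v}) I \<and> (\<Sum>(u, v)\<in>I. v - u) < d
        \<longrightarrow> (\<Sum>(u, v)\<in>I. dist (f u) (f v)) < e)"

text \<open>Functions of time are defined on all of \<open>real\<close>, but only their values at nonnegative times
  are constrained. Absolute continuity on the half-line is understood locally.\<close>

definition fluid_trajectory ::
  "real ^ 'k \<Rightarrow> real ^ 'k \<Rightarrow> real ^ 'k ^ 'k \<Rightarrow> real ^ 'k \<Rightarrow> (real \<Rightarrow> real ^ 'k) \<Rightarrow> bool" where
  "fluid_trajectory lam mu P r q \<longleftrightarrow>
     (\<exists>phi :: real \<Rightarrow> real ^ 'k.
        (\<forall>t\<ge>0. q t = r + t *\<^sub>R (lam - (mat 1 - transpose P) *v mu)
                       + (mat 1 - transpose P) *v phi t) \<and>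
        (\<forall>t\<ge>0. \<forall>k. 0 \<le> q t $ k) \<and>
        phi 0 = 0 \<and>
        (\<forall>b\<ge>0. absolutely_continuous_on_interval 0 b phi) \<and>
        (\<forall>s t k. 0 \<le> s \<and> s \<le> t \<longrightarrow> phi s $ k \<le> phi t $ k) \<and>
        (AE t in lborel. t > 0 \<longrightarrow>
           (\<forall>k. \<exists>d. ((\<lambda>s. phi s $ k) has_real_derivative d) (at t) \<and> q t $ k * d = 0)))"

definition emptying_time :: "(real \<Rightarrow> real ^ 'k) \<Rightarrow> real" where
  "emptying_time q = Inf {t. 0 \<le> t \<and> q t = 0}"

definition is_norm :: "('a::real_vector \<Rightarrow> real) \<Rightarrow> bool" where
  "is_norm N \<longleftrightarrow>
     (\<forall>x. 0 \<le> N x) \<and> (\<forall>x. N x = 0 \<longleftrightarrow> x = 0) \<and>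
     (\<forall>c x. N (c *\<^sub>R x) = \<bar>c\<bar> * N x) \<and> (\<forall>x y. N (x + y) \<le> N x + N y)"

definition scaled_queue :: "(real \<Rightarrow> 'w \<Rightarrow> nat ^ 'k) \<Rightarrow> nat \<Rightarrow> real \<Rightarrow> 'w \<Rightarrow> real ^ 'k" where
  "scaled_queue Q n t w = (\<chi> k. real (Q (real n * t) w $ k) / real n)"

text \<open>The logarithm of a probability, equal to minus infinity for null events.\<close>

definition ln_prob :: "real \<Rightarrow> ereal" where
  "ln_prob p = (if p = 0 then - \<infinity> else ereal (ln p))"

end

theory Submission
  imports Defs
begin

text \<open>The network started at the origin and observed at time \<open>n T\<close> in a state \<open>x\<close> is, read backwards, the
  dual network started at \<open>x\<close> and observed at the origin: with \<open>\<pi> x = (\<Prod>k. \<rho> k ^ x k)\<close> reversal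
  turns the probability of a path into \<open>\<pi> x\<close> times the probability of the reversed path under the
  dual dynamics. Since \<open>\<pi> x = exp (- \<theta> \<bullet> x)\<close>, everything follows from an exponential fluid limit
  for the dual network that is uniform in the initial state: the probability of being away from the
  fluid path decays exponentially, at a rate that does not depend on \<open>\<epsilon>\<close>, whereas conditioning
  costs only \<open>exp (- n \<theta> \<bullet> r)\<close> up to a factor \<open>exp (O (\<epsilon> n))\<close>.

  The fluid limit needs no Skorokhod map. In the coordinates \<open>y = (I - p\<^sup>T)\<inverse> x\<close> the regulator acts
  componentwise, and with a weight \<open>v\<close> satisfying \<open>p\<^sup>T v \<le> \<beta> v\<close>, \<open>\<beta> < 1\<close>, a component of the deviation
  between the chain and the fluid is only pushed outwards by a boundary when its weighted size is at
  most \<open>\<beta>\<close> times the maximal one. Hence the sum of \<open>exp (\<plusminus> c y k / v k)\<close> over the components of the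
  deviation is almost a supermartingale.\<close>

section \<open>Substochastic matrices\<close>

text \<open>The hypotheses give the chain only through a transition function with prescribed
  derivatives at time 0 and through right-continuous paths. The former becomes an explicit kernel by
  uniformization: with bounded rates the backward equation has one solution, so probabilities at
  finitely many times are values of pmfs, on which reversal acts jump by jump. The latter reduces
  the supremum over time to a fixed grid plus oscillations between grid points; these are bounded
  for the forward chain, at an exponential rate made as large as desired by refining the grid.

  The supermartingale property fails by terms of the order of the power \<beta> of the Lyapunov
  function. Adding a constant \<open>L\<close> to that function turns them into a growth rate
  proportional to \<open>L powr (\<beta> - 1)\<close>, negligible since \<open>L\<close> may be
  taken exponentially large in \<open>n\<close>.

  The fluid limit only brings the dual network near the origin, while reversal needs it exactly
  there. The lower bound therefore leaves the fluid path shortly before \<open>T\<close> and pays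
  for the last stretch with forward paths made of arrivals alone, which positivity of
  \<open>lam\<close> permits.\<close>

lemma finite_max_index:
  fixes f :: "'k :: finite \<Rightarrow> real"
  shows "\<exists>i. \<forall>j. f j \<le> f i"
proof -
  have "Max (range f) \<in> range f" by (intro Max_in) auto
  then obtain i where "Max (range f) = f i" by (rule imageE)
  then show ?thesis by (metis Max_ge finite finite_imageI rangeI)
qed

lemma finite_pos_lower_bound:
  fixes f :: "'k :: finite \<Rightarrow> real"
  assumes "\<And>k. 0 < f k"
  shows "\<exists>l>0. \<forall>k. l \<le> f k"
proof -
  obtain i where "\<forall>j. - f j \<le> - f i" using finite_max_index[of "\<lambda>k. - f k"] by blast
  then show ?thesis using assms by (intro exI[of _ "f i"]) auto
qed

text \<open>Evaluate the eigenvalue equation at a coordinate of maximal modulus. The bound is needed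
  because \<open>Sup\<close> is informative only for a set that is bounded above.\<close>

lemma substochastic_eigenvalue_le_1:
  fixes P :: "real ^ 'k ^ 'k" and v :: "complex ^ 'k"
  assumes P: "substochastic P" and v: "v \<noteq> 0"
    and eig: "(\<chi> i j. complex_of_real (P $ i $ j)) *v v = c *s v"
  shows "cmod c \<le> 1"
proof -
  obtain i where i: "\<And>j. cmod (v $ j) \<le> cmod (v $ i)"
    using finite_max_index[of "\<lambda>j. cmod (v $ j)"] by blast
  have pos: "cmod (v $ i) > 0"
  proof (rule ccontr)
    assume "\<not> ?thesis"
    then have "\<And>j. v $ j = 0" using i
      by (metis dual_order.trans norm_le_zero_iff not_le)
    then show False using v by (simp add: vec_eq_iff)
  qed
  have "c * v $ i = (\<Sum>j\<in>UNIV. complex_of_real (P $ i $ j) * v $ j)"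
    using arg_cong[OF eig, of "\<lambda>x. x $ i"] by (simp add: matrix_vector_mult_def)
  then have "cmod c * cmod (v $ i) = cmod (\<Sum>j\<in>UNIV. complex_of_real (P $ i $ j) * v $ j)"
    by (metis norm_mult)
  also have "\<dots> \<le> (\<Sum>j\<in>UNIV. P $ i $ j * cmod (v $ j))"
    using P by (intro sum_norm_le) (auto simp: norm_mult substochastic_def)
  also have "\<dots> \<le> (\<Sum>j\<in>UNIV. P $ i $ j * cmod (v $ i))"
    using P i by (intro sum_mono mult_left_mono) (auto simp: substochastic_def)
  also have "\<dots> = (\<Sum>j\<in>UNIV. P $ i $ j) * cmod (v $ i)"
    by (simp add: sum_distrib_right)
  also have "\<dots> \<le> 1 * cmod (v $ i)"
    using P by (intro mult_right_mono) (auto simp: substochastic_def)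
  finally show ?thesis using pos by simp
qed

text \<open>A nonzero fixed vector puts 1 among the moduli, so the supremum would be at least 1. The
  spectral radius enters the development only through this exclusion of the eigenvalue 1.\<close>

lemma substochastic_fixed_point_zero:
  fixes P :: "real ^ 'k ^ 'k"
  assumes P: "substochastic P" and rad: "spectral_radius P < 1" and s: "P *v s = s"
  shows "s = 0"
proof (rule ccontr)
  assume "s \<noteq> 0"
  let ?S = "{cmod c | c. \<exists>v :: complex ^ 'k. v \<noteq> 0 \<and>
                        (\<chi> i j. complex_of_real (P $ i $ j)) *v v = c *s v}"
  let ?v = "\<chi> i. complex_of_real (s $ i)"
  have "(\<chi> i j. complex_of_real (P $ i $ j)) *v ?v = 1 *s ?v"
    using s by (simp add: vec_eq_iff matrix_vector_mult_def flip: of_real_mult of_real_sum)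
  moreover have "?v \<noteq> 0" using \<open>s \<noteq> 0\<close> by (simp add: vec_eq_iff)
  ultimately have "cmod 1 \<in> ?S" by blast
  moreover have "bdd_above ?S"
    by (rule bdd_aboveI[of _ 1]) (use substochastic_eigenvalue_le_1[OF P] in blast)
  ultimately have "cmod 1 \<le> Sup ?S" by (rule cSup_upper)
  with rad show False by (simp add: spectral_radius_def)
qed

text \<open>The vectors \<open>P^n 1\<close> decrease to a fixed point of \<open>P\<close>, which must be zero; a finite
  Neumann sum is then a strictly superharmonic weight.\<close>

lemma substochastic_superharmonic:
  fixes P :: "real ^ 'k ^ 'k"
  assumes P: "substochastic P" and rad: "spectral_radius P < 1"
  obtains w :: "real ^ 'k" and \<beta> where "\<And>k. 0 < w $ k" "0 \<le> \<beta>" "\<beta> < 1"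
    "\<And>k. (\<Sum>l\<in>UNIV. P $ k $ l * w $ l) \<le> \<beta> * w $ k"
proof -
  define u where "u n = (((*v) P) ^^ n) (\<chi> i. 1)" for n
  have u0: "u 0 $ k = 1" for k by (simp add: u_def)
  have uS: "u (Suc n) = P *v u n" for n by (simp add: u_def)
  have uSk: "u (Suc n) $ k = (\<Sum>l\<in>UNIV. P $ k $ l * u n $ l)" for n k
    by (simp add: uS matrix_vector_mult_def)
  have P0: "0 \<le> P $ k $ l" for k l using P by (simp add: substochastic_def)
  have unn: "0 \<le> u n $ k" for n k
    by (induction n arbitrary: k) (auto simp: u0 uSk P0 intro!: sum_nonneg)
  have dec: "u (Suc n) $ k \<le> u n $ k" for n k
  proof (induction n arbitrary: k)
    case 0 then show ?case using P by (simp add: uSk u0 substochastic_def)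
  next
    case (Suc n)
    then show ?case unfolding uSk[of "Suc n"] uSk[of n] by (intro sum_mono mult_left_mono P0) auto
  qed
  have "\<exists>L. (\<lambda>n. u n $ k) \<longlonglongrightarrow> L" for k
  proof -
    have "decseq (\<lambda>n. u n $ k)" by (rule decseq_SucI) (rule dec)
    then obtain L where "(\<lambda>n. u n $ k) \<longlonglongrightarrow> L" by (rule decseq_convergent[of _ 0]) (use unn in auto)
    then show ?thesis by blast
  qed
  then obtain L where L: "\<And>k. (\<lambda>n. u n $ k) \<longlonglongrightarrow> L k" by metis
  have "P *v (\<chi> k. L k) = (\<chi> k. L k)"
  proof -
    have "(\<Sum>l\<in>UNIV. P $ k $ l * L l) = L k" for k
    proof (rule LIMSEQ_unique)
      show "(\<lambda>n. u (Suc n) $ k) \<longlonglongrightarrow> (\<Sum>l\<in>UNIV. P $ k $ l * L l)"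
        unfolding uSk by (intro tendsto_intros L)
      show "(\<lambda>n. u (Suc n) $ k) \<longlonglongrightarrow> L k" using L by (rule LIMSEQ_Suc)
    qed
    then show ?thesis by (simp add: vec_eq_iff matrix_vector_mult_def)
  qed
  from substochastic_fixed_point_zero[OF P rad this] have L0: "L k = 0" for k
    by (simp add: vec_eq_iff)
  have "eventually (\<lambda>n. u n $ k < 1/2) sequentially" for k
    using order_tendstoD(2)[OF L[of k], of "1/2"] L0[of k] by simp
  then have "eventually (\<lambda>n. \<forall>k. u n $ k < 1/2) sequentially"
    by (simp add: eventually_all_finite)
  then obtain n where n: "\<And>k. u n $ k < 1/2"
    by (auto simp: eventually_sequentially)
  have n0: "n > 0" using n[of undefined] u0[of undefined] by (cases n) auto
  define w where "w = (\<Sum>j<n. u j)"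
  have wk: "w $ k = (\<Sum>j<n. u j $ k)" for k by (simp add: w_def)
  have ule: "u j $ k \<le> 1" for j k
    by (induction j) (auto simp: u0 intro: order_trans[OF dec])
  have w1: "1 \<le> w $ k" for k
  proof -
    have "u 0 $ k \<le> (\<Sum>j<n. u j $ k)" using n0 unn by (intro member_le_sum) auto
    then show ?thesis by (simp add: wk u0)
  qed
  have wn: "w $ k \<le> n" for k
    using sum_mono[of "{..<n}" "\<lambda>j. u j $ k" "\<lambda>_. 1"] ule by (simp add: wk)
  \<comment> \<open>\<open>P w\<close> telescopes to \<open>w - u 0 + u n\<close>, a loss of at
    least 1/2 in every component; since \<open>w k \<le> n\<close>, this is at least the fraction
    \<open>1 / (2 * n)\<close> of \<open>w k\<close>.\<close>
  define \<beta> where "\<beta> = 1 - 1 / (2 * real n)"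
  have "(\<Sum>l\<in>UNIV. P $ k $ l * w $ l) \<le> \<beta> * w $ k" for k
  proof -
    have "(\<Sum>l\<in>UNIV. P $ k $ l * w $ l) = (\<Sum>j<n. u (Suc j) $ k)"
      unfolding wk uSk sum_distrib_left by (rule sum.swap)
    also have "\<dots> = w $ k - u 0 $ k + u n $ k"
      unfolding wk using sum.lessThan_Suc_shift[of "\<lambda>j. u j $ k" n] by simp
    also have "\<dots> \<le> w $ k - 1 / 2" using n[of k] u0[of k] by simp
    also have "\<dots> \<le> \<beta> * w $ k"
      using wn[of k] n0 by (simp add: \<beta>_def field_simps)
    finally show ?thesis .
  qed
  moreover have "0 \<le> \<beta>" "\<beta> < 1" using n0 by (auto simp: \<beta>_def field_simps)
  ultimately show ?thesis using that[of w \<beta>] w1 by (meson less_le_trans zero_less_one)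
qed

text \<open>Pairing with the weight gives \<open>w \<bullet> z \<le> w \<bullet> P\<^sup>T z = P w
  \<bullet> z \<le> \<beta> (w \<bullet> z)\<close>, which forces the nonnegative number
  \<open>w \<bullet> z\<close> to vanish.\<close>

lemma subinvariant_zero:
  fixes z w :: "real ^ 'k" and P :: "real ^ 'k ^ 'k"
  assumes w: "\<And>k. 0 < w $ k" and \<beta>: "\<beta> < 1"
    and Pw: "\<And>k. (\<Sum>l\<in>UNIV. P $ k $ l * w $ l) \<le> \<beta> * w $ k"
    and z0: "\<And>k. 0 \<le> z $ k" and z: "\<And>k. z $ k \<le> (\<Sum>l\<in>UNIV. P $ l $ k * z $ l)"
  shows "z = 0"
proof -
  let ?S = "\<Sum>k\<in>UNIV. w $ k * z $ k"
  have "?S \<le> (\<Sum>k\<in>UNIV. w $ k * (\<Sum>l\<in>UNIV. P $ l $ k * z $ l))"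
    using w z by (intro sum_mono mult_left_mono) (auto simp: less_imp_le)
  also have "\<dots> = (\<Sum>l\<in>UNIV. z $ l * (\<Sum>k\<in>UNIV. P $ l $ k * w $ k))"
    by (simp add: sum_distrib_left) (subst sum.swap, simp add: mult_ac)
  also have "\<dots> \<le> (\<Sum>l\<in>UNIV. z $ l * (\<beta> * w $ l))"
    using Pw z0 by (intro sum_mono mult_left_mono) auto
  also have "\<dots> = \<beta> * ?S" by (simp add: sum_distrib_left mult_ac)
  finally have "?S * (1 - \<beta>) \<le> 0" by (simp add: algebra_simps)
  then have "?S \<le> 0" using \<beta> by (simp add: mult_le_0_iff)
  moreover have "w $ k * z $ k \<ge> 0" for k using w z0 by (simp add: less_imp_le)
  ultimately have "w $ k * z $ k = 0" for k
    by (metis (no_types, lifting) UNIV_I finite order_antisym sum_nonneg sum_nonneg_eq_0_iff)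
  then show ?thesis using w by (simp add: vec_eq_iff) (metis less_irrefl)
qed

lemma I_minus_transpose_mult_nth:
  fixes P :: "real ^ 'k ^ 'k"
  shows "((mat 1 - transpose P) *v x) $ k = x $ k - (\<Sum>l\<in>UNIV. P $ l $ k * x $ l)"
proof -
  have "(mat 1 - transpose P) *v x = x - transpose P *v x"
    by (metis matrix_vector_mult_diff_rdistrib matrix_vector_mul_lid)
  then show ?thesis by (simp add: matrix_vector_mult_def transpose_def)
qed

text \<open>The absolute values of a kernel vector form a subinvariant vector, so the kernel is
  trivial.\<close>

lemma invertible_I_minus_transpose:
  fixes w :: "real ^ 'k" and P :: "real ^ 'k ^ 'k"
  assumes P0: "\<And>k l. 0 \<le> P $ k $ l" and w: "\<And>k. 0 < w $ k" and \<beta>: "\<beta> < 1"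
    and Pw: "\<And>k. (\<Sum>l\<in>UNIV. P $ k $ l * w $ l) \<le> \<beta> * w $ k"
  shows "invertible (mat 1 - transpose P)"
proof -
  have "x = 0" if x: "(mat 1 - transpose P) *v x = 0" for x
  proof -
    have x': "x $ k = (\<Sum>l\<in>UNIV. P $ l $ k * x $ l)" for k
      using arg_cong[OF x, of "\<lambda>y. y $ k"]
      by (simp add: I_minus_transpose_mult_nth)
    have "(\<chi> k. \<bar>x $ k\<bar>) = 0"
    proof (rule subinvariant_zero[OF w \<beta> Pw])
      show "(\<chi> k. \<bar>x $ k\<bar>) $ k \<le> (\<Sum>l\<in>UNIV. P $ l $ k * (\<chi> k. \<bar>x $ k\<bar>) $ l)" for k
        using sum_abs[of "\<lambda>l. P $ l $ k * x $ l" UNIV] P0 by (simp add: x'[of k, symmetric] abs_mult)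
    qed auto
    then show ?thesis by (simp add: vec_eq_iff)
  qed
  then have "inj ((*v) (mat 1 - transpose P))"
    by (metis matrix_left_invertible_injective matrix_left_invertible_ker)
  then show ?thesis
    by (simp add: invertible_left_inverse matrix_left_invertible_injective)
qed

lemma matrix_inv_mult_cancel:
  fixes A :: "real ^ 'k ^ 'k"
  assumes "invertible A"
  shows "A *v (matrix_inv A *v x) = x" "matrix_inv A *v (A *v x) = x"
proof -
  have "A ** matrix_inv A = mat 1 \<and> matrix_inv A ** A = mat 1"
    unfolding matrix_inv_def by (rule someI_ex) (use assms in \<open>auto simp: invertible_def\<close>)
  then show "A *v (matrix_inv A *v x) = x" "matrix_inv A *v (A *v x) = x"
    by (simp_all only: matrix_vector_mul_assoc matrix_vector_mul_lid)
qed

section \<open>Absolutely continuous functions with vanishing derivative\<close>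

lemma finite_disjoint_interval_length_le:
  fixes I :: "(real \<times> real) set"
  assumes I: "finite I" "\<And>u v. (u, v) \<in> I \<Longrightarrow> u \<le> v"
    and disj: "disjoint_family_on (\<lambda>(u, v). {u<..<v}) I"
    and W: "W \<in> sets lborel" "\<And>u v. (u, v) \<in> I \<Longrightarrow> {u<..<v} \<subseteq> W" and fin: "emeasure lborel W < ennreal d"
  shows "(\<Sum>(u, v)\<in>I. v - u) < d"
proof -
  let ?A = "\<lambda>(u, v). {u<..<v::real}"
  have "ennreal (\<Sum>(u, v)\<in>I. v - u) = (\<Sum>i\<in>I. emeasure lborel (?A i))"
    using I(2) by (subst sum_ennreal[symmetric]) (auto intro!: sum.cong)
  also have "\<dots> = emeasure lborel (\<Union>i\<in>I. ?A i)"
    using disj I by (intro sum_emeasure) auto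
  also have "\<dots> \<le> emeasure lborel W"
    using W by (intro emeasure_mono) auto
  also note fin
  finally have "ennreal (\<Sum>(u, v)\<in>I. v - u) < ennreal d" .
  moreover have "0 \<le> (\<Sum>(u, v)\<in>I. v - u)" using I(2) by (intro sum_nonneg) auto
  ultimately show ?thesis by (simp add: ennreal_less_iff)
qed

text \<open>A Cousin-type argument: intervals tagged outside the exceptional null set contribute at most
  \<open>e (b - a)\<close> by the vanishing derivative, the remaining ones at most \<open>e\<close> by absolute continuity.\<close>

lemma absolutely_continuous_derivative_zero_const:
  fixes f :: "real \<Rightarrow> real"
  assumes ab: "a \<le> b" and ac: "absolutely_continuous_on_interval a b f"
    and deriv: "AE t in lborel. a < t \<and> t < b \<longrightarrow> (f has_real_derivative 0) (at t)"
  shows "f b = f a"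
proof -
  from deriv obtain N0 where N0: "N0 \<in> null_sets lborel"
    and der: "\<And>t. a < t \<Longrightarrow> t < b \<Longrightarrow> t \<notin> N0 \<Longrightarrow> (f has_real_derivative 0) (at t)"
    by (auto elim!: AE_E3 simp: set_eq_iff subset_eq)
  define N where "N = N0 \<union> {a, b}"
  have N: "N \<in> null_sets lborel"
    unfolding N_def using N0 by (rule null_sets.Un) (rule finite_imp_null_set_lborel, simp)
  have der: "(f has_real_derivative 0) (at t)" if "t \<in> {a..b}" "t \<notin> N" for t
    using that by (intro der) (auto simp: N_def less_le)
  have main: "\<bar>f b - f a\<bar> \<le> e * (b - a) + e" if e: "e > 0" for e
  proof -
    from ac e obtain d where d: "d > 0" and dI: "\<And>I. finite I \<Longrightarrow> (\<forall>(u, v)\<in>I. a \<le> u \<and> u \<le> v \<and> v \<le> b) \<Longrightarrow>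
        disjoint_family_on (\<lambda>(u, v). {u<..<v}) I \<Longrightarrow> (\<Sum>(u, v)\<in>I. v - u) < d \<Longrightarrow>
        (\<Sum>(u, v)\<in>I. dist (f u) (f v)) < e"
      unfolding absolutely_continuous_on_interval_def by meson
    have "N \<in> sets lebesgue" using N by (auto simp: null_sets_def)
    \<comment> \<open>The exceptional set is enclosed in an open \<open>W\<close> whose measure is
      below the \<open>d\<close> of absolute continuity, so the intervals tagged in it have small
      total length.\<close>
    from sets_lebesgue_outer_open[OF this d] obtain W where W: "open W" "N \<subseteq> W"
      and "emeasure lebesgue (W - N) < ennreal d" by metis
    then have Od: "emeasure lborel W < ennreal d"
    proof -
      have "emeasure lebesgue (W - N) = emeasure lebesgue W"
        using N W(1) by (intro emeasure_Diff_null_set null_sets_completionI) auto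
      also have "\<dots> = emeasure lborel W" using W(1) by simp
      finally show ?thesis using \<open>emeasure lebesgue (W - N) < ennreal d\<close> by simp
    qed
    have "\<exists>\<delta>>0. \<forall>y. \<bar>y - t\<bar> < \<delta> \<longrightarrow> \<bar>f y - f t\<bar> \<le> e * \<bar>y - t\<bar>" if "t \<in> {a..b}" "t \<notin> N" for t
      using der[OF that] e
      unfolding has_field_derivative_def has_derivative_at_alt
      by (auto simp: real_norm_def)
    then obtain \<delta> where \<delta>: "\<And>t. t \<in> {a..b} \<Longrightarrow> t \<notin> N \<Longrightarrow> \<delta> t > 0"
      "\<And>t y. t \<in> {a..b} \<Longrightarrow> t \<notin> N \<Longrightarrow> \<bar>y - t\<bar> < \<delta> t \<Longrightarrow> \<bar>f y - f t\<bar> \<le> e * \<bar>y - t\<bar>" by metis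
    \<comment> \<open>A tag in \<open>N\<close> keeps its interval inside \<open>W\<close>; any
      other tag in \<open>[a, b]\<close> uses the radius on which the difference quotient is at most
      \<open>e\<close>. The last branch only makes \<open>g\<close> a gauge on the whole
      line.\<close>
    define g where "g t = (if t \<in> N then W else if t \<in> {a..b} then ball t (\<delta> t) else UNIV)" for t
    have "gauge g" using W \<delta> by (auto simp: gauge_def g_def)
    from fine_division_exists_real[OF this] obtain p where
      p: "p tagged_division_of {a..b}" and fine: "g fine p" by blast
    note pD = tagged_division_ofD[OF p]
    have ivl: "\<exists>u v. K = {u..v} \<and> Inf K = u \<and> Sup K = v \<and> a \<le> u \<and> u \<le> x \<and> x \<le> v \<and> v \<le> b \<and> {u..v} \<subseteq> g x"
      if xK: "(x, K) \<in> p" for x K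
    proof -
      obtain u v where K: "K = {u..v}" using pD(4)[OF xK] by (auto simp: cbox_interval)
      have "x \<in> {u..v}" "{u..v} \<subseteq> {a..b}" using pD(2,3)[OF xK] K by auto
      moreover have "K \<subseteq> g x" using fine xK by (auto simp: fine_def)
      ultimately show ?thesis using K by (intro exI[of _ u] exI[of _ v]) auto
    qed
    \<comment> \<open>Degenerate intervals are left out: distinct members of \<open>p1\<close> then
      have disjoint nonempty interiors, which makes the passage to pairs of end points
      injective.\<close>
    define p1 where "p1 = {(x, K) \<in> p. x \<in> N \<and> Inf K < Sup K}"
    define p2 where "p2 = p - p1"
    define I where "I = (\<lambda>(x, K). (Inf K, Sup K)) ` p1"
    have "finite p" by (rule pD(1))
    moreover have "p1 \<subseteq> p" by (auto simp: p1_def)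
    ultimately have fin: "finite p" "finite p1" "finite I"
      using finite_subset[of p1 p] by (auto simp: I_def)
    have neq: "{u<..<v} \<inter> {u'<..<v'} = {}" if "(x, K) \<in> p" "(x', K') \<in> p" "(x, K) \<noteq> (x', K')"
       "u = Inf K" "v = Sup K" "u' = Inf K'" "v' = Sup K'" for x K x' K' u v u' v'
    proof -
      have "interior K = {Inf K<..<Sup K}" if "(x, K) \<in> p" for x K
        using ivl[OF that] interior_atLeastAtMost_real by metis
      from this[OF that(1)] this[OF that(2)] pD(5)[OF that(1-3)] that(4-) show ?thesis by simp
    qed
    have inj: "inj_on (\<lambda>(x, K). (Inf K, Sup K)) p1"
    proof (rule inj_onI, clarify)
      fix x K x' K' assume *: "(x, K) \<in> p1" "(x', K') \<in> p1" "Inf K = Inf K'" "Sup K = Sup K'"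
      then have "{Inf K<..<Sup K} \<noteq> {}" by (auto simp: p1_def)
      with neq[of x K x' K' "Inf K" "Sup K" "Inf K" "Sup K"] * show "x = x' \<and> K = K'"
        by (auto simp: p1_def)
    qed
    have "(\<Sum>(u, v)\<in>I. dist (f u) (f v)) < e"
    proof (rule dI[OF fin(3)])
      show "\<forall>(u, v)\<in>I. a \<le> u \<and> u \<le> v \<and> v \<le> b"
        using ivl by (fastforce simp: I_def p1_def)
      show disj: "disjoint_family_on (\<lambda>(u, v). {u<..<v}) I"
        unfolding disjoint_family_on_def I_def using neq by (force simp: p1_def)
      show "(\<Sum>(u, v)\<in>I. v - u) < d"
      proof (rule finite_disjoint_interval_length_le[OF fin(3) _ disj _ _ Od])
        show "W \<in> sets lborel" using W by auto
        show "u \<le> v" "{u<..<v} \<subseteq> W" if "(u, v) \<in> I" for u v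
        proof -
          from that obtain x K where xK: "(x, K) \<in> p1" "u = Inf K" "v = Sup K" by (auto simp: I_def)
          then have "(x, K) \<in> p" "x \<in> N" by (auto simp: p1_def)
          with ivl[OF this(1)] xK show "u \<le> v" "{u<..<v} \<subseteq> W" by (auto simp: g_def)
        qed
      qed
    qed
    then have S1: "(\<Sum>(x, K)\<in>p1. \<bar>f (Sup K) - f (Inf K)\<bar>) < e"
      unfolding I_def using inj by (subst (asm) sum.reindex) (auto simp: o_def split_beta dist_real_def abs_minus_commute)
    have S2: "(\<Sum>(x, K)\<in>p2. \<bar>f (Sup K) - f (Inf K)\<bar>) \<le> e * (b - a)"
    proof -
      have "(\<Sum>(x, K)\<in>p2. \<bar>f (Sup K) - f (Inf K)\<bar>) \<le> (\<Sum>(x, K)\<in>p2. e * (Sup K - Inf K))"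
      proof (rule sum_mono, clarify)
        fix x K assume xK: "(x, K) \<in> p2"
        then have xp: "(x, K) \<in> p" by (auto simp: p2_def)
        from ivl[OF this] obtain u v where uv: "K = {u..v}" "Inf K = u" "Sup K = v" "a \<le> u" "u \<le> x" "x \<le> v" "v \<le> b" "{u..v} \<subseteq> g x"
          by blast
        show "\<bar>f (Sup K) - f (Inf K)\<bar> \<le> e * (Sup K - Inf K)"
        proof (cases "x \<in> N")
          case True
          \<comment> \<open>Tagged in \<open>N\<close> but not in \<open>p1\<close>: the interval is
            a single point and contributes nothing.\<close>
          then have "u = v" using xK xp uv by (auto simp: p2_def p1_def)
          then show ?thesis using uv by simp
        next
          case False
          have x: "x \<in> {a..b}" using uv by auto
          have "u \<in> ball x (\<delta> x)" "v \<in> ball x (\<delta> x)" using subsetD[OF uv(8), of u] subsetD[OF uv(8), of v] uv(5,6) False x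
            by (auto simp: g_def)
          then have "\<bar>u - x\<bar> < \<delta> x" "\<bar>v - x\<bar> < \<delta> x"
            by (auto simp: dist_real_def abs_minus_commute)
          then have "\<bar>f u - f x\<bar> \<le> e * \<bar>u - x\<bar>" "\<bar>f v - f x\<bar> \<le> e * \<bar>v - x\<bar>"
            using \<delta>(2)[OF x False] by auto
          then show ?thesis using uv(2,3,5,6) by (simp add: algebra_simps)
        qed
      qed
      also have "\<dots> \<le> (\<Sum>(x, K)\<in>p. e * (Sup K - Inf K))"
        using ivl e by (intro sum_mono2 fin) (fastforce simp: p2_def)+
      also have "\<dots> = e * (b - a)"
        using additive_tagged_division_1[OF ab p, of "\<lambda>x. x"]
        by (simp add: split_beta sum_distrib_left[symmetric])
      finally show ?thesis .
    qed
    have "f b - f a = (\<Sum>(x, K)\<in>p. f (Sup K) - f (Inf K))"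
      using additive_tagged_division_1[OF ab p, of f] by simp
    also have "\<bar>\<dots>\<bar> \<le> (\<Sum>(x, K)\<in>p. \<bar>f (Sup K) - f (Inf K)\<bar>)"
      unfolding split_beta by (rule sum_abs)
    also have "\<dots> = (\<Sum>(x, K)\<in>p1. \<bar>f (Sup K) - f (Inf K)\<bar>) + (\<Sum>(x, K)\<in>p2. \<bar>f (Sup K) - f (Inf K)\<bar>)"
      using fin(1) by (subst sum.subset_diff[of p1 p]) (auto simp: p1_def p2_def)
    finally show ?thesis using S1 S2 by linarith
  qed
  show ?thesis
  proof (rule ccontr)
    assume "f b \<noteq> f a"
    then have pos: "\<bar>f b - f a\<bar> > 0" by simp
    define l where "l = b - a + 1"
    have l: "l > 0" using ab by (simp add: l_def)
    define e where "e = \<bar>f b - f a\<bar> / (2 * l)"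
    have "e > 0" using pos l by (auto simp: e_def)
    from main[OF this] have "\<bar>f b - f a\<bar> \<le> e * l" by (simp add: l_def algebra_simps)
    also have "\<dots> = \<bar>f b - f a\<bar> / 2" using l by (simp add: e_def)
    finally show False using pos by simp
  qed
qed

section \<open>Fluid trajectories\<close>

lemma absolutely_continuous_imp_continuous_on:
  fixes f :: "real \<Rightarrow> 'a::metric_space"
  assumes "absolutely_continuous_on_interval a b f"
  shows "continuous_on {a..b} f"
  unfolding continuous_on_iff
proof (intro ballI allI impI)
  fix x e :: real assume x: "x \<in> {a..b}" and e: "e > 0"
  from assms e obtain d where d: "d > 0" and dI: "\<And>I. finite I \<Longrightarrow> (\<forall>(u, v)\<in>I. a \<le> u \<and> u \<le> v \<and> v \<le> b) \<Longrightarrow>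
        disjoint_family_on (\<lambda>(u, v). {u<..<v}) I \<Longrightarrow> (\<Sum>(u, v)\<in>I. v - u) < d \<Longrightarrow>
        (\<Sum>(u, v)\<in>I. dist (f u) (f v)) < e"
      unfolding absolutely_continuous_on_interval_def by meson
  have "dist (f y) (f x) < e" if "y \<in> {a..b}" "dist y x < d" for y
    using dI[of "{(min x y, max x y)}"] x that
    by (cases "x \<le> y") (auto simp: disjoint_family_on_def dist_real_def dist_commute)
  with d show "\<exists>d>0. \<forall>x'\<in>{a..b}. dist x' x < d \<longrightarrow> dist (f x') (f x) < e" by blast
qed

lemma absolutely_continuous_on_interval_nth:
  fixes f :: "real \<Rightarrow> real ^ 'k"
  assumes ac: "absolutely_continuous_on_interval a b f" and sub: "a \<le> a'"
  shows "absolutely_continuous_on_interval a' b (\<lambda>t. f t $ k)"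
  unfolding absolutely_continuous_on_interval_def
proof (intro allI impI)
  fix e :: real assume e: "e > 0"
  from ac e obtain d where d: "d > 0" and dI: "\<And>I. finite I \<Longrightarrow> (\<forall>(u, v)\<in>I. a \<le> u \<and> u \<le> v \<and> v \<le> b) \<Longrightarrow>
        disjoint_family_on (\<lambda>(u, v). {u<..<v}) I \<Longrightarrow> (\<Sum>(u, v)\<in>I. v - u) < d \<Longrightarrow>
        (\<Sum>(u, v)\<in>I. dist (f u) (f v)) < e"
      unfolding absolutely_continuous_on_interval_def by meson
  show "\<exists>d>0. \<forall>I. finite I \<and> (\<forall>(u, v)\<in>I. a' \<le> u \<and> u \<le> v \<and> v \<le> b) \<and>
        disjoint_family_on (\<lambda>(u, v). {u<..<v}) I \<and> (\<Sum>(u, v)\<in>I. v - u) < d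
        \<longrightarrow> (\<Sum>(u, v)\<in>I. dist (f u $ k) (f v $ k)) < e"
  proof (intro exI[of _ d] conjI d allI impI)
    fix I :: "(real \<times> real) set"
    assume I: "finite I \<and> (\<forall>(u, v)\<in>I. a' \<le> u \<and> u \<le> v \<and> v \<le> b) \<and>
        disjoint_family_on (\<lambda>(u, v). {u<..<v}) I \<and> (\<Sum>(u, v)\<in>I. v - u) < d"
    have "(\<Sum>(u, v)\<in>I. dist (f u $ k) (f v $ k)) \<le> (\<Sum>(u, v)\<in>I. dist (f u) (f v))"
      by (intro sum_mono) (auto simp: dist_vec_nth_le)
    also have "\<dots> < e" using I sub by (intro dI) force+
    finally show "(\<Sum>(u, v)\<in>I. dist (f u $ k) (f v $ k)) < e" .
  qed
qed

section \<open>Open networks and their regulated trajectories\<close>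

locale jackson =
  fixes a mu :: "real ^ 'k" and p :: "real ^ 'k ^ 'k"
  assumes a_nonneg: "0 \<le> a $ k" and mu_pos: "0 < mu $ k"
    and p_nonneg: "0 \<le> p $ k $ l" and p_sub: "(\<Sum>l\<in>UNIV. p $ k $ l) \<le> 1"

text \<open>\<open>nu\<close> solves the traffic equations. The weight \<open>v\<close> is
  superharmonic for the transposed routing matrix, whereas
  \<open>substochastic_superharmonic\<close> provides a weight \<open>w\<close> for a matrix itself;
  for the dual network the two fit together through \<open>v k = nu k * w k\<close>.\<close>

locale network = jackson a mu p
  for a mu :: "real ^ 'k" and p :: "real ^ 'k ^ 'k" +
  fixes nu v :: "real ^ 'k" and \<beta> :: real
  assumes beta: "0 \<le> \<beta>" "\<beta> < 1" and v_pos: "0 < v $ k"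
    and pv: "(\<Sum>j\<in>UNIV. p $ j $ k * v $ j) \<le> \<beta> * v $ k"
    and nu_eq: "nu $ k = a $ k + (\<Sum>j\<in>UNIV. p $ j $ k * nu $ j)"
begin

definition res :: "real ^ 'k \<Rightarrow> real ^ 'k" where
  "res y = (\<chi> k. y $ k - (\<Sum>j\<in>UNIV. p $ j $ k * y $ j))"

lemma res_nth: "res y $ k = y $ k - (\<Sum>j\<in>UNIV. p $ j $ k * y $ j)"
  by (simp add: res_def)

lemma p_le_1: "p $ j $ k \<le> 1"
  using p_sub[of j] member_le_sum[of k UNIV "\<lambda>l. p $ j $ l"] p_nonneg by force

lemma res_diff: "res (x - y) = res x - res y"
  by (simp add: vec_eq_iff res_nth algebra_simps sum_subtractf)

text \<open>At an index \<open>i\<close> maximizing \<open>x i / v i\<close>, with maximum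
  \<open>M > 0\<close>, the hypothesis yields \<open>v i * M \<le> d + \<beta> * v i * M\<close>,
  hence a bound on \<open>M\<close>. The constant depends on the network alone.\<close>

lemma max_principle:
  "\<exists>C\<ge>0. \<forall>x d. (\<forall>k. x $ k \<le> d + (\<Sum>j\<in>UNIV. p $ j $ k * x $ j)) \<longrightarrow> 0 \<le> d \<longrightarrow> (\<forall>k. x $ k \<le> C * d)"
proof -
  obtain l where l: "0 < l" "\<And>k. l \<le> v $ k" using finite_pos_lower_bound[of "\<lambda>k. v $ k", OF v_pos] by blast
  obtain i0 where i0: "\<And>k. v $ k \<le> v $ i0" using finite_max_index[of "\<lambda>k. v $ k"] by blast
  define C where "C = v $ i0 / (l * (1 - \<beta>))"
  have "x $ k \<le> C * d" if x: "\<And>k. x $ k \<le> d + (\<Sum>j\<in>UNIV. p $ j $ k * x $ j)" and d: "0 \<le> d" for x d k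
  proof -
    obtain i where i: "\<And>j. x $ j / v $ j \<le> x $ i / v $ i"
      using finite_max_index[of "\<lambda>j. x $ j / v $ j"] by blast
    define M where "M = x $ i / v $ i"
    have xM: "x $ j \<le> v $ j * M" for j
      using i[of j] v_pos[of j] by (simp add: M_def field_simps)
    have "M \<le> d / (l * (1 - \<beta>))"
    proof (cases "M \<le> 0")
      case True
      moreover have "0 \<le> d / (l * (1 - \<beta>))" using d l beta by simp
      ultimately show ?thesis by linarith
    next
      case False
      have "v $ i * M = x $ i" using v_pos[of i] by (simp add: M_def)
      also have "\<dots> \<le> d + (\<Sum>j\<in>UNIV. p $ j $ i * x $ j)" by (rule x)
      also have "\<dots> \<le> d + (\<Sum>j\<in>UNIV. p $ j $ i * (v $ j * M))"
        using xM p_nonneg by (intro add_left_mono sum_mono mult_left_mono) auto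
      also have "\<dots> = d + (\<Sum>j\<in>UNIV. p $ j $ i * v $ j) * M"
        by (simp add: sum_distrib_left mult_ac)
      also have "\<dots> \<le> d + (\<beta> * v $ i) * M"
        using pv[of i] False by (intro add_left_mono mult_right_mono) auto
      finally have "v $ i * ((1 - \<beta>) * M) \<le> d" by (simp add: algebra_simps)
      moreover have "l * ((1 - \<beta>) * M) \<le> v $ i * ((1 - \<beta>) * M)"
        using l False beta by (intro mult_right_mono) auto
      ultimately have "l * (1 - \<beta>) * M \<le> d" by (simp add: mult_ac)
      then show ?thesis using l beta by (simp add: field_simps)
    qed
    moreover have "0 \<le> d / (l * (1 - \<beta>))" using d l beta by simp
    ultimately have "v $ k * M \<le> v $ i0 * (d / (l * (1 - \<beta>)))"
      using i0[of k] v_pos[of k] by (meson less_imp_le mult_left_mono mult_right_mono order_trans)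
    then show ?thesis using xM[of k] by (simp add: C_def)
  qed
  moreover have "0 \<le> C" using l beta v_pos[of i0] by (simp add: C_def)
  ultimately show ?thesis by (intro exI[of _ C]) simp
qed

text \<open>\<open>max_principle\<close> for \<open>- y\<close> with \<open>d = 0\<close>: the
  inverse of \<open>res\<close> preserves nonnegativity.\<close>

lemma res_nonneg_imp:
  assumes "\<And>k. 0 \<le> res y $ k"
  shows "0 \<le> y $ k"
proof -
  obtain C where C: "0 \<le> C" "\<And>x d k. (\<And>k. x $ k \<le> d + (\<Sum>j\<in>UNIV. p $ j $ k * x $ j)) \<Longrightarrow> 0 \<le> d \<Longrightarrow> x $ k \<le> C * d"
    using max_principle by auto
  have "(- y) $ k \<le> C * 0"
  proof (rule C(2))
    show "(- y) $ k \<le> 0 + (\<Sum>j\<in>UNIV. p $ j $ k * (- y) $ j)" for k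
      using assms[of k] by (simp add: res_nth sum_negf)
  qed simp
  then show ?thesis by simp
qed

lemma res_0 [simp]: "res 0 = 0"
  by (simp add: vec_eq_iff res_nth)

lemma res_eq_0_iff: "res y = 0 \<longleftrightarrow> y = 0"
proof
  assume y: "res y = 0"
  have "res (- y) = 0" using res_diff[of 0 y] y by simp
  with y have "0 \<le> y $ k" "0 \<le> (- y) $ k" for k
    using res_nonneg_imp[of y k] res_nonneg_imp[of "- y" k] by auto
  then show "y = 0" by (simp add: vec_eq_iff order_antisym)
qed simp

lemma res_eq_matrix: "res y = (mat 1 - transpose p) *v y"
  by (simp add: vec_eq_iff res_nth I_minus_transpose_mult_nth)

lemma invertible_I_minus_pT: "invertible (mat 1 - transpose p)"
proof -
  have "inj ((*v) (mat 1 - transpose p))"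
    using res_eq_0_iff by (metis matrix_left_invertible_injective matrix_left_invertible_ker res_eq_matrix)
  then show ?thesis by (simp add: invertible_left_inverse matrix_left_invertible_injective)
qed

text \<open>A fluid trajectory in the coordinates \<open>y\<close> with \<open>q = (I - p\<^sup>T) y\<close>: there the
  regulator acts componentwise. The increment of the \<open>k\<close>-th component of the regulator over
  \<open>[s, t]\<close> is \<open>y t $ k - y s $ k + (mu $ k - nu $ k) * (t - s)\<close>.\<close>

definition regulated :: "(real \<Rightarrow> real ^ 'k) \<Rightarrow> real \<Rightarrow> bool" where
  "regulated y C \<longleftrightarrow>
     (\<forall>t\<ge>0. \<forall>k. 0 \<le> res (y t) $ k) \<and>
     (\<forall>s t k. 0 \<le> s \<and> s \<le> t \<longrightarrow>
        0 \<le> y t $ k - y s $ k + (mu $ k - nu $ k) * (t - s) \<and>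
        y t $ k - y s $ k + (mu $ k - nu $ k) * (t - s) \<le> C * (t - s) \<and>
        ((\<forall>u\<in>{s..t}. 0 < res (y u) $ k) \<longrightarrow> y t $ k - y s $ k + (mu $ k - nu $ k) * (t - s) = 0))"

lemma regulatedD:
  assumes "regulated y C"
  shows "0 \<le> t \<Longrightarrow> 0 \<le> res (y t) $ k"
    and "0 \<le> s \<Longrightarrow> s \<le> t \<Longrightarrow> 0 \<le> y t $ k - y s $ k + (mu $ k - nu $ k) * (t - s)"
    and "0 \<le> s \<Longrightarrow> s \<le> t \<Longrightarrow> y t $ k - y s $ k + (mu $ k - nu $ k) * (t - s) \<le> C * (t - s)"
    and "0 \<le> s \<Longrightarrow> s \<le> t \<Longrightarrow> (\<And>u. s \<le> u \<Longrightarrow> u \<le> t \<Longrightarrow> 0 < res (y u) $ k) \<Longrightarrow>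
      y t $ k - y s $ k + (mu $ k - nu $ k) * (t - s) = 0"
proof -
  note A = conjunct1[OF assms[unfolded regulated_def], rule_format]
    and B = conjunct2[OF assms[unfolded regulated_def], rule_format]
  show "0 \<le> t \<Longrightarrow> 0 \<le> res (y t) $ k" by (rule A)
  show "0 \<le> s \<Longrightarrow> s \<le> t \<Longrightarrow> 0 \<le> y t $ k - y s $ k + (mu $ k - nu $ k) * (t - s)"
    using B[of s t k] by simp
  show "0 \<le> s \<Longrightarrow> s \<le> t \<Longrightarrow> y t $ k - y s $ k + (mu $ k - nu $ k) * (t - s) \<le> C * (t - s)"
    using B[of s t k] by simp
  show "0 \<le> s \<Longrightarrow> s \<le> t \<Longrightarrow> (\<And>u. s \<le> u \<Longrightarrow> u \<le> t \<Longrightarrow> 0 < res (y u) $ k) \<Longrightarrow>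
      y t $ k - y s $ k + (mu $ k - nu $ k) * (t - s) = 0"
    using B[of s t k] by simp
qed

text \<open>Because \<open>a = res nu\<close>, applying the inverse of \<open>res\<close> to the
  fluid equation gives \<open>y\<close>, and its regulator increments are those of
  \<open>phi\<close>. Absolute continuity alone gives no speed bound; the constant \<open>C\<close>
  comes from bounding each increment of \<open>phi\<close> by a multiple of the elapsed time plus
  the routed increments, and then applying \<open>max_principle\<close>.\<close>

lemma fluid_trajectory_regulated:
  assumes "fluid_trajectory a mu p r q"
  obtains y C where "0 \<le> C" "regulated y C" "\<And>t. 0 \<le> t \<Longrightarrow> q t = res (y t)"
proof -
  from assms obtain phi where
      q: "\<And>t. t \<ge> 0 \<Longrightarrow> q t = r + t *\<^sub>R (a - (mat 1 - transpose p) *v mu) + (mat 1 - transpose p) *v phi t"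
    and q0: "\<And>t k. t \<ge> 0 \<Longrightarrow> 0 \<le> q t $ k"
    and ac: "\<And>b. b \<ge> 0 \<Longrightarrow> absolutely_continuous_on_interval 0 b phi"
    and mono: "\<And>s t k. 0 \<le> s \<Longrightarrow> s \<le> t \<Longrightarrow> phi s $ k \<le> phi t $ k"
    and compl: "AE t in lborel. t > 0 \<longrightarrow>
           (\<forall>k. \<exists>d. ((\<lambda>s. phi s $ k) has_real_derivative d) (at t) \<and> q t $ k * d = 0)"
  proof -
    from assms obtain phi where phi: "(\<forall>t\<ge>0. q t = r + t *\<^sub>R (a - (mat 1 - transpose p) *v mu)
                       + (mat 1 - transpose p) *v phi t) \<and>
        (\<forall>t\<ge>0. \<forall>k. 0 \<le> q t $ k) \<and>
        phi 0 = 0 \<and>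
        (\<forall>b\<ge>0. absolutely_continuous_on_interval 0 b phi) \<and>
        (\<forall>s t k. 0 \<le> s \<and> s \<le> t \<longrightarrow> phi s $ k \<le> phi t $ k) \<and>
        (AE t in lborel. t > 0 \<longrightarrow>
           (\<forall>k. \<exists>d. ((\<lambda>s. phi s $ k) has_real_derivative d) (at t) \<and> q t $ k * d = 0))"
      unfolding fluid_trajectory_def by (rule exE)
    show ?thesis by (rule that[of phi]) (insert phi, blast+)
  qed
  define y where "y t = matrix_inv (mat 1 - transpose p) *v r + t *\<^sub>R (nu - mu) + phi t" for t
  have a_eq: "a = (mat 1 - transpose p) *v nu"
  proof -
    have "a $ k = ((mat 1 - transpose p) *v nu) $ k" for k
      unfolding I_minus_transpose_mult_nth using nu_eq[of k] by linarith
    then show ?thesis unfolding vec_eq_iff by blast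
  qed
  have qres: "q t = res (y t)" if "t \<ge> 0" for t
  proof -
    let ?R = "mat 1 - transpose p"
    have "?R *v y t = ?R *v (matrix_inv ?R *v r) + t *\<^sub>R (?R *v nu - ?R *v mu) + ?R *v phi t"
      unfolding y_def
      by (simp only: matrix_vector_right_distrib matrix_vector_mult_diff_distrib matrix_vector_mult_scaleR)
    also have "?R *v (matrix_inv ?R *v r) = r"
      by (rule matrix_inv_mult_cancel[OF invertible_I_minus_pT])
    finally show ?thesis using q[OF that] by (simp only: res_eq_matrix a_eq)
  qed
  have inc: "y t $ k - y s $ k + (mu $ k - nu $ k) * (t - s) = phi t $ k - phi s $ k" for s t k
    by (simp add: y_def algebra_simps)
  \<comment> \<open>While \<open>q k\<close> is positive, complementarity makes the derivative of
    \<open>phi k\<close> vanish almost everywhere, and absolute continuity turns this into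
    constancy. Positivity is asked on the half-open interval only, so that \<open>s\<close> may be a
    zero of \<open>q k\<close>.\<close>
  have const: "phi t $ k = phi s $ k" if st: "0 \<le> s" "s \<le> t" and pos: "\<And>u. s < u \<Longrightarrow> u \<le> t \<Longrightarrow> 0 < q u $ k" for s t k
  proof (rule absolutely_continuous_derivative_zero_const[OF st(2)])
    show "absolutely_continuous_on_interval s t (\<lambda>t. phi t $ k)"
      using st by (intro absolutely_continuous_on_interval_nth[OF ac]) auto
    show "AE u in lborel. s < u \<and> u < t \<longrightarrow> ((\<lambda>t. phi t $ k) has_real_derivative 0) (at u)"
      using compl
    proof eventually_elim
      case (elim u)
      show ?case
      proof
        assume u: "s < u \<and> u < t"
        with elim st obtain d where d: "((\<lambda>s. phi s $ k) has_real_derivative d) (at u)" "q u $ k * d = 0"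
          by fastforce
        moreover have "d = 0" using d(2) pos[of u] u by auto
        ultimately show "((\<lambda>t. phi t $ k) has_real_derivative 0) (at u)" by simp
      qed
    qed
  qed
  have contphi: "continuous_on {0..b} phi" if "b \<ge> 0" for b
    using absolutely_continuous_imp_continuous_on[OF ac[OF that]] .
  have contq: "continuous_on {0..b} (\<lambda>t. q t $ k)" if "b \<ge> 0" for b k
  proof -
    have "continuous_on {0..b} (\<lambda>t. res (y t) $ k)"
      unfolding res_nth y_def by (intro continuous_intros contphi that)
    then show ?thesis by (rule continuous_on_eq) (simp add: qres)
  qed
  define c where "c k = a $ k - res mu $ k" for k
  have qk: "q t $ k = r $ k + t * c k + res (phi t) $ k" if "t \<ge> 0" for t k
    using q[OF that] by (simp add: c_def res_eq_matrix)
  define D where "D = (\<Sum>k\<in>UNIV. \<bar>c k\<bar>)"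
  have D: "\<bar>c k\<bar> \<le> D" for k unfolding D_def by (rule member_le_sum) auto
  have D0: "0 \<le> D" unfolding D_def by (rule sum_nonneg) auto
  have Phi: "(phi t - phi s) $ k \<le> D * (t - s) + (\<Sum>j\<in>UNIV. p $ j $ k * (phi t - phi s) $ j)"
    if st: "0 \<le> s" "s \<le> t" for s t k
  proof (cases "\<exists>u\<in>{s..t}. q u $ k = 0")
    case False
    then have "phi t $ k = phi s $ k"
      using st q0 by (intro const) (auto simp: less_le)
    then show ?thesis using mono[OF st] p_nonneg D0 st by (auto intro!: add_nonneg_nonneg sum_nonneg)
  next
    case True
    \<comment> \<open>After the last zero \<open>\<tau>\<close> of \<open>q k\<close> the regulator
      is frozen, and at \<open>\<tau>\<close> the queue is at most what it was at \<open>s\<close>.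
      The increment of \<open>phi k\<close> up to \<open>\<tau>\<close> is therefore paid by the
      drift and by the routed increments.\<close>
    define Z where "Z = {u\<in>{s..t}. q u $ k = 0}"
    have "compact Z"
    proof -
      have "closed Z" unfolding Z_def
        using contq[of t k] st by (intro continuous_closed_preimage_constant) (auto elim: continuous_on_subset)
      then have "compact ({s..t} \<inter> Z)" by (intro compact_Int_closed) auto
      moreover have "{s..t} \<inter> Z = Z" by (auto simp: Z_def)
      ultimately show ?thesis by simp
    qed
    moreover have "Z \<noteq> {}" using True by (auto simp: Z_def)
    ultimately obtain \<tau> where \<tau>: "\<tau> \<in> Z" "\<And>u. u \<in> Z \<Longrightarrow> u \<le> \<tau>"
      using compact_attains_sup[of Z] by blast
    have \<tau>s: "0 \<le> \<tau>" "s \<le> \<tau>" "\<tau> \<le> t" "q \<tau> $ k = 0" using \<tau> st by (auto simp: Z_def)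
    have pt: "phi t $ k = phi \<tau> $ k"
    proof (rule const[OF \<tau>s(1,3)])
      fix u assume "\<tau> < u" "u \<le> t"
      then have "u \<notin> Z" using \<tau>(2)[of u] by auto
      then show "0 < q u $ k" using q0[of u k] \<open>\<tau> < u\<close> \<open>u \<le> t\<close> \<tau>s by (auto simp: Z_def less_le)
    qed
    have "q \<tau> $ k - q s $ k \<le> 0" using q0[of s k] \<tau>s st by simp
    then have "(\<tau> - s) * c k + res (phi \<tau> - phi s) $ k \<le> 0"
      using qk[of \<tau> k] qk[of s k] \<tau>s st by (simp add: res_diff algebra_simps)
    then have "(phi \<tau> - phi s) $ k \<le> - ((\<tau> - s) * c k) + (\<Sum>j\<in>UNIV. p $ j $ k * (phi \<tau> - phi s) $ j)"
      by (simp add: res_nth)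
    also have "- ((\<tau> - s) * c k) \<le> D * (t - s)"
    proof -
      have "- ((\<tau> - s) * c k) \<le> (\<tau> - s) * \<bar>c k\<bar>" using mult_left_mono[of "- c k" "\<bar>c k\<bar>" "\<tau> - s"] \<tau>s by simp
      also have "\<dots> \<le> (t - s) * D" using D[of k] \<tau>s by (intro mult_mono) auto
      finally show ?thesis by (simp add: mult_ac)
    qed
    also have "(\<Sum>j\<in>UNIV. p $ j $ k * (phi \<tau> - phi s) $ j) \<le> (\<Sum>j\<in>UNIV. p $ j $ k * (phi t - phi s) $ j)"
      using \<tau>s st mono p_nonneg by (intro sum_mono mult_left_mono) auto
    finally show ?thesis using pt by simp
  qed
  obtain C where C: "0 \<le> C" "\<And>x d k. (\<And>k. x $ k \<le> d + (\<Sum>j\<in>UNIV. p $ j $ k * x $ j)) \<Longrightarrow> 0 \<le> d \<Longrightarrow> x $ k \<le> C * d"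
    using max_principle by auto
  have "regulated y (C * D)"
    unfolding regulated_def inc
  proof (intro conjI allI impI)
    show "0 \<le> res (y t) $ k" if "0 \<le> t" for t k using q0[OF that, of k] qres[OF that] by simp
    show "0 \<le> phi t $ k - phi s $ k" if "0 \<le> s \<and> s \<le> t" for s t k using mono that by simp
    show "phi t $ k - phi s $ k \<le> C * D * (t - s)" if st: "0 \<le> s \<and> s \<le> t" for s t k
      using C(2)[of "phi t - phi s" "D * (t - s)" k] Phi st D0 by (simp add: mult_ac)
    show "phi t $ k - phi s $ k = 0" if "0 \<le> s \<and> s \<le> t" "\<forall>u\<in>{s..t}. 0 < res (y u) $ k" for s t k
      using const[of s t k] that qres by simp
  qed
  then show ?thesis using that[of "C * D" y] C D0 qres by simp
qed

section \<open>Speed bounds and draining of regulated trajectories\<close>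

lemma regulated_lipschitz:
  assumes "regulated y C" "0 \<le> s" "s \<le> t"
  shows "\<bar>y t $ k - y s $ k\<bar> \<le> (\<bar>C\<bar> + \<bar>mu $ k - nu $ k\<bar>) * (t - s)"
proof -
  let ?d = "(mu $ k - nu $ k) * (t - s)"
  have "0 \<le> y t $ k - y s $ k + ?d" "y t $ k - y s $ k + ?d \<le> C * (t - s)"
    using regulatedD(2,3)[OF assms] by auto
  moreover have "\<bar>?d\<bar> \<le> \<bar>mu $ k - nu $ k\<bar> * (t - s)" using assms by (simp add: abs_mult)
  moreover have "C * (t - s) \<le> \<bar>C\<bar> * (t - s)" "0 \<le> \<bar>C\<bar> * (t - s)" using assms by (auto intro: mult_right_mono)
  ultimately show ?thesis by (simp add: distrib_right abs_le_iff)
qed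

text \<open>The constant is fixed before \<open>y\<close>: it has to serve all rescaled trajectories
  \<open>n y(t / n)\<close> at once.\<close>

lemma regulated_uniformly_lipschitz:
  "\<exists>L\<ge>0. \<forall>y s t k. regulated y C \<longrightarrow> 0 \<le> s \<longrightarrow> 0 \<le> t \<longrightarrow> \<bar>y t $ k - y s $ k\<bar> \<le> L * \<bar>t - s\<bar>"
proof -
  define L where "L = \<bar>C\<bar> + (\<Sum>k\<in>UNIV. \<bar>mu $ k - nu $ k\<bar>)"
  have Lk: "\<bar>C\<bar> + \<bar>mu $ k - nu $ k\<bar> \<le> L" for k
    unfolding L_def by (intro add_left_mono member_le_sum) auto
  have *: "\<bar>y t $ k - y s $ k\<bar> \<le> L * \<bar>t - s\<bar>" if "regulated y C" "0 \<le> s" "s \<le> t" for y s t k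
  proof -
    have "\<bar>y t $ k - y s $ k\<bar> \<le> (\<bar>C\<bar> + \<bar>mu $ k - nu $ k\<bar>) * (t - s)"
      using regulated_lipschitz[OF that] .
    also have "\<dots> \<le> L * (t - s)" using Lk that by (intro mult_right_mono) auto
    finally show ?thesis using that by simp
  qed
  have "0 \<le> L" unfolding L_def by (auto intro!: add_nonneg_nonneg sum_nonneg)
  moreover have "\<bar>y t $ k - y s $ k\<bar> \<le> L * \<bar>t - s\<bar>" if "regulated y C" "0 \<le> s" "0 \<le> t" for y s t k
    using *[of y s t k] *[of y t s k] that by (cases "s \<le> t") (auto simp: abs_minus_commute)
  ultimately show ?thesis by blast
qed

text \<open>As long as \<open>y\<close> stays away from 0, the weighted maximum of
  \<open>y k / v k\<close> decreases at rate at least \<open>c\<close>. Over a short time step a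
  component either is not regulated and decreases with its drift, or its queue hits zero, and then
  \<open>y k\<close> is at most about \<open>\<beta>\<close> times the weighted maximum, hence far
  below the bound to be maintained.\<close>

lemma regulated_reaches_zero:
  assumes reg: "regulated y C" and stable: "\<And>k. nu $ k < mu $ k"
  shows "\<exists>t\<ge>0. y t = 0"
proof (rule ccontr)
  assume "\<not> ?thesis"
  then have nz: "y t \<noteq> 0" if "t \<ge> 0" for t using that by blast
  have y0: "0 \<le> y t $ k" if "t \<ge> 0" for t k
    using regulatedD(1)[OF reg that] by (rule res_nonneg_imp)
  obtain L where L: "0 \<le> L" "\<And>s t k. 0 \<le> s \<Longrightarrow> 0 \<le> t \<Longrightarrow> \<bar>y t $ k - y s $ k\<bar> \<le> L * \<bar>t - s\<bar>"
    using regulated_uniformly_lipschitz[of C] reg by blast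
  obtain c where c: "0 < c" "\<And>k. c \<le> (mu $ k - nu $ k) / v $ k"
  proof -
    have "0 < (mu $ k - nu $ k) / v $ k" for k using stable v_pos by simp
    from finite_pos_lower_bound[of "\<lambda>k. (mu $ k - nu $ k) / v $ k", OF this] that show ?thesis by blast
  qed
  obtain l where l: "0 < l" "\<And>k. l \<le> v $ k" using finite_pos_lower_bound[of "\<lambda>k. v $ k", OF v_pos] by blast
  define V where "V = (\<Sum>k\<in>UNIV. v $ k)"
  have V: "V > 0" unfolding V_def by (intro sum_pos) (auto simp: v_pos)
  obtain i where i: "\<And>k. y 0 $ k / v $ k \<le> y 0 $ i / v $ i"
    using finite_max_index[of "\<lambda>k. y 0 $ k / v $ k"] by blast
  define m0 where "m0 = y 0 $ i / v $ i"
  have m0: "0 \<le> m0" "y 0 $ k \<le> m0 * v $ k" for k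
    using i[of k] v_pos[of k] v_pos[of i] y0[of 0 i] by (auto simp: m0_def field_simps)
  \<comment> \<open>At this time the linear bound \<open>m0 - c * T\<close> equals
    \<open>- c\<close>, which is negative.\<close>
  define T where "T = m0 / c + 1"
  have T: "T > 0" using m0 c by (simp add: T_def add_nonneg_pos)
  have cont: "continuous_on {0..T} (\<lambda>t. \<Sum>k\<in>UNIV. y t $ k)"
  proof (rule continuous_on_sum)
    fix k
    have "L-lipschitz_on {0..T} (\<lambda>t. y t $ k)"
      using L by (intro lipschitz_onI) (auto simp: dist_real_def)
    then show "continuous_on {0..T} (\<lambda>t. y t $ k)" by (rule lipschitz_on_continuous_on)
  qed
  obtain t0 where t0: "t0 \<in> {0..T}" "\<And>t. t \<in> {0..T} \<Longrightarrow> (\<Sum>k\<in>UNIV. y t0 $ k) \<le> (\<Sum>k\<in>UNIV. y t $ k)"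
    using continuous_attains_inf[OF _ _ cont] T by auto
  \<comment> \<open>By compactness the assumption that \<open>y\<close> never vanishes gives a
    positive lower bound for every \<open>M\<close> with \<open>y t k \<le> M * v k\<close> on
    \<open>[0, T]\<close>. It leaves the room \<open>(1 - \<beta>) * \<eta>\<close> for the error of
    one step.\<close>
  define \<eta> where "\<eta> = (\<Sum>k\<in>UNIV. y t0 $ k) / V"
  have "(\<Sum>k\<in>UNIV. y t0 $ k) > 0"
  proof -
    have "(\<Sum>k\<in>UNIV. y t0 $ k) \<noteq> 0"
      using nz[of t0] t0(1) y0[of t0] by (auto simp: vec_eq_iff sum_nonneg_eq_0_iff)
    then show ?thesis using sum_nonneg[of UNIV "\<lambda>k. y t0 $ k"] y0[of t0] t0(1) by force
  qed
  then have \<eta>: "\<eta> > 0" using V by (simp add: \<eta>_def)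
  have M\<eta>: "\<eta> \<le> M" if "t \<in> {0..T}" "\<And>k. y t $ k \<le> M * v $ k" for t M
  proof -
    have "(\<Sum>k\<in>UNIV. y t0 $ k) \<le> (\<Sum>k\<in>UNIV. y t $ k)" using t0 that by blast
    also have "\<dots> \<le> (\<Sum>k\<in>UNIV. M * v $ k)" using that by (intro sum_mono) auto
    also have "\<dots> = M * V" by (simp add: V_def sum_distrib_left)
    finally show ?thesis using V by (simp add: \<eta>_def field_simps)
  qed
  define K where "K = real CARD('k)"
  \<comment> \<open>Error per unit of time in the boundary case: Lipschitz errors of the
    \<open>K\<close> routed terms and of the component itself, relative to the weight, plus the
    decrease \<open>c\<close> that the induction has to deliver.\<close>
  define B where "B = L * (K + 1) / l + c"
  have B: "B > 0" using L c l by (simp add: B_def K_def add_nonneg_pos)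
  obtain n :: nat where n: "T * B / ((1 - \<beta>) * \<eta>) < real n" using reals_Archimedean2 by blast
  have npos: "real n > 0"
    using n T B \<eta> beta by (smt (verit) divide_pos_pos mult_pos_pos)
  define h where "h = T / real n"
  have h: "h > 0" "h * B \<le> (1 - \<beta>) * \<eta>"
    using n npos T \<eta> beta by (auto simp: h_def field_simps)
  have split_sum: "(\<Sum>j\<in>UNIV. p $ j $ k * (M * v $ j + X)) =
      (\<Sum>j\<in>UNIV. p $ j $ k * v $ j) * M + (\<Sum>j\<in>UNIV. p $ j $ k) * X" for M X k
    by (simp add: distrib_left sum.distrib sum_distrib_left mult_ac)
  have "j \<le> n \<Longrightarrow> y (real j * h) $ k \<le> (m0 - c * (real j * h)) * v $ k" for j k
  proof (induction j arbitrary: k)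
    case 0 then show ?case using m0 by simp
  next
    case (Suc j)
    let ?t = "real j * h" and ?t' = "real (Suc j) * h" and ?M = "m0 - c * (real j * h)"
    have tt: "?t' = ?t + h" by (simp add: algebra_simps)
    have nh: "real n * h = T" using npos by (simp add: h_def)
    have t: "0 \<le> ?t" "?t \<le> T" "?t \<le> ?t'"
      using h Suc.prems mult_right_mono[of "real j" "real n" h] nh by (auto simp: tt)
    have IH: "y ?t $ k \<le> ?M * v $ k" for k using Suc by auto
    have M: "\<eta> \<le> ?M" using IH t by (intro M\<eta>[of ?t]) auto
    show ?case
    proof (cases "\<forall>u\<in>{?t..?t'}. 0 < res (y u) $ k")
      case True
      have "y ?t' $ k - y ?t $ k + (mu $ k - nu $ k) * (?t' - ?t) = 0"
        by (rule regulatedD(4)[OF reg t(1,3)]) (use True in auto)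
      moreover have "?t' - ?t = h" by (simp add: algebra_simps)
      ultimately have "y ?t' $ k = y ?t $ k - (mu $ k - nu $ k) * h" by (simp only:)
      also have "\<dots> \<le> ?M * v $ k - (c * v $ k) * h"
        using IH[of k] c(2)[of k] v_pos[of k] h by (intro diff_mono mult_right_mono) (auto simp: field_simps)
      finally show ?thesis by (simp add: tt algebra_simps)
    next
      case False
      then obtain u where u: "?t \<le> u" "u \<le> ?t'" "res (y u) $ k \<le> 0" by (auto simp: not_less)
      have uh: "u - ?t \<le> h" "?t' - u \<le> h" using u by (auto simp: algebra_simps)
      have yu: "y u $ j \<le> ?M * v $ j + L * h" for j
      proof -
        have "\<bar>y u $ j - y ?t $ j\<bar> \<le> L * \<bar>u - ?t\<bar>" using u t by (intro L) auto
        also have "\<dots> \<le> L * h" using u(1,2) uh L(1) by (intro mult_left_mono) auto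
        finally show ?thesis using IH[of j] by linarith
      qed
      have "y ?t' $ k \<le> y u $ k + L * h"
      proof -
        have "\<bar>y ?t' $ k - y u $ k\<bar> \<le> L * \<bar>?t' - u\<bar>" using u t by (intro L) auto
        also have "\<dots> \<le> L * h" using u(1,2) uh L(1) by (intro mult_left_mono) auto
        finally show ?thesis by linarith
      qed
      also have "y u $ k \<le> (\<Sum>j\<in>UNIV. p $ j $ k * y u $ j)" using u by (simp add: res_nth)
      also have "\<dots> \<le> (\<Sum>j\<in>UNIV. p $ j $ k * (?M * v $ j + L * h))"
        using yu p_nonneg by (intro sum_mono mult_left_mono) auto
      also have "\<dots> = (\<Sum>j\<in>UNIV. p $ j $ k * v $ j) * ?M + (\<Sum>j\<in>UNIV. p $ j $ k) * (L * h)"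
        by (rule split_sum)
      also have "\<dots> \<le> (\<beta> * v $ k) * ?M + K * (L * h)"
        using pv[of k] M \<eta> L h p_le_1 sum_bounded_above[of UNIV "\<lambda>j. p $ j $ k" 1]
        by (intro add_mono mult_right_mono) (auto simp: K_def)
      finally have *: "y ?t' $ k \<le> \<beta> * v $ k * ?M + L * h * (K + 1)" by (simp add: algebra_simps)
      have "L * h * (K + 1) + c * h * v $ k \<le> v $ k * (h * B)"
      proof -
        have "L * h * (K + 1) \<le> L * h * (K + 1) / l * v $ k"
        proof -
          have "0 \<le> L * h * (K + 1)" using L(1) h(1) by (simp add: K_def)
          from mult_left_mono[OF l(2)[of k] this] show ?thesis using l(1) by (simp add: pos_le_divide_eq)
        qed
        then show ?thesis by (simp add: B_def algebra_simps)
      qed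
      also have "\<dots> \<le> v $ k * ((1 - \<beta>) * ?M)"
      proof -
        have "(1 - \<beta>) * \<eta> \<le> (1 - \<beta>) * ?M" using M beta by (intro mult_left_mono) auto
        then show ?thesis using h(2) v_pos[of k] by (intro mult_left_mono) auto
      qed
      finally show ?thesis using * by (simp add: tt algebra_simps)
    qed
  qed
  from this[of n] npos have "y T $ k \<le> (m0 - c * T) * v $ k" for k by (simp add: h_def)
  then have "\<eta> \<le> m0 - c * T" using T by (intro M\<eta>[of T]) auto
  moreover have "m0 - c * T < 0" using c by (simp add: T_def algebra_simps)
  ultimately show False using \<eta> by linarith
qed

end

section \<open>Uniformization of the Jackson network\<close>

lemma sum_UNIV_option: "(\<Sum>o'\<in>(UNIV :: 'k :: finite option set). f o') = f None + (\<Sum>k\<in>UNIV. f (Some k))"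
  by (simp add: UNIV_option_conv sum.reindex)

lemma sum_UNIV_pair: "(\<Sum>e\<in>(UNIV :: ('a :: finite \<times> 'b :: finite) set). f e) = (\<Sum>x\<in>UNIV. \<Sum>y\<in>UNIV. f (x, y))"
  by (simp add: sum.cartesian_product flip: UNIV_Times_UNIV)

lemma pmf_bind_nn_integral:
  "ennreal (pmf (bind_pmf N f) i) = (\<integral>\<^sup>+z. ennreal (pmf N z * pmf (f z) i) \<partial>count_space UNIV)"
  by (simp add: ennreal_pmf_bind nn_integral_measure_pmf ennreal_mult')

lemma pmf_bind_ge: "pmf N z * pmf (f z) i \<le> pmf (bind_pmf N f) i"
proof -
  have "ennreal (pmf N z * pmf (f z) i) \<le> ennreal (pmf (bind_pmf N f) i)"
    unfolding pmf_bind_nn_integral by (rule nn_integral_ge_point) simp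
  then show ?thesis by simp
qed

text \<open>The weight is carried through the intermediate state \<open>z\<close>, so reversal of
  kernels is compatible with composition and exchanges the order of the factors.\<close>

lemma pmf_bind_reverse:
  assumes "\<And>x z. w x * pmf (K x) z = w z * pmf (K' z) x"
    and "\<And>z y. w z * pmf (L z) y = w y * pmf (L' y) z"
    and w: "\<And>x. 0 \<le> w x"
  shows "w x * pmf (bind_pmf (K x) L) y = w y * pmf (bind_pmf (L' y) K') x"
proof -
  have "ennreal (w x * pmf (bind_pmf (K x) L) y) =
      (\<integral>\<^sup>+z. ennreal (w x * pmf (K x) z * pmf (L z) y) \<partial>count_space UNIV)"
    using w by (simp add: ennreal_mult pmf_bind_nn_integral nn_integral_cmult mult.assoc)
  also have "\<dots> = (\<integral>\<^sup>+z. ennreal (w y * pmf (L' y) z * pmf (K' z) x) \<partial>count_space UNIV)"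
  proof (intro nn_integral_cong arg_cong[of _ _ ennreal])
    fix z
    have "w x * pmf (K x) z * pmf (L z) y = pmf (K' z) x * (w z * pmf (L z) y)"
      using assms(1)[of x z] by (simp add: mult_ac)
    also have "\<dots> = w y * pmf (L' y) z * pmf (K' z) x"
      using assms(2)[of z y] by (simp add: mult_ac)
    finally show "w x * pmf (K x) z * pmf (L z) y = w y * pmf (L' y) z * pmf (K' z) x" .
  qed
  also have "\<dots> = ennreal (w y * pmf (bind_pmf (L' y) K') x)"
    using w by (simp add: ennreal_mult pmf_bind_nn_integral nn_integral_cmult mult.assoc)
  finally show ?thesis using w by (simp add: ennreal_inj)
qed

text \<open>Extends the Poisson law to rate 0, so that the kernel at time 0 is the identity.\<close>

definition pois :: "real \<Rightarrow> nat pmf" where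
  "pois t = (if t \<le> 0 then return_pmf 0 else poisson_pmf t)"

lemma pmf_pois: "0 \<le> t \<Longrightarrow> pmf (pois t) n = t ^ n / fact n * exp (- t)"
  by (cases "t = 0") (auto simp: pois_def power_0_left)

lemma pois_0 [simp]: "pois 0 = return_pmf 0"
  by (simp add: pois_def)

lemma pois_add:
  assumes "0 \<le> s" "0 \<le> t"
  shows "pois (s + t) = bind_pmf (pois s) (\<lambda>i. map_pmf ((+) i) (pois t))"
proof (rule pmf_eqI)
  fix n
  have m: "pmf (map_pmf ((+) i) (pois t)) n = (if i \<le> n then pmf (pois t) (n - i) else 0)" for i
  proof (cases "i \<le> n")
    case True
    then show ?thesis using pmf_map_inj'[of "(+) i" "pois t" "n - i"] by simp
  next
    case False
    then show ?thesis by (auto simp: pmf_eq_0_set_pmf)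
  qed
  have "pmf (bind_pmf (pois s) (\<lambda>i. map_pmf ((+) i) (pois t))) n =
      (\<Sum>i\<le>n. pmf (map_pmf ((+) i) (pois t)) n * pmf (pois s) i)"
    unfolding pmf_bind by (rule integral_measure_pmf_real) (auto simp: m split: if_splits)
  also have "\<dots> = (\<Sum>i\<le>n. (s ^ i /\<^sub>R fact i) * (t ^ (n - i) /\<^sub>R fact (n - i))) * exp (- (s + t))"
  proof -
    have e: "exp (- (s + t)) = exp (- s) * exp (- t)" by (simp flip: exp_add)
    show ?thesis unfolding sum_distrib_right e
      by (intro sum.cong) (auto simp: m pmf_pois assms divide_inverse)
  qed
  also have "(\<Sum>i\<le>n. (s ^ i /\<^sub>R fact i) * (t ^ (n - i) /\<^sub>R fact (n - i))) = (s + t) ^ n /\<^sub>R fact n"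
    by (rule exp_series_add_commuting[symmetric]) (simp add: mult.commute)
  also have "(s + t) ^ n /\<^sub>R fact n * exp (- (s + t)) = pmf (pois (s + t)) n"
    using assms by (simp add: pmf_pois divide_inverse mult_ac)
  finally show "pmf (pois (s + t)) n = pmf (bind_pmf (pois s) (\<lambda>i. map_pmf ((+) i) (pois t))) n" ..
qed

text \<open>A transition is a pair of an optional source and an optional destination node;
  \<open>None\<close> stands for the outside world.\<close>

definition unit_state :: "'k option \<Rightarrow> nat ^ 'k" where
  "unit_state d = (case d of None \<Rightarrow> 0 | Some k \<Rightarrow> axis k 1)"

definition enabled :: "'k option \<Rightarrow> nat ^ 'k \<Rightarrow> bool" where
  "enabled s x = (case s of None \<Rightarrow> True | Some k \<Rightarrow> 0 < x $ k)"

text \<open>A disabled event leaves the state as it is. These fictitious jumps make the total jump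
  rate the same in every state, which is what uniformization requires. The guard also ensures that
  the subtraction of naturals never truncates.\<close>

definition move :: "'k option \<times> 'k option \<Rightarrow> nat ^ 'k \<Rightarrow> nat ^ 'k" where
  "move e x = (if enabled (fst e) x then x - unit_state (fst e) + unit_state (snd e) else x)"

lemma unit_state_le: "enabled s x \<Longrightarrow> unit_state s $ k \<le> x $ k"
  by (cases s) (auto simp: enabled_def unit_state_def axis_def)

lemma enabled_add_unit: "enabled s (x + unit_state s)"
  by (cases s) (auto simp: enabled_def unit_state_def axis_def)

lemma move_reverse:
  "enabled s x \<and> x - unit_state s + unit_state d = y \<longleftrightarrow> enabled d y \<and> y - unit_state d + unit_state s = x"
proof -
  have "enabled d y \<and> y - unit_state d + unit_state s = x"
    if "enabled s x" "x - unit_state s + unit_state d = y" for s d and x y :: "nat ^ 'a"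
  proof -
    have "y - unit_state d + unit_state s = x"
      using unit_state_le[OF that(1)] by (simp add: vec_eq_iff flip: that(2))
    moreover have "enabled d y" using enabled_add_unit[of d "x - unit_state s"] that(2) by simp
    ultimately show ?thesis by blast
  qed
  then show ?thesis by blast
qed

section \<open>Events, jump skeleton and uniformized kernel\<close>

context jackson
begin

text \<open>The pair \<open>(None, None)\<close> gets rate 0 so that all sums may run over the whole
  finite type of events.\<close>

definition event_rate :: "'k option \<times> 'k option \<Rightarrow> real" where
  "event_rate e = (case e of (None, None) \<Rightarrow> 0 | (None, Some k) \<Rightarrow> a $ k
     | (Some k, None) \<Rightarrow> mu $ k * (1 - (\<Sum>l\<in>UNIV. p $ k $ l)) | (Some k, Some l) \<Rightarrow> mu $ k * p $ k $ l)"

definition total :: real where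
  "total = (\<Sum>k\<in>UNIV. a $ k) + (\<Sum>k\<in>UNIV. mu $ k)"

lemma total_pos: "0 < total"
  unfolding total_def by (intro add_nonneg_pos sum_nonneg sum_pos) (auto simp: a_nonneg mu_pos)

lemma event_rate_nonneg: "0 \<le> event_rate e"
  using a_nonneg mu_pos[THEN less_imp_le] p_nonneg p_sub
  by (auto simp: event_rate_def split: prod.split option.split)

lemma sum_event_rate_from: "(\<Sum>d\<in>UNIV. event_rate (Some k, d)) = mu $ k"
  by (simp add: sum_UNIV_option event_rate_def algebra_simps flip: sum_distrib_left)

lemma sum_event_rate: "(\<Sum>e\<in>UNIV. event_rate e * f e) =
    (\<Sum>k\<in>UNIV. a $ k * f (None, Some k)) +
    (\<Sum>k\<in>UNIV. \<Sum>l\<in>UNIV. mu $ k * p $ k $ l * f (Some k, Some l)) +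
    (\<Sum>k\<in>UNIV. mu $ k * (1 - (\<Sum>l\<in>UNIV. p $ k $ l)) * f (Some k, None))"
  by (simp add: sum_UNIV_pair sum_UNIV_option event_rate_def sum.distrib)

lemma sum_event_rate_total: "(\<Sum>e\<in>UNIV. event_rate e) = total"
  unfolding sum_UNIV_pair sum_UNIV_option[of "\<lambda>s. \<Sum>y\<in>UNIV. event_rate (s, y)"] sum_event_rate_from
  by (simp add: sum_UNIV_option event_rate_def total_def)

definition event_pmf :: "('k option \<times> 'k option) pmf" where
  "event_pmf = embed_pmf (\<lambda>e. event_rate e / total)"

lemma pmf_event: "pmf event_pmf e = event_rate e / total"
  unfolding event_pmf_def
proof (rule pmf_embed_pmf)
  show "0 \<le> event_rate e / total" for e using event_rate_nonneg total_pos by simp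
  have "(\<integral>\<^sup>+x. ennreal (event_rate x / total) \<partial>count_space UNIV) = ennreal (\<Sum>e\<in>UNIV. event_rate e / total)"
    using event_rate_nonneg total_pos by (subst nn_integral_count_space_finite) (auto simp: sum_ennreal)
  also have "(\<Sum>e\<in>UNIV. event_rate e / total) = 1"
    using total_pos by (simp add: sum_event_rate_total flip: sum_divide_distrib)
  finally show "(\<integral>\<^sup>+x. ennreal (event_rate x / total) \<partial>count_space UNIV) = 1" by simp
qed

definition step :: "nat ^ 'k \<Rightarrow> (nat ^ 'k) pmf" where
  "step x = map_pmf (\<lambda>e. move e x) event_pmf"

primrec steps :: "nat \<Rightarrow> nat ^ 'k \<Rightarrow> (nat ^ 'k) pmf" where
  "steps 0 x = return_pmf x"
| "steps (Suc n) x = bind_pmf (step x) (steps n)"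

text \<open>The uniformized semigroup: the skeleton is run for a Poisson number of steps of mean
  \<open>total * s\<close>.\<close>

definition kern :: "real \<Rightarrow> nat ^ 'k \<Rightarrow> (nat ^ 'k) pmf" where
  "kern s x = bind_pmf (pois (total * s)) (\<lambda>n. steps n x)"

lemma pmf_step: "pmf (step x) y = (\<Sum>e\<in>UNIV. event_rate e * of_bool (move e x = y)) / total"
proof -
  have "pmf (step x) y = (\<Sum>e\<in>(\<lambda>e. move e x) -` {y}. pmf event_pmf e)"
    by (simp add: step_def pmf_map measure_measure_pmf_finite)
  also have "\<dots> = (\<Sum>e\<in>UNIV. pmf event_pmf e * of_bool (move e x = y))"
    by (intro sum.mono_neutral_cong_left) auto
  finally show ?thesis by (simp only: pmf_event sum_divide_distrib times_divide_eq_left)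
qed

lemma nn_integral_step: "(\<integral>\<^sup>+z. f z \<partial>step x) = (\<Sum>e\<in>UNIV. f (move e x) * ennreal (event_rate e / total))"
  unfolding step_def nn_integral_map_pmf
  by (subst nn_integral_measure_pmf_support[of UNIV]) (auto simp: pmf_event)

lemma pmf_steps_Suc: "pmf (steps (Suc n) x) y = (\<Sum>e\<in>UNIV. event_rate e * pmf (steps n (move e x)) y) / total"
proof -
  have "pmf (steps (Suc n) x) y = (\<integral>z. pmf (steps n z) y \<partial>step x)" by (simp add: pmf_bind)
  also have "\<dots> = (\<integral>e. pmf (steps n (move e x)) y \<partial>event_pmf)" by (simp add: step_def)
  also have "\<dots> = (\<Sum>e\<in>UNIV. pmf (steps n (move e x)) y * pmf event_pmf e)"
    by (rule integral_measure_pmf_real) auto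
  finally show ?thesis by (simp add: pmf_event sum_divide_distrib mult_ac)
qed

lemma steps_add: "steps (m + n) x = bind_pmf (steps m x) (steps n)"
proof (induction m arbitrary: x)
  case (Suc m)
  then have "steps (m + n) = (\<lambda>x. bind_pmf (steps m x) (steps n))" by (intro ext)
  then show ?case by (simp add: bind_assoc_pmf)
qed (simp add: bind_return_pmf)

text \<open>Reversal exchanges the first and the last jump, so the recursion is needed at both
  ends.\<close>

lemma steps_Suc_right: "steps (Suc n) x = bind_pmf (steps n x) step"
proof -
  have "steps 0 = return_pmf" by (intro ext) simp
  then have "steps (Suc 0) = step" by (intro ext) (simp add: bind_return_pmf')
  then show ?thesis using steps_add[of n "Suc 0" x] by simp
qed

lemma kern_0 [simp]: "kern 0 x = return_pmf x"
  by (simp add: kern_def bind_return_pmf)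

lemma kern_add:
  assumes "0 \<le> s" "0 \<le> t"
  shows "kern (s + t) x = bind_pmf (kern s x) (kern t)"
proof -
  have "kern (s + t) x = bind_pmf (pois (total * s)) (\<lambda>i. bind_pmf (pois (total * t)) (\<lambda>j. steps (i + j) x))"
    using assms total_pos by (simp add: kern_def distrib_left pois_add bind_assoc_pmf bind_map_pmf)
  also have "\<dots> = bind_pmf (kern s x) (kern t)"
    unfolding kern_def steps_add bind_assoc_pmf
    by (intro bind_pmf_cong refl) (subst bind_commute_pmf, rule refl)
  finally show ?thesis .
qed

text \<open>Expansion of the kernel in powers of time, in the form in which it will be compared with
  an arbitrary transition function having the same rates.\<close>

lemma kern_sums:
  assumes "0 \<le> s"
  shows "(\<lambda>n. (total * s) ^ n / fact n * pmf (steps n x) y) sums (exp (total * s) * pmf (kern s x) y)"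
proof -
  have s: "0 \<le> total * s" using assms total_pos by simp
  let ?f = "\<lambda>n. pmf (pois (total * s)) n * pmf (steps n x) y"
  have int: "integrable (count_space UNIV) ?f"
  proof -
    have "integrable (measure_pmf (pois (total * s))) (\<lambda>n. pmf (steps n x) y)"
      by (rule measure_pmf.integrable_const_bound[where B = 1]) (auto simp: pmf_le_1)
    then show ?thesis unfolding measure_pmf_eq_density by (subst (asm) integrable_density) auto
  qed
  have "integral\<^sup>L (count_space UNIV) ?f = pmf (kern s x) y"
    unfolding kern_def pmf_bind measure_pmf_eq_density by (subst integral_density) auto
  with sums_integral_count_space_nat[OF int] have "?f sums pmf (kern s x) y" by simp
  from sums_mult[OF this, of "exp (total * s)"] show ?thesis
    using s by (simp add: pmf_pois mult_ac exp_minus field_simps)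
qed

lemma jackson_rate_eq: "jackson_rate a mu p x y = (\<Sum>e\<in>UNIV. event_rate e * of_bool (enabled (fst e) x \<and> move e x = y))"
  unfolding sum_event_rate jackson_rate_def
  by (intro arg_cong2[of _ _ _ _ "(+)"] sum.cong refl)
     (auto simp: enabled_def move_def unit_state_def)

lemma jackson_rate_off_diagonal: "x \<noteq> y \<Longrightarrow> jackson_rate a mu p x y = total * pmf (step x) y"
  using total_pos unfolding jackson_rate_eq pmf_step
  by (auto simp: move_def intro!: sum.cong)

end

section \<open>Transition functions and time reversal\<close>

lemma transition_functionD:
  assumes "transition_function tr"
  shows "0 \<le> t \<Longrightarrow> 0 \<le> tr t x y" "0 \<le> t \<Longrightarrow> (tr t x has_sum 1) UNIV"
    "tr 0 x y = of_bool (x = y)"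
    "0 \<le> s \<Longrightarrow> 0 \<le> t \<Longrightarrow> ((\<lambda>z. tr s x z * tr t z y) has_sum tr (s + t) x y) UNIV"
  using assms unfolding transition_function_def by blast+

lemma transition_function_le_1:
  assumes "transition_function tr" "0 \<le> t"
  shows "tr t x y \<le> 1"
  using has_sum_mono'[OF has_sum_finiteI[of "{y}" _ "tr t x"] transition_functionD(2)[OF assms]]
    transition_functionD(1)[OF assms] by auto

text \<open>Chapman-Kolmogorov truncated to a finite set \<open>F\<close>: what is lost is
  nonnegative and at most the mass that the first leg puts outside \<open>F\<close>. This allows
  limits in \<open>h\<close> to be taken in finite sums.\<close>

lemma transition_function_remainder:
  assumes tr: "transition_function tr" and h: "0 \<le> h" and s: "0 \<le> s" and F: "finite F"
  shows "0 \<le> tr (h + s) x y - (\<Sum>z\<in>F. tr h x z * tr s z y)" (is "0 \<le> ?R")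
    and "tr (h + s) x y - (\<Sum>z\<in>F. tr h x z * tr s z y) \<le> 1 - (\<Sum>z\<in>F. tr h x z)"
proof -
  note D = transition_functionD[OF tr]
  have le: "tr h x z * tr s z y \<le> tr h x z" for z
    using D(1)[OF h] transition_function_le_1[OF tr s] by (simp add: mult_left_le)
  have "(\<Sum>z\<in>F. tr h x z * tr s z y) \<le> tr (h + s) x y"
    by (rule has_sum_mono'[OF has_sum_finiteI[OF F refl] D(4)[OF h s]]) (use D(1) h s in auto)
  then show "0 \<le> ?R" by simp
  have minus: "((\<lambda>z. tr h x z * tr s z y) has_sum - (- tr (h + s) x y)) UNIV"
    using D(4)[OF h s] by simp
  have "(\<Sum>z\<in>F. tr h x z + - (tr h x z * tr s z y)) \<le> 1 + - tr (h + s) x y"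
    by (rule has_sum_mono'[OF has_sum_finiteI[OF F refl] has_sum_add[OF D(2)[OF h] has_sum_uminus[THEN iffD2, OF minus]]])
       (use le in auto)
  then show "?R \<le> 1 - (\<Sum>z\<in>F. tr h x z)" by (simp add: sum_subtractf)
qed

text \<open>Truncation to the single state \<open>x\<close>. The bound does not depend on
  \<open>s\<close>, so continuity at time 0 spreads to all times.\<close>

lemma transition_function_increment:
  assumes tr: "transition_function tr" and h: "0 \<le> h" and s: "0 \<le> s"
  shows "\<bar>tr (s + h) x y - tr s x y\<bar> \<le> 1 - tr h x x"
proof -
  note R = transition_function_remainder[OF tr h s, of "{x}" x y]
  have "0 \<le> tr h x x" "tr h x x \<le> 1" "0 \<le> tr s x y" "tr s x y \<le> 1"
    using transition_function_le_1[OF tr] transition_functionD(1)[OF tr] h s by auto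
  then have "(1 - tr h x x) * tr s x y \<le> 1 - tr h x x" "0 \<le> (1 - tr h x x) * tr s x y"
    by (auto intro: mult_left_le)
  with R show ?thesis by (simp add: add.commute[of s h] algebra_simps abs_le_iff)
qed

section \<open>The backward equation and its unique solution\<close>

context jackson
begin

context
  fixes tr :: "real \<Rightarrow> nat ^ 'k \<Rightarrow> nat ^ 'k \<Rightarrow> real"
  assumes tr: "transition_function tr" and rates: "has_transition_rates tr (jackson_rate a mu p)"
begin

lemma tr_quotient:
  "((\<lambda>h. (tr h x z - of_bool (x = z)) / h) \<longlongrightarrow>
     (if x = z then - (\<Sum>\<^sub>\<infinity>z\<in>- {x}. jackson_rate a mu p x z) else jackson_rate a mu p x z)) (at_right 0)"
  using rates unfolding has_transition_rates_def transition_functionD(3)[OF tr] by blast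

lemma tr_diagonal_tendsto: "((\<lambda>h. tr h x x) \<longlongrightarrow> 1) (at_right 0)"
proof -
  have "((\<lambda>h. h * ((tr h x x - of_bool (x = x)) / h) + 1) \<longlongrightarrow>
      0 * (if x = x then - (\<Sum>\<^sub>\<infinity>z\<in>- {x}. jackson_rate a mu p x z) else jackson_rate a mu p x x) + 1) (at_right 0)"
    by (intro tendsto_intros tr_quotient)
  then have "((\<lambda>h. h * ((tr h x x - of_bool (x = x)) / h) + 1) \<longlongrightarrow> 1) (at_right 0)" by simp
  then show ?thesis
    by (rule Lim_transform_eventually) (auto simp: eventually_at_right_less eventually_at_filter)
qed

text \<open>The base point \<open>u h\<close> may move with \<open>h\<close>: the constant
  \<open>s\<close> produces the right derivative at \<open>s\<close>, and \<open>s - h\<close> the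
  left derivative, by the same argument.\<close>

lemma tr_increment_quotient:
  assumes u: "\<forall>\<^sub>F h in at_right 0. 0 \<le> u h" and c: "\<And>z. ((\<lambda>h. tr (u h) z y) \<longlongrightarrow> c z) (at_right 0)"
  shows "((\<lambda>h. (tr (h + u h) x y - tr (u h) x y) / h) \<longlongrightarrow>
     (\<Sum>e\<in>UNIV. event_rate e * (c (move e x) - c x))) (at_right 0)"
proof -
  let ?g = "jackson_rate a mu p"
  \<comment> \<open>From \<open>x\<close> one event leads to finitely many states only; they carry
    all the rates out of \<open>x\<close>.\<close>
  define F where "F = insert x ((\<lambda>e. move e x) ` UNIV)"
  have F: "finite F" "x \<in> F" "move e x \<in> F" for e by (auto simp: F_def)
  define G where "G z = (if x = z then - (\<Sum>\<^sub>\<infinity>z\<in>- {x}. ?g x z) else ?g x z)" for z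
  have g: "?g x z = (\<Sum>e\<in>UNIV. event_rate e * of_bool (move e x = z))" if "x \<noteq> z" for z
    using jackson_rate_off_diagonal[OF that] total_pos by (simp add: pmf_step)
  have "(\<Sum>\<^sub>\<infinity>z\<in>- {x}. ?g x z) = (\<Sum>\<^sub>\<infinity>z\<in>F - {x}. ?g x z)"
  proof (rule infsum_cong_neutral)
    fix z assume "z \<in> - {x} - (F - {x})"
    then have z: "x \<noteq> z" "\<And>e. move e x \<noteq> z" using F by auto
    show "?g x z = 0" unfolding g[OF z(1)] by (simp add: z)
  qed auto
  also have "\<dots> = (\<Sum>z\<in>F - {x}. ?g x z)" using F by simp
  finally have Gx: "G x = - (\<Sum>z\<in>F - {x}. ?g x z)" by (simp add: G_def)
  have Gz: "G z = ?g x z" if "z \<in> F - {x}" for z using that by (auto simp: G_def)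
  \<comment> \<open>The generator row sums to zero on \<open>F\<close>. This both recenters the
    limit at \<open>c x\<close> and makes the mass escaping from \<open>F\<close> negligible
    compared with \<open>h\<close>.\<close>
  have sumG: "(\<Sum>z\<in>F. G z) = 0"
    using F Gx Gz by (simp add: sum.remove[of F x])
  have limit: "(\<Sum>z\<in>F. G z * c z) = (\<Sum>e\<in>UNIV. event_rate e * (c (move e x) - c x))"
  proof -
    have "(\<Sum>z\<in>F. G z * c z) = (\<Sum>z\<in>F. G z * (c z - c x))"
      using sumG by (simp add: right_diff_distrib sum_subtractf flip: sum_distrib_right)
    also have "\<dots> = (\<Sum>z\<in>F. \<Sum>e\<in>UNIV. event_rate e * (of_bool (move e x = z) * (c z - c x)))"
    proof (rule sum.cong)
      fix z assume "z \<in> F"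
      show "G z * (c z - c x) = (\<Sum>e\<in>UNIV. event_rate e * (of_bool (move e x = z) * (c z - c x)))"
      proof (cases "z = x")
        case False
        then have "G z = (\<Sum>e\<in>UNIV. event_rate e * of_bool (move e x = z))"
          using g[of z] Gz[of z] \<open>z \<in> F\<close> by auto
        then show ?thesis by (simp only: sum_distrib_right mult.assoc)
      qed simp
    qed simp
    also have "\<dots> = (\<Sum>e\<in>UNIV. event_rate e * (\<Sum>z\<in>F. of_bool (move e x = z) * (c z - c x)))"
      unfolding sum_distrib_left by (rule sum.swap)
    also have "\<dots> = (\<Sum>e\<in>UNIV. event_rate e * (c (move e x) - c x))"
    proof (intro sum.cong refl arg_cong2[of _ _ _ _ "(*)"])
      fix e
      have "(\<Sum>z\<in>F. of_bool (move e x = z) * (c z - c x)) = (\<Sum>z\<in>{move e x}. of_bool (move e x = z) * (c z - c x))"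
        using F by (intro sum.mono_neutral_right) auto
      then show "(\<Sum>z\<in>F. of_bool (move e x = z) * (c z - c x)) = c (move e x) - c x" by simp
    qed
    finally show ?thesis .
  qed
  define d where "d h z = (tr h x z - of_bool (x = z)) / h" for h z
  have d: "((\<lambda>h. d h z) \<longlongrightarrow> G z) (at_right 0)" for z
    unfolding d_def G_def by (rule tr_quotient)
  \<comment> \<open>The truncation error divided by \<open>h\<close>. It is squeezed between 0 and
    \<open>- (\<Sum>z\<in>F. d h z)\<close>, which tends to minus the row sum, that is, to
    0.\<close>
  define R where "R h = (tr (h + u h) x y - (\<Sum>z\<in>F. tr h x z * tr (u h) z y)) / h" for h
  have pos: "\<forall>\<^sub>F h in at_right 0. (0::real) < h" by (rule eventually_at_right_less)
  have mainsum: "((\<lambda>h. \<Sum>z\<in>F. d h z * tr (u h) z y) \<longlongrightarrow> (\<Sum>z\<in>F. G z * c z)) (at_right 0)"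
    by (intro tendsto_intros d c)
  have "(R \<longlongrightarrow> 0) (at_right 0)"
  proof (rule tendsto_sandwich[of "\<lambda>_. 0" R "at_right 0" "\<lambda>h. - (\<Sum>z\<in>F. d h z)"])
    have "((\<lambda>h. - (\<Sum>z\<in>F. d h z)) \<longlongrightarrow> - (\<Sum>z\<in>F. G z)) (at_right 0)"
      by (intro tendsto_intros d)
    then show "((\<lambda>h. - (\<Sum>z\<in>F. d h z)) \<longlongrightarrow> 0) (at_right 0)" by (simp add: sumG)
    show "\<forall>\<^sub>F h in at_right 0. 0 \<le> R h"
      using pos u
    proof eventually_elim
      case (elim h)
      then show ?case unfolding R_def
        using transition_function_remainder(1)[OF tr, of h "u h" F x y] F by simp
    qed
    show "\<forall>\<^sub>F h in at_right 0. R h \<le> - (\<Sum>z\<in>F. d h z)"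
      using pos u
    proof eventually_elim
      case (elim h)
      have "- (\<Sum>z\<in>F. d h z) = (1 - (\<Sum>z\<in>F. tr h x z)) / h"
        using F by (simp add: d_def sum_subtractf of_bool_def flip: sum_divide_distrib)
           (simp add: minus_divide_left)
      then show ?case unfolding R_def
        using transition_function_remainder(2)[OF tr, of h "u h" F x y] F elim
        by (simp add: divide_right_mono)
    qed
  qed auto
  from tendsto_add[OF mainsum this]
  have "((\<lambda>h. (\<Sum>z\<in>F. d h z * tr (u h) z y) + R h) \<longlongrightarrow> (\<Sum>z\<in>F. G z * c z)) (at_right 0)" by simp
  then show ?thesis unfolding limit
  proof (rule Lim_transform_eventually)
    show "\<forall>\<^sub>F h in at_right 0. (\<Sum>z\<in>F. d h z * tr (u h) z y) + R h = (tr (h + u h) x y - tr (u h) x y) / h"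
      using pos
    proof eventually_elim
      case (elim h)
      have "(\<Sum>z\<in>F. d h z * tr (u h) z y) =
          (\<Sum>z\<in>F. tr h x z * tr (u h) z y - of_bool (x = z) * tr (u h) z y) / h"
        unfolding sum_divide_distrib by (intro sum.cong) (auto simp: d_def left_diff_distrib diff_divide_distrib)
      also have "\<dots> = ((\<Sum>z\<in>F. tr h x z * tr (u h) z y) - tr (u h) x y) / h"
      proof -
        have "(\<Sum>z\<in>F. of_bool (x = z) * tr (u h) z y) = (\<Sum>z\<in>{x}. of_bool (x = z) * tr (u h) z y)"
          using F by (intro sum.mono_neutral_right) auto
        then show ?thesis by (simp add: sum_subtractf)
      qed
      finally show ?case by (simp add: R_def diff_divide_distrib)
    qed
  qed
qed

lemma tr_continuous_on: "continuous_on {0..} (\<lambda>s. tr s x y)"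
  unfolding continuous_on_iff
proof (intro ballI allI impI)
  fix s e :: real assume s: "s \<in> {0..}" and e: "0 < e"
  have "\<forall>\<^sub>F h in at_right 0. dist (tr h x x) 1 < e"
    using tr_diagonal_tendsto e by (rule tendstoD)
  then obtain b where b: "b > 0" "\<And>h. 0 < h \<Longrightarrow> h < b \<Longrightarrow> dist (tr h x x) 1 < e"
    by (auto simp: eventually_at_right_field)
  have "dist (tr t x y) (tr s x y) < e" if t: "t \<in> {0..}" "dist t s < b" for t
  proof (cases "t = s")
    case False
    define h where "h = \<bar>t - s\<bar>"
    have h: "0 < h" "h < b" using False t by (auto simp: h_def dist_real_def)
    have "\<bar>tr (min s t + h) x y - tr (min s t) x y\<bar> \<le> 1 - tr h x x"
      using s t h by (intro transition_function_increment[OF tr]) auto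
    also have "\<dots> < e" using b(2)[OF h] by (auto simp: dist_real_def)
    finally show ?thesis
      by (cases "s \<le> t") (auto simp: h_def min_def dist_real_def abs_minus_commute split: if_splits)
  qed (use e in simp)
  then show "\<exists>d>0. \<forall>t\<in>{0..}. dist t s < d \<longrightarrow> dist (tr t x y) (tr s x y) < e" using b by blast
qed

lemma tr_has_derivative:
  assumes s: "0 < s"
  shows "((\<lambda>s. tr s x y) has_real_derivative
     (\<Sum>e\<in>UNIV. event_rate e * (tr s (move e x) y - tr s x y))) (at s)"
proof -
  have lim: "((\<lambda>h. tr (s - h) z y) \<longlongrightarrow> tr s z y) (at_right 0)" for z
  proof -
    have "isCont (\<lambda>s. tr s z y) s"
    proof (rule continuous_on_interior[OF tr_continuous_on])
      have "interior {0::real..} = {0<..}" by (rule interior_Ici[where b = "-1"]) simp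
      with s show "s \<in> interior {0..}" by simp
    qed
    moreover have "((\<lambda>h. s - h) \<longlongrightarrow> s) (at_right 0)" by (auto intro!: tendsto_eq_intros)
    ultimately show ?thesis by (rule isCont_tendsto_compose)
  qed
  have "\<forall>\<^sub>F h in at_right 0. h < s" using s by (rule eventually_at_right_real[THEN eventually_mono]) auto
  then have ev: "\<forall>\<^sub>F h in at_right 0. 0 \<le> s - h" by eventually_elim simp
  show ?thesis
    unfolding DERIV_def
  proof (rule filterlim_split_at)
    show "((\<lambda>h. (tr (s + h) x y - tr s x y) / h) \<longlongrightarrow>
       (\<Sum>e\<in>UNIV. event_rate e * (tr s (move e x) y - tr s x y))) (at_right 0)"
      using tr_increment_quotient[of "\<lambda>_. s" y "\<lambda>z. tr s z y" x] s by (simp add: add.commute)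
    show "((\<lambda>h. (tr (s + h) x y - tr s x y) / h) \<longlongrightarrow>
       (\<Sum>e\<in>UNIV. event_rate e * (tr s (move e x) y - tr s x y))) (at_left 0)"
    proof -
      have eq: "(tr (s + - h) x y - tr s x y) / - h = (tr s x y - tr (s - h) x y) / h" for h
        by (cases "h = 0") (auto simp: field_simps)
      show ?thesis unfolding filterlim_at_left_to_right minus_zero eq
      using tr_increment_quotient[of "\<lambda>h. s - h" y "\<lambda>z. tr s z y" x, OF ev lim]
        by simp
    qed
  qed
qed

text \<open>The functions \<open>exp (total * s) * tr s x y\<close> and the partial sums of the uniformization
  series satisfy the same integral recursion, so they differ by a Taylor remainder.\<close>

lemma tr_taylor_bound:
  assumes "0 \<le> s" "s \<le> S"
  shows "\<bar>exp (total * s) * tr s x y - (\<Sum>m<n. (total * s) ^ m / fact m * pmf (steps m x) y)\<bar>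
    \<le> exp (total * S) * ((total * s) ^ n / fact n)"
  using assms
proof (induction n arbitrary: s x)
  case 0
  have "exp (total * s) * tr s x y \<le> exp (total * S) * 1"
    using 0 total_pos transition_function_le_1[OF tr] transition_functionD(1)[OF tr] by (intro mult_mono) auto
  then show ?case using transition_functionD(1)[OF tr 0(1), of x y] by simp
next
  case (Suc n)
  \<comment> \<open>A bound for the exponential on the whole interval up to \<open>S\<close>; being
    constant in time, it lets each induction step integrate a pure power.\<close>
  define B where "B = exp (total * S)"
  define E where "E s x = exp (total * s) * tr s x y" for s x
  define T where "T n s x = (\<Sum>m<n. (total * s) ^ m / fact m * pmf (steps m x) y)" for n s x
  have IH: "\<bar>E t z - T n t z\<bar> \<le> B * ((total * t) ^ n / fact n)" if "0 \<le> t" "t \<le> s" for t z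
    using Suc.IH[of t z] that Suc.prems by (simp add: E_def T_def B_def)
  have power_deriv: "((\<lambda>t. (total * t) ^ Suc m / fact (Suc m)) has_real_derivative
      total * ((total * t) ^ m / fact m)) (at t)" for m t
  proof -
    have "((\<lambda>t. (total * t) ^ Suc m / fact (Suc m)) has_real_derivative
        (real (Suc m) * (total * t) ^ m * total) / fact (Suc m)) (at t)"
      by (auto intro!: derivative_eq_intros simp del: power_Suc of_nat_Suc fact_Suc)
    also have "(real (Suc m) * (total * t) ^ m * total) / fact (Suc m) = total * ((total * t) ^ m / fact m)"
      by (simp add: fact_Suc del: of_nat_Suc)
    finally show ?thesis .
  qed
  have dE: "((\<lambda>t. E t x) has_real_derivative (\<Sum>e\<in>UNIV. event_rate e * E t (move e x))) (at t)"
    if "0 < t" for t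
  proof -
    have "((\<lambda>t. E t x) has_real_derivative (total * exp (total * t) * tr t x y +
        exp (total * t) * (\<Sum>e\<in>UNIV. event_rate e * (tr t (move e x) y - tr t x y)))) (at t)"
      unfolding E_def by (auto intro!: derivative_eq_intros tr_has_derivative[OF that])
    also have "total * exp (total * t) * tr t x y +
        exp (total * t) * (\<Sum>e\<in>UNIV. event_rate e * (tr t (move e x) y - tr t x y)) =
        (\<Sum>e\<in>UNIV. event_rate e * E t (move e x))"
    proof -
      have "(\<Sum>e\<in>UNIV. event_rate e * (tr t (move e x) y - tr t x y)) =
          (\<Sum>e\<in>UNIV. event_rate e * tr t (move e x) y) - total * tr t x y"
        by (simp add: right_diff_distrib sum_subtractf sum_event_rate_total flip: sum_distrib_right)
      then show ?thesis by (simp add: E_def right_diff_distrib sum_distrib_left mult_ac)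
    qed
    finally show ?thesis .
  qed
  have dT: "((\<lambda>t. T (Suc n) t x) has_real_derivative (\<Sum>e\<in>UNIV. event_rate e * T n t (move e x))) (at t)" for t
  proof -
    have eq: "T (Suc n) t x = pmf (steps 0 x) y + (\<Sum>m<n. (total * t) ^ Suc m / fact (Suc m) * pmf (steps (Suc m) x) y)" for t
      unfolding T_def by (subst sum.lessThan_Suc_shift) simp
    have "((\<lambda>t. T (Suc n) t x) has_real_derivative
        (\<Sum>m<n. total * ((total * t) ^ m / fact m) * pmf (steps (Suc m) x) y)) (at t)"
      unfolding eq by (rule derivative_eq_intros refl power_deriv)+ simp
    also have "(\<Sum>m<n. total * ((total * t) ^ m / fact m) * pmf (steps (Suc m) x) y) =
        (\<Sum>m<n. \<Sum>e\<in>UNIV. event_rate e * ((total * t) ^ m / fact m * pmf (steps m (move e x)) y))"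
    proof (intro sum.cong refl)
      fix m
      let ?c = "(total * t) ^ m / fact m"
      have "total * ?c * pmf (steps (Suc m) x) y = ?c * (\<Sum>e\<in>UNIV. event_rate e * pmf (steps m (move e x)) y)"
        using total_pos unfolding pmf_steps_Suc by simp
      also have "\<dots> = (\<Sum>e\<in>UNIV. event_rate e * (?c * pmf (steps m (move e x)) y))"
        unfolding sum_distrib_left by (intro sum.cong refl mult.left_commute)
      finally show "total * ?c * pmf (steps (Suc m) x) y =
        (\<Sum>e\<in>UNIV. event_rate e * (?c * pmf (steps m (move e x)) y))" .
    qed
    also have "\<dots> = (\<Sum>e\<in>UNIV. event_rate e * T n t (move e x))"
      unfolding T_def sum_distrib_left by (rule sum.swap)
    finally show ?thesis .
  qed
  \<comment> \<open>The antiderivative of the bound for the difference of the derivatives. Instead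
    of integrating, the proof compares: the difference minus \<open>U\<close> is nonincreasing for
    either sign of the difference.\<close>
  define U where "U t = B * ((total * t) ^ Suc n / fact (Suc n))" for t
  have dU: "(U has_real_derivative B * (total * ((total * t) ^ n / fact n))) (at t)" for t
    unfolding U_def by (intro DERIV_cmult power_deriv)
  have cont: "continuous_on {0..s} (\<lambda>t. E t x)" "continuous_on {0..s} (\<lambda>t. T (Suc n) t x)" "continuous_on {0..s} U"
  proof -
    show "continuous_on {0..s} (\<lambda>t. E t x)"
      unfolding E_def by (intro continuous_intros continuous_on_subset[OF tr_continuous_on]) auto
    show "continuous_on {0..s} (\<lambda>t. T (Suc n) t x)" using dT by (meson DERIV_isCont continuous_at_imp_continuous_on)
    show "continuous_on {0..s} U" using dU by (meson DERIV_isCont continuous_at_imp_continuous_on)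
  qed
  have dd: "\<bar>(\<Sum>e\<in>UNIV. event_rate e * E t (move e x)) - (\<Sum>e\<in>UNIV. event_rate e * T n t (move e x))\<bar>
      \<le> B * (total * ((total * t) ^ n / fact n))" if "0 < t" "t < s" for t
  proof -
    have "\<bar>(\<Sum>e\<in>UNIV. event_rate e * E t (move e x)) - (\<Sum>e\<in>UNIV. event_rate e * T n t (move e x))\<bar>
        = \<bar>\<Sum>e\<in>UNIV. event_rate e * (E t (move e x) - T n t (move e x))\<bar>"
      by (simp add: right_diff_distrib sum_subtractf)
    also have "\<dots> \<le> (\<Sum>e\<in>UNIV. event_rate e * (B * ((total * t) ^ n / fact n)))"
    proof (intro order_trans[OF sum_abs] sum_mono)
      fix e
      have "\<bar>event_rate e * (E t (move e x) - T n t (move e x))\<bar> = event_rate e * \<bar>E t (move e x) - T n t (move e x)\<bar>"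
        using event_rate_nonneg[of e] by (simp add: abs_mult)
      also have "\<dots> \<le> event_rate e * (B * ((total * t) ^ n / fact n))"
        using that by (intro mult_left_mono IH event_rate_nonneg) auto
      finally show "\<bar>event_rate e * (E t (move e x) - T n t (move e x))\<bar> \<le> event_rate e * (B * ((total * t) ^ n / fact n))" .
    qed
    also have "\<dots> = B * (total * ((total * t) ^ n / fact n))"
      unfolding sum_distrib_right[symmetric] sum_event_rate_total by (simp add: mult_ac)
    finally show ?thesis .
  qed
  have E0: "E 0 x - T (Suc n) 0 x = 0"
  proof -
    have "T (Suc n) 0 x = pmf (steps 0 x) y"
      unfolding T_def by (subst sum.lessThan_Suc_shift) simp
    then show ?thesis by (simp add: E_def transition_functionD(3)[OF tr])
  qed
  have U0: "U 0 = 0" by (simp add: U_def)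
  have "E s x - T (Suc n) s x - U s \<le> E 0 x - T (Suc n) 0 x - U 0"
  proof (rule DERIV_nonpos_imp_decreasing_open[of 0 s "\<lambda>t. E t x - T (Suc n) t x - U t"])
    show "\<exists>d. ((\<lambda>t. E t x - T (Suc n) t x - U t) has_real_derivative d) (at t) \<and> d \<le> 0" if "0 < t" "t < s" for t
      using dd[OF that] DERIV_diff[OF DERIV_diff[OF dE[OF that(1)] dT] dU] by (intro exI conjI) (assumption, linarith)
    show "continuous_on {0..s} (\<lambda>t. E t x - T (Suc n) t x - U t)" by (intro continuous_intros cont)
  qed (use Suc.prems in auto)
  moreover have "T (Suc n) s x - E s x - U s \<le> T (Suc n) 0 x - E 0 x - U 0"
  proof (rule DERIV_nonpos_imp_decreasing_open[of 0 s "\<lambda>t. T (Suc n) t x - E t x - U t"])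
    show "\<exists>d. ((\<lambda>t. T (Suc n) t x - E t x - U t) has_real_derivative d) (at t) \<and> d \<le> 0" if "0 < t" "t < s" for t
      using dd[OF that] DERIV_diff[OF DERIV_diff[OF dT dE[OF that(1)]] dU] by (intro exI conjI) (assumption, linarith)
    show "continuous_on {0..s} (\<lambda>t. T (Suc n) t x - E t x - U t)" by (intro continuous_intros cont)
  qed (use Suc.prems in auto)
  ultimately have "\<bar>E s x - T (Suc n) s x\<bar> \<le> U s" using E0 U0 by linarith
  then show ?case by (simp only: E_def T_def U_def B_def)
qed

text \<open>For fixed time the Taylor remainder of \<open>tr_taylor_bound\<close> tends to 0, so the
  uniformization series of \<open>kern_sums\<close> is the only candidate.\<close>

theorem tr_eq_kern:
  assumes s: "0 \<le> s"
  shows "tr s x y = pmf (kern s x) y"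
proof -
  let ?T = "\<lambda>n. \<Sum>m<n. (total * s) ^ m / fact m * pmf (steps m x) y"
  have "(\<lambda>n. exp (total * s) * ((total * s) ^ n / fact n)) \<longlonglongrightarrow> 0"
    unfolding divide_inverse mult.commute[of _ "inverse _"]
    by (rule tendsto_mult_right_zero[OF summable_LIMSEQ_zero[OF summable_exp]])
  then have "(\<lambda>n. exp (total * s) * tr s x y - ?T n) \<longlonglongrightarrow> 0"
    by (rule Lim_null_comparison[rotated]) (use tr_taylor_bound[OF s order_refl] in auto)
  then have "(\<lambda>n. exp (total * s) * tr s x y - (exp (total * s) * tr s x y - ?T n)) \<longlonglongrightarrow> exp (total * s) * tr s x y - 0"
    by (intro tendsto_intros)
  then have "?T \<longlonglongrightarrow> exp (total * s) * tr s x y" by simp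
  moreover have "?T \<longlonglongrightarrow> exp (total * s) * pmf (kern s x) y"
    using kern_sums[OF s] by (simp add: sums_def)
  ultimately show ?thesis using LIMSEQ_unique by fastforce
qed

end

text \<open>The state is built up by \<open>m\<close> consecutive arrivals, each being the next
  event with probability at least \<open>\<alpha>\<close>; any order of the arrivals will
  do.\<close>

lemma pmf_steps_arrivals:
  assumes \<alpha>: "0 \<le> \<alpha>" "\<And>k. \<alpha> * total \<le> a $ k" and m: "(\<Sum>k\<in>UNIV. y $ k) = m"
  shows "\<alpha> ^ m \<le> pmf (steps m x) (x + y)"
  using m
proof (induction m arbitrary: x y)
  case 0
  then have "y = 0" by (simp add: vec_eq_iff)
  then show ?case by simp
next
  case (Suc m)
  then obtain k where k: "y $ k \<noteq> 0" by (metis (no_types, lifting) nat.distinct(1) sum.neutral)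
  define y' where "y' = y - axis k 1"
  have y: "y = axis k 1 + y'" using k by (auto simp: vec_eq_iff y'_def axis_def)
  have "(\<Sum>j\<in>UNIV. y $ j) = 1 + (\<Sum>j\<in>UNIV. y' $ j)"
    unfolding y by (simp add: sum.distrib axis_def)
  then have m: "(\<Sum>j\<in>UNIV. y' $ j) = m" using Suc by simp
  let ?e = "(None, Some k) :: 'k option \<times> 'k option"
  have "\<alpha> ^ Suc m \<le> event_rate ?e / total * pmf (steps m (move ?e x)) (x + y)"
  proof -
    have "move ?e x = x + axis k 1" by (simp add: move_def enabled_def unit_state_def)
    then have "\<alpha> ^ m \<le> pmf (steps m (move ?e x)) (x + y)"
      using Suc.IH[OF m, of "x + axis k 1"] by (simp add: y add.assoc)
    moreover have "\<alpha> \<le> event_rate ?e / total" using \<alpha>(2)[of k] total_pos by (simp add: event_rate_def field_simps)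
    ultimately show ?thesis unfolding power_Suc using \<alpha>(1) by (intro mult_mono) auto
  qed
  also have "\<dots> = event_rate ?e * pmf (steps m (move ?e x)) (x + y) / total" by simp
  also have "\<dots> \<le> pmf (steps (Suc m) x) (x + y)"
    unfolding pmf_steps_Suc using total_pos event_rate_nonneg
    by (intro divide_right_mono member_le_sum) auto
  finally show ?case .
qed

text \<open>Let exactly as many events occur as there are customers in \<open>y\<close>, all of them
  arrivals. If that number \<open>m\<close> is of order \<open>t\<close>, the estimate
  \<open>m! \<le> m^m\<close> makes the cost exponential in \<open>t\<close> at most.\<close>

lemma pmf_kern_from_0_ge:
  assumes a_pos: "\<And>k. 0 < a $ k"
  shows "\<exists>C\<ge>0. \<forall>t\<ge>0. \<forall>y. real (\<Sum>k\<in>UNIV. y $ k) \<le> C0 * t \<longrightarrow> exp (- (C * t)) \<le> pmf (kern t 0) y"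
proof -
  obtain l where l: "l > 0" "\<forall>k. l \<le> a $ k" using finite_pos_lower_bound[of "\<lambda>k. a $ k", OF a_pos] by blast
  define \<alpha> where "\<alpha> = l / total"
  have \<alpha>: "0 < \<alpha>" "\<alpha> * total = l" using l total_pos by (auto simp: \<alpha>_def)
  \<comment> \<open>\<open>C1 \<ge> l\<close> makes \<open>l / C1\<close> at most 1, so that its
    powers decrease when the exponent \<open>m\<close> is replaced by its upper bound
    \<open>C1 * t\<close>.\<close>
  define C1 where "C1 = max C0 l"
  have C1: "0 < C1" "l \<le> C1" "C0 \<le> C1" using l by (auto simp: C1_def)
  define C where "C = total + C1 * ln (C1 / l)"
  have "0 \<le> C" using C1 l total_pos by (simp add: C_def)
  moreover have "exp (- (C * t)) \<le> pmf (kern t 0) y" if t: "0 \<le> t" and y: "real (\<Sum>k\<in>UNIV. y $ k) \<le> C0 * t" for t y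
  proof -
    define m where "m = (\<Sum>k\<in>UNIV. y $ k)"
    have m: "real m \<le> C1 * t" using y t C1(3) mult_right_mono[of C0 C1 t] by (simp add: m_def)
    have "exp (- (C1 * ln (C1 / l) * t)) = (l / C1) powr (C1 * t)"
      using l C1 by (simp add: powr_def ln_div algebra_simps)
    also have "\<dots> \<le> (l / C1) powr (real m)"
      using m l C1 by (intro powr_mono') auto
    also have "\<dots> = (l / C1) ^ m" using l C1 by (simp add: powr_realpow)
    also have "\<dots> \<le> (l * t) ^ m / fact m"
    proof (cases "m = 0")
      case False
      have "(l / C1) ^ m \<le> (l * t / m) ^ m"
        using False m l C1 by (intro power_mono) (auto simp: field_simps)
      also have "\<dots> = (l * t) ^ m / real (m ^ m)" by (simp add: power_divide)
      also have "\<dots> \<le> (l * t) ^ m / fact m"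
        using fact_le_power[of m, where 'a = real] l t False by (intro divide_left_mono) (auto intro!: mult_pos_pos)
      finally show ?thesis .
    qed simp
    also have "\<dots> = (total * t) ^ m / fact m * \<alpha> ^ m" by (simp flip: \<alpha>(2) add: power_mult_distrib mult_ac)
    finally have *: "exp (- (C1 * ln (C1 / l) * t)) \<le> (total * t) ^ m / fact m * \<alpha> ^ m" .
    have "exp (- (C * t)) = exp (- (total * t)) * exp (- (C1 * ln (C1 / l) * t))"
      by (simp add: C_def algebra_simps flip: exp_add)
    also have "\<dots> \<le> exp (- (total * t)) * ((total * t) ^ m / fact m * \<alpha> ^ m)"
      using * by (intro mult_left_mono) auto
    also have "\<dots> = pmf (pois (total * t)) m * \<alpha> ^ m"
      using t total_pos by (simp add: pmf_pois)
    also have "\<dots> \<le> pmf (pois (total * t)) m * pmf (steps m 0) y"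
      using pmf_steps_arrivals[of \<alpha> y m 0] \<alpha> l by (intro mult_left_mono) (auto simp: m_def)
    also have "\<dots> \<le> pmf (kern t 0) y" unfolding kern_def by (rule pmf_bind_ge)
    finally show ?thesis .
  qed
  ultimately show ?thesis by blast
qed

end

section \<open>Reversal with respect to the product weight\<close>

locale jackson_duality = fw: jackson a mu p + bw: jackson a' mu p'
  for a a' mu :: "real ^ 'k" and p p' :: "real ^ 'k ^ 'k" +
  fixes rho :: "real ^ 'k"
  assumes rho_pos: "0 < rho $ k"
    and arrivals: "a $ k = rho $ k * (mu $ k * (1 - (\<Sum>l\<in>UNIV. p' $ k $ l)))"
    and departures: "rho $ k * (mu $ k * (1 - (\<Sum>l\<in>UNIV. p $ k $ l))) = a' $ k"
    and routings: "rho $ k * (mu $ k * p $ k $ l) = rho $ l * (mu $ l * p' $ l $ k)"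
    and total_arrivals: "(\<Sum>k\<in>UNIV. a $ k) = (\<Sum>k\<in>UNIV. a' $ k)"
begin

definition wt :: "nat ^ 'k \<Rightarrow> real" where
  "wt x = (\<Prod>k\<in>UNIV. rho $ k ^ x $ k)"

definition rho_opt :: "'k option \<Rightarrow> real" where
  "rho_opt s = (case s of None \<Rightarrow> 1 | Some k \<Rightarrow> rho $ k)"

lemma wt_pos: "0 < wt x"
  unfolding wt_def by (intro prod_pos) (auto simp: rho_pos)

lemma wt_0 [simp]: "wt 0 = 1"
  by (simp add: wt_def)

lemma wt_add_unit: "wt (x + unit_state s) = rho_opt s * wt x"
proof (cases s)
  case None
  then show ?thesis by (simp add: unit_state_def rho_opt_def)
next
  case (Some k)
  have "wt (x + axis k 1) = (\<Prod>j\<in>UNIV. rho $ j ^ x $ j) * (\<Prod>j\<in>UNIV. rho $ j ^ (axis k 1 $ j))"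
    by (simp add: wt_def power_add prod.distrib)
  also have "(\<Prod>j\<in>UNIV. rho $ j ^ (axis k 1 $ j)) = (\<Prod>j\<in>{k}. rho $ j ^ (axis k 1 $ j))"
    by (rule prod.mono_neutral_right) (auto simp: axis_def)
  finally show ?thesis using Some by (simp add: unit_state_def rho_opt_def wt_def)
qed

text \<open>With a common uniformization rate, the same Poisson number of jumps serves both
  networks, and only the skeletons have to be reversed.\<close>

lemma total_eq: "fw.total = bw.total"
  by (simp add: fw.total_def bw.total_def total_arrivals)

text \<open>Giving the outside world the weight 1 merges the balance relations for arrivals,
  departures and routing into one identity for all source and destination pairs.\<close>

lemma event_rate_reverse: "rho_opt s * fw.event_rate (s, d) = rho_opt d * bw.event_rate (d, s)"
  using arrivals departures routings
  by (cases s; cases d) (auto simp: rho_opt_def fw.event_rate_def bw.event_rate_def)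

text \<open>An enabled event from \<open>s\<close> to \<open>d\<close> passes through the state
  \<open>z\<close> with the moving customer removed; then \<open>x\<close> and \<open>y\<close> have
  weights \<open>rho_opt s * wt z\<close> and \<open>rho_opt d * wt z\<close>, and the identity
  reduces to \<open>event_rate_reverse\<close>. Fictitious jumps are compared in total rather than
  one by one.\<close>

lemma step_reverse: "wt x * pmf (fw.step x) y = wt y * pmf (bw.step y) x"
proof -
  let ?en = "\<lambda>s d x y. enabled s x \<and> x - unit_state s + unit_state d = y"
  have split: "event_rate (s, d) * of_bool (move (s, d) x = y) =
      event_rate (s, d) * of_bool (?en s d x y) + of_bool (x = y) * (event_rate (s, d) * of_bool (\<not> enabled s x))"
    for event_rate :: "'k option \<times> 'k option \<Rightarrow> real" and s d x y
    by (auto simp: move_def)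
  \<comment> \<open>Events with source \<open>k\<close> have total rate \<open>mu k\<close> in
    either network, so the rate of fictitious jumps at a state is the same for both.\<close>
  have blocked: "(\<Sum>s\<in>UNIV. \<Sum>d\<in>UNIV. fw.event_rate (s, d) * of_bool (\<not> enabled s x)) =
      (\<Sum>s\<in>UNIV. \<Sum>d\<in>UNIV. bw.event_rate (s, d) * of_bool (\<not> enabled s x))" for x
    unfolding sum_distrib_right[symmetric]
      sum_UNIV_option[of "\<lambda>s. (\<Sum>d\<in>UNIV. fw.event_rate (s, d)) * of_bool (\<not> enabled s x)"]
      sum_UNIV_option[of "\<lambda>s. (\<Sum>d\<in>UNIV. bw.event_rate (s, d)) * of_bool (\<not> enabled s x)"]
      fw.sum_event_rate_from bw.sum_event_rate_from by (simp add: enabled_def)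
  have termwise: "wt x * (fw.event_rate (s, d) * of_bool (?en s d x y)) = wt y * (bw.event_rate (d, s) * of_bool (?en d s y x))"
    for s d
  proof (cases "?en s d x y")
    case True
    define z where "z = x - unit_state s"
    have y: "y = z + unit_state d" using True by (simp add: z_def)
    have x: "x = z + unit_state s" using unit_state_le[of s x] True by (simp add: z_def vec_eq_iff)
    have "wt x * fw.event_rate (s, d) = wt z * (rho_opt s * fw.event_rate (s, d))"
      by (simp add: x wt_add_unit)
    also have "\<dots> = wt y * bw.event_rate (d, s)"
      by (simp add: event_rate_reverse y wt_add_unit)
    finally show ?thesis using True move_reverse[of s x d y] by simp
  next
    case False
    then show ?thesis using move_reverse[of s x d y] by auto
  qed
  have "wt x * (\<Sum>e\<in>UNIV. fw.event_rate e * of_bool (move e x = y)) =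
      (\<Sum>s\<in>UNIV. \<Sum>d\<in>UNIV. wt x * (fw.event_rate (s, d) * of_bool (?en s d x y))) +
      wt x * of_bool (x = y) * (\<Sum>s\<in>UNIV. \<Sum>d\<in>UNIV. fw.event_rate (s, d) * of_bool (\<not> enabled s x))"
    unfolding sum_UNIV_pair split by (simp only: sum.distrib sum_distrib_left distrib_left mult.assoc)
  also have "(\<Sum>s\<in>UNIV. \<Sum>d\<in>UNIV. wt x * (fw.event_rate (s, d) * of_bool (?en s d x y))) =
      (\<Sum>d\<in>UNIV. \<Sum>s\<in>UNIV. wt y * (bw.event_rate (d, s) * of_bool (?en d s y x)))"
    unfolding termwise by (rule sum.swap)
  also have "wt x * of_bool (x = y) * (\<Sum>s\<in>UNIV. \<Sum>d\<in>UNIV. fw.event_rate (s, d) * of_bool (\<not> enabled s x)) =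
      wt y * of_bool (y = x) * (\<Sum>s\<in>UNIV. \<Sum>d\<in>UNIV. bw.event_rate (s, d) * of_bool (\<not> enabled s y))"
    unfolding blocked by auto
  also have "(\<Sum>d\<in>UNIV. \<Sum>s\<in>UNIV. wt y * (bw.event_rate (d, s) * of_bool (?en d s y x))) + \<dots> =
      wt y * (\<Sum>e\<in>UNIV. bw.event_rate e * of_bool (move e y = x))"
    unfolding sum_UNIV_pair split by (simp only: sum.distrib sum_distrib_left distrib_left mult.assoc)
  finally show ?thesis unfolding fw.pmf_step bw.pmf_step total_eq by simp
qed

lemma steps_reverse: "wt x * pmf (fw.steps n x) y = wt y * pmf (bw.steps n y) x"
proof (induction n arbitrary: x y)
  case (Suc n)
  have "wt x * pmf (fw.steps (Suc n) x) y = wt x * pmf (bind_pmf (fw.step x) (fw.steps n)) y" by simp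
  also have "\<dots> = wt y * pmf (bind_pmf (bw.steps n y) bw.step) x"
    by (rule pmf_bind_reverse) (use step_reverse Suc.IH wt_pos[THEN less_imp_le] in auto)
  finally show ?case by (simp only: bw.steps_Suc_right)
qed (auto split: split_indicator)

theorem kern_reverse:
  "wt x * pmf (fw.kern s x) y = wt y * pmf (bw.kern s y) x"
proof -
  have "ennreal (wt x * pmf (fw.kern s x) y) = (\<integral>\<^sup>+n. ennreal (wt x * pmf (fw.steps n x) y) \<partial>pois (fw.total * s))"
    unfolding fw.kern_def using wt_pos[of x] by (simp add: ennreal_mult ennreal_pmf_bind nn_integral_cmult)
  also have "\<dots> = (\<integral>\<^sup>+n. ennreal (wt y * pmf (bw.steps n y) x) \<partial>pois (bw.total * s))"
    by (simp add: steps_reverse total_eq)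
  also have "\<dots> = ennreal (wt y * pmf (bw.kern s y) x)"
    unfolding bw.kern_def using wt_pos[of y] by (simp add: ennreal_mult ennreal_pmf_bind nn_integral_cmult)
  finally show ?thesis using wt_pos[of x] wt_pos[of y] by (simp add: ennreal_inj)
qed

end

section \<open>The Lyapunov function of the fluid deviation\<close>

definition vec_of :: "nat ^ 'k \<Rightarrow> real ^ 'k" where
  "vec_of x = (\<chi> k. real (x $ k))"

lemma vec_of_nth [simp]: "vec_of x $ k = real (x $ k)"
  by (simp add: vec_of_def)

lemma exp_le_quadratic:
  fixes x :: real
  assumes "\<bar>x\<bar> \<le> 1"
  shows "exp x \<le> 1 + x + x\<^sup>2"
proof (cases "0 \<le> x")
  case True
  then show ?thesis using assms by (intro exp_bound) auto
next
  case False
  have "1 \<le> (1 - x) * (1 + x + x\<^sup>2)"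
  proof -
    have "(1 - x) * (1 + x + x\<^sup>2) = 1 + (- x) * x\<^sup>2" by (simp add: power2_eq_square algebra_simps)
    moreover have "0 \<le> (- x) * x\<^sup>2" using False by (intro mult_nonneg_nonneg) auto
    ultimately show ?thesis by simp
  qed
  moreover have "0 < 1 - x" "1 - x \<le> exp (- x)" using False exp_ge_add_one_self[of "- x"] by auto
  ultimately have "1 \<le> exp (- x) * (1 + x + x\<^sup>2)"
    by (smt (verit) mult_right_mono zero_less_mult_pos)
  then have "exp x * 1 \<le> exp x * (exp (- x) * (1 + x + x\<^sup>2))" by (intro mult_left_mono) auto
  then show ?thesis by (simp add: mult.assoc[symmetric] flip: exp_add)
qed

text \<open>The left side is a Poisson average of mean \<open>T\<close>: the series of
  \<open>exp (3 * T)\<close> with its first order term replaced by \<open>T * (1 + r)\<close>. The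
  constant 11 is 9 from the second order term of \<open>exp (3 * T)\<close> plus 2 from dropping
  \<open>exp (- T)\<close> in front of \<open>T * r\<close>.\<close>

lemma exp_le_linear_quadratic:
  fixes t r T :: real
  assumes r: "\<bar>r\<bar> \<le> 2" and T: "0 \<le> T" "3 * T \<le> 1"
  shows "exp (- T) * (exp (3 * T) + T * (1 + r) - 3 * T) \<le> exp (T * r + 11 * T\<^sup>2)"
proof -
  have "exp (3 * T) \<le> 1 + 3 * T + (3 * T)\<^sup>2" using T by (intro exp_bound) auto
  then have "exp (- T) * (exp (3 * T) + T * (1 + r) - 3 * T) \<le> exp (- T) * (1 + T + T * r + 9 * T\<^sup>2)"
    by (intro mult_left_mono) (auto simp: power2_eq_square algebra_simps)
  also have "\<dots> = exp (- T) * (1 + T) + exp (- T) * (T * r) + exp (- T) * (9 * T\<^sup>2)"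
    by (simp add: algebra_simps)
  also have "exp (- T) * (1 + T) \<le> 1"
    using exp_ge_add_one_self[of T] by (simp add: exp_minus field_simps)
  also have "exp (- T) * (9 * T\<^sup>2) \<le> 9 * T\<^sup>2"
    using T by (intro mult_left_le_one_le) auto
  also have "exp (- T) * (T * r) \<le> T * r + 2 * T\<^sup>2"
  proof -
    have e: "0 \<le> 1 - exp (- T)" "1 - exp (- T) \<le> T" using exp_ge_add_one_self[of "- T"] T by auto
    have "- ((1 - exp (- T)) * (T * r)) \<le> \<bar>(1 - exp (- T)) * (T * r)\<bar>" by simp
    also have "\<dots> = (1 - exp (- T)) * (T * \<bar>r\<bar>)" using e T by (simp add: abs_mult)
    also have "\<dots> \<le> T * (T * 2)" using e T r by (intro mult_mono mult_left_mono) auto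
    finally show ?thesis by (simp add: algebra_simps power2_eq_square)
  qed
  finally have "exp (- T) * (exp (3 * T) + T * (1 + r) - 3 * T) \<le> 1 + (T * r + 11 * T\<^sup>2)" by simp
  also have "\<dots> \<le> exp (T * r + 11 * T\<^sup>2)" by (rule exp_ge_add_one_self)
  finally show ?thesis .
qed

section \<open>Exponential moments over a short time\<close>

context jackson
begin

lemma nn_integral_exp_steps_le:
  fixes f :: "nat ^ 'k \<Rightarrow> real"
  assumes \<Delta>: "\<And>e z. f (move e z) \<le> f z + \<delta>"
  shows "(\<integral>\<^sup>+z. ennreal (exp (f z)) \<partial>steps n x) \<le> ennreal (exp (f x) * exp \<delta> ^ n)"
proof (induction n arbitrary: x)
  case 0
  then show ?case by simp
next
  case (Suc n)
  have "(\<integral>\<^sup>+z. ennreal (exp (f z)) \<partial>steps (Suc n) x) \<le> (\<integral>\<^sup>+y. ennreal (exp (f y) * exp \<delta> ^ n) \<partial>step x)"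
    using Suc.IH by (auto intro!: nn_integral_mono)
  also have "\<dots> = (\<integral>\<^sup>+e. ennreal (exp (f (move e x)) * exp \<delta> ^ n) \<partial>event_pmf)" by (simp add: step_def)
  also have "\<dots> \<le> (\<integral>\<^sup>+e. ennreal (exp (f x) * exp \<delta> ^ Suc n) \<partial>event_pmf)"
  proof (intro nn_integral_mono ennreal_leI)
    fix e
    have "exp (f (move e x)) \<le> exp (f x) * exp \<delta>" using \<Delta>[of e x] by (simp flip: exp_add)
    then show "exp (f (move e x)) * exp \<delta> ^ n \<le> exp (f x) * exp \<delta> ^ Suc n" by simp
  qed
  also have "\<dots> = ennreal (exp (f x) * exp \<delta> ^ Suc n)" by (simp add: measure_pmf.emeasure_space_1)
  finally show ?case .
qed

text \<open>To first order in \<open>h\<close> the exponent grows by the generator applied to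
  \<open>f\<close> plus the second order term of a single jump. The error of order
  \<open>h\<^sup>2\<close> disappears when a given time is cut into many pieces.\<close>

lemma nn_integral_exp_kern_le:
  fixes f :: "nat ^ 'k \<Rightarrow> real"
  assumes \<Delta>: "\<And>e z. \<bar>f (move e z) - f z\<bar> \<le> \<delta>" and \<delta>: "\<delta> \<le> 1"
    and h: "0 \<le> h" "3 * (total * h) \<le> 1"
  shows "(\<integral>\<^sup>+z. ennreal (exp (f z)) \<partial>kern h x) \<le>
    ennreal (exp (f x + h * (\<Sum>e\<in>UNIV. event_rate e * (f (move e x) - f x)) + total * \<delta>\<^sup>2 * h + 11 * (total * h)\<^sup>2))"
proof -
  define T where "T = total * h"
  define m where "m = (\<Sum>e\<in>UNIV. event_rate e * (f (move e x) - f x)) / total"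
  define r where "r = m + \<delta>\<^sup>2"
  have T: "0 \<le> T" "3 * T \<le> 1" using h total_pos by (auto simp: T_def)
  have \<delta>0: "0 \<le> \<delta>" using \<Delta>[of undefined undefined] by linarith
  have \<Delta>1: "\<bar>f (move e z) - f z\<bar> \<le> 1" for e z using \<Delta>[of e z] \<delta> by linarith
  have "\<bar>\<Sum>e\<in>UNIV. event_rate e * (f (move e x) - f x)\<bar> \<le> (\<Sum>e\<in>UNIV. event_rate e * 1)"
    using \<Delta>1 event_rate_nonneg
    by (intro order_trans[OF sum_abs] sum_mono) (auto simp: abs_mult intro!: mult_left_le)
  then have m: "\<bar>m\<bar> \<le> 1" using total_pos by (simp add: m_def sum_event_rate_total)
  have \<delta>2: "0 \<le> \<delta>\<^sup>2" "\<delta>\<^sup>2 \<le> 1" using \<delta>0 \<delta> by (auto simp: power_le_one)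
  have r: "\<bar>r\<bar> \<le> 2" "0 \<le> 1 + r" using m \<delta>2 unfolding r_def by linarith+
  \<comment> \<open>Only the average over one jump has to be precise. Two or more jumps are bounded
    by \<open>exp 1 \<le> 3\<close> per jump, since they occur with probability of order
    \<open>T\<^sup>2\<close>.\<close>
  define g where "g n = (if n = 0 then 1 else if n = 1 then 1 + r else 3 ^ n)" for n :: nat
  have g0: "0 \<le> g n" for n using r by (simp add: g_def)
  have one: "(\<integral>\<^sup>+z. ennreal (exp (f z)) \<partial>step x) \<le> ennreal (exp (f x) * (1 + r))"
  proof -
    have "(\<integral>\<^sup>+z. ennreal (exp (f z)) \<partial>step x) = (\<Sum>e\<in>UNIV. ennreal (exp (f (move e x)) * (event_rate e / total)))"
      unfolding nn_integral_step using event_rate_nonneg total_pos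
      by (intro sum.cong refl ennreal_mult[symmetric]) auto
    also have "\<dots> = ennreal (\<Sum>e\<in>UNIV. exp (f (move e x)) * (event_rate e / total))"
      using event_rate_nonneg total_pos by (intro sum_ennreal) auto
    also have "\<dots> \<le> ennreal (exp (f x) * (1 + r))"
    proof (rule ennreal_leI)
      have "(\<Sum>e\<in>UNIV. exp (f (move e x)) * (event_rate e / total)) \<le>
          (\<Sum>e\<in>UNIV. exp (f x) * (1 + (f (move e x) - f x) + \<delta>\<^sup>2) * (event_rate e / total))"
      proof (intro sum_mono mult_right_mono)
        fix e
        let ?d = "f (move e x) - f x"
        have "exp ?d \<le> 1 + ?d + ?d\<^sup>2" using \<Delta>1[of e x] by (rule exp_le_quadratic)
        also have "?d\<^sup>2 \<le> \<delta>\<^sup>2" using \<Delta>[of e x] by (metis abs_ge_zero power2_abs power_mono)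
        finally have "exp (f x) * exp ?d \<le> exp (f x) * (1 + ?d + \<delta>\<^sup>2)" by simp
        then show "exp (f (move e x)) \<le> exp (f x) * (1 + ?d + \<delta>\<^sup>2)" by (simp flip: exp_add)
      qed (use event_rate_nonneg total_pos in simp)
      also have "\<dots> = (\<Sum>e\<in>UNIV. exp (f x) * (1 + \<delta>\<^sup>2) / total * event_rate e + exp (f x) / total * (event_rate e * (f (move e x) - f x)))"
        using total_pos by (intro sum.cong refl) (simp add: field_simps)
      also have "\<dots> = exp (f x) * (1 + \<delta>\<^sup>2) / total * total + exp (f x) / total * (m * total)"
        unfolding sum.distrib sum_distrib_left[symmetric] sum_event_rate_total using total_pos by (simp add: m_def)
      also have "\<dots> = exp (f x) * (1 + r)" using total_pos by (simp add: r_def field_simps)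
      finally show "(\<Sum>e\<in>UNIV. exp (f (move e x)) * (event_rate e / total)) \<le> exp (f x) * (1 + r)" .
    qed
    finally show ?thesis .
  qed
  have steps_le: "(\<integral>\<^sup>+z. ennreal (exp (f z)) \<partial>steps n x) \<le> ennreal (exp (f x) * g n)" for n
  proof -
    consider "n = 0" | "n = 1" | "n \<ge> 2" by linarith
    then show ?thesis
    proof cases
      case 2
      have "steps 1 x = step x"
        using steps_Suc_right[of 0 x] by (simp add: bind_return_pmf)
      then show ?thesis using 2 one by (simp add: g_def)
    next
      case 3
      have "f (move e z) \<le> f z + 1" for e z using \<Delta>1[of e z] by linarith
      then have "(\<integral>\<^sup>+z. ennreal (exp (f z)) \<partial>steps n x) \<le> ennreal (exp (f x) * exp 1 ^ n)"
        by (rule nn_integral_exp_steps_le)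
      also have "\<dots> \<le> ennreal (exp (f x) * 3 ^ n)"
        using exp_le by (intro ennreal_leI mult_left_mono power_mono) auto
      finally show ?thesis using 3 by (simp add: g_def)
    qed (simp add: g_def)
  qed
  have series: "(\<lambda>n. T ^ n / fact n * g n) sums (exp (3 * T) + (T * (1 + r) - 3 * T))"
  proof -
    have "(\<lambda>n. (3 * T) ^ n /\<^sub>R fact n + (if n = 1 then T * (1 + r) - 3 * T else 0)) sums (exp (3 * T) + (T * (1 + r) - 3 * T))"
      by (intro sums_add exp_converges sums_single)
    moreover have "(3 * T) ^ n /\<^sub>R fact n + (if n = 1 then T * (1 + r) - 3 * T else 0) = T ^ n / fact n * g n" for n
      by (auto simp: g_def power_mult_distrib divide_inverse mult_ac)
    ultimately show ?thesis by simp
  qed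
  have "(\<integral>\<^sup>+z. ennreal (exp (f z)) \<partial>kern h x) \<le> (\<integral>\<^sup>+n. ennreal (exp (f x) * g n) \<partial>pois T)"
    unfolding kern_def T_def using steps_le by (auto intro!: nn_integral_mono)
  also have "\<dots> = (\<integral>\<^sup>+n. ennreal (exp (f x) * exp (- T) * (T ^ n / fact n * g n)) \<partial>count_space UNIV)"
    unfolding nn_integral_measure_pmf
    by (intro nn_integral_cong) (use T g0 in \<open>simp add: pmf_pois mult_ac flip: ennreal_mult\<close>)
  also have "\<dots> = ennreal (exp (f x) * exp (- T) * (exp (3 * T) + (T * (1 + r) - 3 * T)))"
    unfolding nn_integral_count_space_nat
  proof (rule suminf_ennreal_eq)
    show "0 \<le> exp (f x) * exp (- T) * (T ^ i / fact i * g i)" for i using T g0 by simp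
    show "(\<lambda>i. exp (f x) * exp (- T) * (T ^ i / fact i * g i)) sums
        (exp (f x) * exp (- T) * (exp (3 * T) + (T * (1 + r) - 3 * T)))"
      by (rule sums_mult[OF series])
  qed
  also have "\<dots> \<le> ennreal (exp (f x) * exp (T * r + 11 * T\<^sup>2))"
    using exp_le_linear_quadratic[OF r(1) T] by (intro ennreal_leI) (simp add: mult.assoc add_diff_eq)
  also have "exp (f x) * exp (T * r + 11 * T\<^sup>2) =
      exp (f x + h * (\<Sum>e\<in>UNIV. event_rate e * (f (move e x) - f x)) + total * \<delta>\<^sup>2 * h + 11 * (total * h)\<^sup>2)"
    using total_pos by (simp add: r_def m_def T_def algebra_simps flip: exp_add)
  finally show ?thesis .
qed

end

section \<open>Drift in decoupled coordinates and the one-step estimate\<close>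

context network
begin

definition coord :: "nat ^ 'k \<Rightarrow> real ^ 'k" where
  "coord x = matrix_inv (mat 1 - transpose p) *v vec_of x"

lemma res_coord: "res (coord x) = vec_of x"
  by (simp add: coord_def res_eq_matrix matrix_inv_mult_cancel[OF invertible_I_minus_pT])

lemma res_inject: "res x = res y \<Longrightarrow> x = y"
  using res_eq_0_iff[of "x - y"] by (simp add: res_diff)

lemma linear_res: "linear res"
  unfolding res_eq_matrix[abs_def] by (rule matrix_vector_mul_linear)

lemma vec_of_drift:
  "(\<Sum>e\<in>UNIV. event_rate e *\<^sub>R (vec_of (move e x) - vec_of x)) = res (nu - (\<chi> k. if 0 < x $ k then mu $ k else 0))"
  (is "?l = res (nu - ?D)")
proof -
  have "?l $ j = res (nu - ?D) $ j" for j
  proof -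
    have vec: "(vec_of (move e x) - vec_of x) $ j =
        of_bool (enabled (fst e) x) * of_bool (snd e = Some j) - of_bool (enabled (fst e) x) * of_bool (fst e = Some j)" for e
    proof -
      obtain s d where e: "e = (s, d)" by (cases e)
      have u: "unit_state o' $ j = of_bool (o' = Some j)" for o'
        by (cases o') (auto simp: unit_state_def axis_def)
      show ?thesis using unit_state_le[of s x j]
        by (auto simp: e move_def u of_nat_diff)
    qed
    have "?l $ j = (\<Sum>e\<in>UNIV. event_rate e * (of_bool (enabled (fst e) x) * of_bool (snd e = Some j))) -
        (\<Sum>e\<in>UNIV. event_rate e * (of_bool (enabled (fst e) x) * of_bool (fst e = Some j)))"
      by (simp only: sum_component vector_scaleR_component real_scaleR_def vec right_diff_distrib sum_subtractf)
    also have "(\<Sum>e\<in>UNIV. event_rate e * (of_bool (enabled (fst e) x) * of_bool (snd e = Some j))) =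
        a $ j + (\<Sum>k\<in>UNIV. p $ k $ j * ?D $ k)"
    proof -
      have 1: "(\<Sum>k\<in>UNIV. a $ k * (of_bool (k = j))) = a $ j"
        by simp
      have 2: "(\<Sum>k\<in>UNIV. \<Sum>l\<in>UNIV. mu $ k * p $ k $ l * (of_bool (0 < x $ k) * of_bool (l = j))) =
          (\<Sum>k\<in>UNIV. p $ k $ j * ?D $ k)"
      proof (rule sum.cong[OF refl])
        fix k
        have "(\<Sum>l\<in>UNIV. mu $ k * p $ k $ l * (of_bool (0 < x $ k) * of_bool (l = j))) =
            (\<Sum>l\<in>{j}. mu $ k * p $ k $ l * (of_bool (0 < x $ k) * of_bool (l = j)))"
          by (intro sum.mono_neutral_right) auto
        then show "(\<Sum>l\<in>UNIV. mu $ k * p $ k $ l * (of_bool (0 < x $ k) * of_bool (l = j))) = p $ k $ j * ?D $ k"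
          by simp
      qed
      show ?thesis unfolding sum_event_rate by (simp add: enabled_def 1 2)
    qed
    also have "(\<Sum>e\<in>UNIV. event_rate e * (of_bool (enabled (fst e) x) * of_bool (fst e = Some j))) = ?D $ j"
    proof -
      have "(\<Sum>e\<in>UNIV. event_rate e * (of_bool (enabled (fst e) x) * of_bool (fst e = Some j))) =
          (\<Sum>s\<in>UNIV. (\<Sum>d\<in>UNIV. event_rate (s, d)) * (of_bool (enabled s x) * of_bool (s = Some j)))"
        unfolding sum_UNIV_pair sum_distrib_right by simp
      also have "\<dots> = (\<Sum>s\<in>{Some j}. (\<Sum>d\<in>UNIV. event_rate (s, d)) * (of_bool (enabled s x) * of_bool (s = Some j)))"
        by (intro sum.mono_neutral_right) auto
      finally show ?thesis by (simp add: sum_event_rate_from enabled_def)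
    qed
    also have "a $ j + (\<Sum>k\<in>UNIV. p $ k $ j * ?D $ k) - ?D $ j = res (nu - ?D) $ j"
      unfolding res_diff vector_minus_component res_nth using nu_eq[of j] by linarith
    finally show ?thesis .
  qed
  then show ?thesis unfolding vec_eq_iff by blast
qed

text \<open>Routing has disappeared: the drift of the \<open>k\<close>-th coordinate depends only on
  whether node \<open>k\<close> is empty. This mirrors \<open>regulated\<close>, where the regulator
  \<open>k\<close> acts only when the fluid at \<open>k\<close> vanishes.\<close>

lemma coord_drift:
  "(\<Sum>e\<in>UNIV. event_rate e * (coord (move e x) $ k - coord x $ k)) = nu $ k - (if 0 < x $ k then mu $ k else 0)"
proof -
  have "res (\<Sum>e\<in>UNIV. event_rate e *\<^sub>R (coord (move e x) - coord x)) =
      (\<Sum>e\<in>UNIV. event_rate e *\<^sub>R (vec_of (move e x) - vec_of x))"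
    by (simp add: linear_sum[OF linear_res] linear_scale[OF linear_res] res_diff res_coord)
  then have "(\<Sum>e\<in>UNIV. event_rate e *\<^sub>R (coord (move e x) - coord x)) = nu - (\<chi> k. if 0 < x $ k then mu $ k else 0)"
    unfolding vec_of_drift by (rule res_inject)
  from arg_cong[OF this, of "\<lambda>v. v $ k"] show ?thesis by simp
qed

lemma coord_jump_bound: "\<exists>b>0. \<forall>e x k. \<bar>coord (move e x) $ k - coord x $ k\<bar> \<le> b"
proof -
  let ?B = "matrix_inv (mat 1 - transpose p)"
  let ?u = "\<lambda>e. vec_of (unit_state (snd e)) - vec_of (unit_state (fst e))"
  define b where "b = 1 + (\<Sum>e\<in>UNIV. \<Sum>k\<in>UNIV. \<bar>(?B *v ?u e) $ k\<bar>)"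
  have "\<bar>coord (move e x) $ k - coord x $ k\<bar> \<le> b" for e x k
  proof -
    have mem: "\<bar>(?B *v ?u e) $ k\<bar> \<le> (\<Sum>e\<in>UNIV. \<Sum>k\<in>UNIV. \<bar>(?B *v ?u e) $ k\<bar>)"
      by (rule order_trans[OF member_le_sum[of k UNIV "\<lambda>k. \<bar>(?B *v ?u e) $ k\<bar>"]
            member_le_sum[of e UNIV "\<lambda>e. \<Sum>k\<in>UNIV. \<bar>(?B *v ?u e) $ k\<bar>"]]) (auto intro!: sum_nonneg)
    show ?thesis
    proof (cases "enabled (fst e) x")
      case True
      have "vec_of (move e x) - vec_of x = ?u e"
        using unit_state_le[OF True] True by (simp add: vec_eq_iff move_def of_nat_diff trans_le_add1)
      then have "coord (move e x) - coord x = ?B *v ?u e"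
        by (simp add: coord_def flip: matrix_vector_mult_diff_distrib)
      then have "coord (move e x) $ k - coord x $ k = (?B *v ?u e) $ k"
        by (metis vector_minus_component)
      then show ?thesis using mem by (simp add: b_def)
    next
      case False
      then have "move e x = x" by (simp add: move_def)
      then show ?thesis using mem by (simp add: b_def)
    qed
  qed
  moreover have "b > 0" unfolding b_def by (intro add_pos_nonneg sum_nonneg) auto
  ultimately show ?thesis by blast
qed

text \<open>Both signs occur because the chain may run ahead of the fluid or lag behind it; division
  by \<open>v\<close> makes the components comparable with the weighted maximum.\<close>

definition lyap :: "real \<Rightarrow> real ^ 'k \<Rightarrow> nat ^ 'k \<Rightarrow> real" where
  "lyap c y x = (\<Sum>k\<in>UNIV. exp (c * ((coord x - y) $ k / v $ k)) + exp (- (c * ((coord x - y) $ k / v $ k))))"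

lemma lyap_pos: "0 < lyap c y x"
  unfolding lyap_def by (intro sum_pos) (auto intro: add_pos_pos)

lemma exp_abs_le_lyap: "exp (c * \<bar>(coord x - y) $ k\<bar> / v $ k) \<le> lyap c y x"
proof -
  let ?f = "\<lambda>k. exp (c * ((coord x - y) $ k / v $ k)) + exp (- (c * ((coord x - y) $ k / v $ k)))"
  have "exp (c * \<bar>(coord x - y) $ k\<bar> / v $ k) \<le> ?f k"
  proof -
    define d where "d = (coord x - y) $ k"
    have "\<bar>d\<bar> = d \<or> \<bar>d\<bar> = - d" by linarith
    then have "c * \<bar>d\<bar> / v $ k = c * (d / v $ k) \<or> c * \<bar>d\<bar> / v $ k = - (c * (d / v $ k))"
      by (elim disjE) simp_all
    then have "exp (c * \<bar>d\<bar> / v $ k) \<le> exp (c * (d / v $ k)) + exp (- (c * (d / v $ k)))"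
      by (metis add_increasing add_increasing2 exp_ge_zero order_refl)
    then show ?thesis unfolding d_def .
  qed
  also have "\<dots> \<le> lyap c y x"
    unfolding lyap_def by (rule member_le_sum) (auto intro: add_nonneg_nonneg)
  finally show ?thesis .
qed

text \<open>\<open>A\<close> is the exponent of one component and \<open>X\<close> its push during a
  step. An outward push occurs only where \<open>exp A \<le> 3 * F powr \<beta>\<close>, and
  \<open>exp X - 1 \<le> 2 * t\<close>; together they give the factor 6.\<close>

lemma exp_add_le_powr:
  fixes A X t F c m :: real
  assumes t: "0 \<le> t" "t \<le> 1" and F: "exp (c * m) \<le> F"
    and X: "X \<le> 0 \<or> X \<le> t \<and> A \<le> \<beta> * (c * m) + t"
  shows "exp (A + X) \<le> exp A + 6 * t * F powr \<beta>"
proof -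
  have F0: "0 < F" using F by (rule less_le_trans[OF exp_gt_zero])
  show ?thesis
  proof (cases "X \<le> 0")
    case True
    then have "exp (A + X) \<le> exp A" by simp
    then show ?thesis using t by (simp add: add_increasing2)
  next
    case False
    with X have X: "X \<le> t" "A \<le> \<beta> * (c * m) + t" by auto
    have "exp t \<le> 1 + t + t\<^sup>2" using t by (rule exp_bound)
    also have "t\<^sup>2 \<le> t" using t by (simp add: power2_eq_square mult_left_le)
    finally have e: "exp t - 1 \<le> 2 * t" by simp
    have "exp t \<le> 3" using exp_le t by (meson exp_le_cancel_iff order_trans)
    have "exp A \<le> exp (c * m) powr \<beta> * exp t"
      using X(2) by (simp add: powr_def flip: exp_add)
    also have "\<dots> \<le> F powr \<beta> * 3"
      using F \<open>exp t \<le> 3\<close> beta by (intro mult_mono powr_mono2) auto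
    finally have A: "exp A \<le> F powr \<beta> * 3" .
    have "exp (A + X) - exp A = exp A * (exp X - 1)" by (simp add: exp_add algebra_simps)
    also have "\<dots> \<le> exp A * (2 * t)"
      using X(1) e by (intro mult_left_mono) (auto intro: order_trans[of _ "exp t - 1"])
    also have "\<dots> \<le> (F powr \<beta> * 3) * (2 * t)" using A t by (intro mult_right_mono) auto
    finally show ?thesis by (simp add: mult_ac)
  qed
qed

text \<open>Trades the sublinear power for a linear term with a small coefficient, so that
  \<open>lyap + L\<close> obeys a purely multiplicative recursion. Below \<open>L\<close> the
  summand \<open>L\<close> pays, above it the summand \<open>F\<close>.\<close>

lemma powr_le_linear:
  assumes "0 < F" "1 \<le> L"
  shows "F powr \<beta> \<le> L powr (\<beta> - 1) * (F + L)"
proof (cases "F \<le> L")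
  case True
  have "F powr \<beta> \<le> L powr \<beta>" using True assms beta by (intro powr_mono2) auto
  also have "\<dots> = L powr (\<beta> - 1) * L" using assms by (simp add: powr_diff)
  also have "\<dots> \<le> L powr (\<beta> - 1) * (F + L)" using assms by (intro mult_left_mono) auto
  finally show ?thesis .
next
  case False
  have "F powr \<beta> = F powr (\<beta> - 1) * F" using assms by (simp add: powr_diff)
  also have "\<dots> \<le> L powr (\<beta> - 1) * F"
    using False assms beta by (intro mult_right_mono powr_mono2') auto
  also have "\<dots> \<le> L powr (\<beta> - 1) * (F + L)" using assms by (intro mult_left_mono) auto
  finally show ?thesis .
qed

text \<open>Where the fluid regulator or an empty queue pushes a coordinate of the deviation away from
  zero, that coordinate is smaller than the maximal one by the factor \<open>\<beta>\<close>; hence the push is of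
  order \<open>lyap powr \<beta>\<close> only.\<close>

lemma lyap_step:
  assumes C: "0 \<le> C"
  shows "\<exists>c0>0. \<exists>K\<ge>0. \<forall>c y u h x L. 0 < c \<longrightarrow> c \<le> c0 \<longrightarrow> regulated y C \<longrightarrow> 0 \<le> u \<longrightarrow> 0 \<le> h \<longrightarrow>
    K * h \<le> 1 \<longrightarrow> 1 \<le> L \<longrightarrow>
    (\<integral>\<^sup>+z. ennreal (lyap c (y (u + h)) z + L) \<partial>kern h x) \<le>
      ennreal (exp ((K * c\<^sup>2 + K * c * L powr (\<beta> - 1)) * h + K * h\<^sup>2) * (lyap c (y u) x + L))"
proof -
  obtain b where b: "0 < b" "\<And>e x k. \<bar>coord (move e x) $ k - coord x $ k\<bar> \<le> b"
    using coord_jump_bound by blast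
  obtain l where l: "0 < l" "\<And>k. l \<le> v $ k" using finite_pos_lower_bound[of "\<lambda>k. v $ k", OF v_pos] by blast
  obtain L1 where L1: "0 \<le> L1"
    "\<And>y s t k. regulated y C \<Longrightarrow> 0 \<le> s \<Longrightarrow> 0 \<le> t \<Longrightarrow> \<bar>y t $ k - y s $ k\<bar> \<le> L1 * \<bar>t - s\<bar>"
    using regulated_uniformly_lipschitz[of C] by blast
  define n where "n = real CARD('k)"
  \<comment> \<open>Bounds all pushes per unit of time relative to the weight: an idle server
    (\<open>mu\<close>), the fluid regulator (\<open>C\<close>), and the change of the fluid queue
    within a step (\<open>L1 * (1 + n)\<close>).\<close>
  define C3 where "C3 = ((\<Sum>k\<in>UNIV. mu $ k) + C + L1 * (1 + n)) / l"
  have sum_mu: "0 \<le> (\<Sum>k\<in>UNIV. mu $ k)" "mu $ k \<le> (\<Sum>k\<in>UNIV. mu $ k)" for k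
    using mu_pos[THEN less_imp_le] by (auto intro: sum_nonneg member_le_sum)
  have n: "0 \<le> n" by (simp add: n_def)
  have C3: "0 \<le> C3" using sum_mu(1) C L1 l n by (simp add: C3_def)
  have C3': "X / v $ k \<le> C3" if "X \<le> (\<Sum>k\<in>UNIV. mu $ k) + C + L1 * (1 + n)" for X k
  proof -
    have "X / v $ k \<le> ((\<Sum>k\<in>UNIV. mu $ k) + C + L1 * (1 + n)) / v $ k"
      using that v_pos[of k] by (intro divide_right_mono) auto
    also have "\<dots> \<le> C3" unfolding C3_def
      using sum_mu(1) C L1 l n v_pos[of k] by (intro divide_left_mono) (auto intro!: add_nonneg_nonneg)
    finally show ?thesis .
  qed
  define c0 where "c0 = min 1 (l / b)"
  \<comment> \<open>The first two summands absorb the errors of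
    \<open>nn_integral_exp_kern_le\<close> in \<open>c\<^sup>2 * h\<close> and
    \<open>h\<^sup>2\<close>, the third one the pushes. The last two turn
    \<open>K * h \<le> 1\<close> into \<open>t \<le> 1\<close> and
    \<open>3 * (total * h) \<le> 1\<close>.\<close>
  define K where "K = total * (b / l)\<^sup>2 + 11 * total\<^sup>2 + 12 * n * C3 + C3 + 3 * total"
  have K_parts: "0 \<le> total * (b / l)\<^sup>2" "0 \<le> 11 * total\<^sup>2" "0 \<le> 12 * n * C3" "0 \<le> 3 * total"
    using total_pos n C3 by auto
  have "0 < c0" "0 \<le> K" using K_parts C3 l b by (auto simp: c0_def K_def)
  moreover have "(\<integral>\<^sup>+z. ennreal (lyap c (y (u + h)) z + L) \<partial>kern h x) \<le>
      ennreal (exp ((K * c\<^sup>2 + K * c * L powr (\<beta> - 1)) * h + K * h\<^sup>2) * (lyap c (y u) x + L))"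
    if c: "0 < c" "c \<le> c0" and reg: "regulated y C" and u: "0 \<le> u" and h: "0 \<le> h" "K * h \<le> 1" and L: "1 \<le> L"
    for c y u h x L
  proof -
    define \<delta> where "\<delta> = c * b / l"
    have \<delta>: "\<delta> \<le> 1" using c l b by (simp add: \<delta>_def c0_def field_simps)
    have Kh: "C3 * h \<le> K * h" "3 * total * h \<le> K * h"
      using K_parts C3 h by (auto simp: K_def intro!: mult_right_mono)
    define t where "t = c * C3 * h"
    have t: "0 \<le> t" "t \<le> 1"
    proof -
      have "c * (C3 * h) \<le> 1 * (C3 * h)" using c C3 h by (intro mult_right_mono) (auto simp: c0_def)
      then show "0 \<le> t" "t \<le> 1" using Kh h c C3 by (auto simp: t_def mult.assoc)
    qed
    define q where "q = total * \<delta>\<^sup>2 * h + 11 * (total * h)\<^sup>2"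
    have q: "0 \<le> q" using total_pos h by (simp add: q_def)
    define D where "D k = (if 0 < x $ k then mu $ k else 0)" for k
    define dev where "dev = coord x - y u"
    define F where "F = lyap c (y u) x"
    obtain i where i: "\<And>j. \<bar>dev $ j\<bar> / v $ j \<le> \<bar>dev $ i\<bar> / v $ i"
      using finite_max_index[of "\<lambda>j. \<bar>dev $ j\<bar> / v $ j"] by blast
    define m where "m = \<bar>dev $ i\<bar> / v $ i"
    have m: "\<bar>dev $ j\<bar> \<le> v $ j * m" for j
      using i[of j] v_pos[of j] by (simp add: m_def field_simps)
    have m0: "0 \<le> m" using v_pos[of i] by (simp add: m_def)
    have Fm: "exp (c * m) \<le> F"
      using exp_abs_le_lyap[of c x "y u" i] by (simp add: m_def F_def dev_def)
    have pm: "(\<Sum>j\<in>UNIV. p $ j $ k * (\<sigma> * dev $ j)) \<le> \<beta> * v $ k * m" if "\<bar>\<sigma>\<bar> \<le> 1" for k and \<sigma> :: real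
    proof -
      have "(\<Sum>j\<in>UNIV. p $ j $ k * (\<sigma> * dev $ j)) \<le> (\<Sum>j\<in>UNIV. p $ j $ k * (v $ j * m))"
      proof (intro sum_mono mult_left_mono p_nonneg)
        fix j
        have "\<sigma> * dev $ j \<le> \<bar>\<sigma>\<bar> * \<bar>dev $ j\<bar>" by (metis abs_ge_self abs_mult)
        also have "\<dots> \<le> 1 * \<bar>dev $ j\<bar>" using that by (intro mult_right_mono) auto
        finally show "\<sigma> * dev $ j \<le> v $ j * m" using m[of j] by simp
      qed
      also have "\<dots> = (\<Sum>j\<in>UNIV. p $ j $ k * v $ j) * m" by (simp add: sum_distrib_left mult_ac)
      also have "\<dots> \<le> \<beta> * v $ k * m" using pv[of k] m0 by (intro mult_right_mono)
      finally show ?thesis .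
    qed
    have res_dev: "dev $ k = real (x $ k) - res (y u) $ k + (\<Sum>j\<in>UNIV. p $ j $ k * dev $ j)" for k
    proof -
      have "res dev $ k = real (x $ k) - res (y u) $ k" by (simp add: dev_def res_diff res_coord)
      then show ?thesis by (simp add: res_nth)
    qed
    define \<Phi> where "\<Phi> k = y (u + h) $ k - y u $ k + (mu $ k - nu $ k) * h" for k
    have \<Phi>: "0 \<le> \<Phi> k" "\<Phi> k \<le> C * h" for k
      using regulatedD(2,3)[OF reg u, of "u + h" k] h by (auto simp: \<Phi>_def)
    have D: "0 \<le> mu $ k - D k" "mu $ k - D k \<le> mu $ k" for k
      using mu_pos[of k] by (auto simp: D_def)
    have scaled_le: "c * (X * h) / v $ k \<le> t" if "X \<le> (\<Sum>k\<in>UNIV. mu $ k) + C + L1 * (1 + n)" for X k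
    proof -
      have "c * h * (X / v $ k) \<le> c * h * C3" using C3'[OF that] c h by (intro mult_left_mono) auto
      then show ?thesis by (simp add: t_def mult_ac)
    qed
    have beta_le: "c * (\<beta> * v $ k * m) / v $ k = \<beta> * (c * m)" for k using v_pos[of k] by simp
    \<comment> \<open>Upward, the only outward push comes from an idle server. At an empty node the
      deviation is at most the routed deviations, hence at most \<open>\<beta>\<close> times the
      weighted maximum.\<close>
    have plus: "c * ((mu $ k - D k) * h - \<Phi> k) / v $ k \<le> 0 \<or>
        c * ((mu $ k - D k) * h - \<Phi> k) / v $ k \<le> t \<and> c * dev $ k / v $ k \<le> \<beta> * (c * m) + t" for k
    proof (cases "0 < x $ k")
      case True
      then show ?thesis using \<Phi>(1)[of k] c v_pos[of k] by (simp add: D_def divide_nonpos_pos mult_nonneg_nonpos)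
    next
      case False
      have "c * ((mu $ k - D k) * h - \<Phi> k) / v $ k \<le> c * (mu $ k * h) / v $ k"
        using D[of k] \<Phi>(1)[of k] c v_pos[of k] h mult_right_mono[OF D(2)[of k] h(1)]
        by (intro divide_right_mono mult_left_mono) auto
      also have "\<dots> \<le> t"
        using sum_mu(2)[of k] C L1 n by (intro scaled_le) (simp add: add_nonneg_nonneg add_increasing2)
      finally have "c * ((mu $ k - D k) * h - \<Phi> k) / v $ k \<le> t" .
      moreover have "dev $ k \<le> \<beta> * v $ k * m"
        using res_dev[of k] regulatedD(1)[OF reg u, of k] pm[of 1 k] False by simp
      then have "c * dev $ k / v $ k \<le> \<beta> * (c * m)"
        unfolding beta_le[of k, symmetric] using c v_pos[of k] by (intro divide_right_mono mult_left_mono) auto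
      ultimately show ?thesis using t by linarith
    qed
    \<comment> \<open>Downward, the only outward push comes from the fluid regulator. It acts only
      if the fluid queue vanishes somewhere in the step; that queue may be positive at time
      \<open>u\<close>, but only by a multiple of \<open>h\<close>, which is the source of the extra
      \<open>t\<close>.\<close>
    have minus: "c * (\<Phi> k - (mu $ k - D k) * h) / v $ k \<le> 0 \<or>
        c * (\<Phi> k - (mu $ k - D k) * h) / v $ k \<le> t \<and> - (c * dev $ k / v $ k) \<le> \<beta> * (c * m) + t" for k
    proof (cases "\<forall>s\<in>{u..u + h}. 0 < res (y s) $ k")
      case True
      then have "\<Phi> k = 0" using regulatedD(4)[OF reg u, of "u + h" k] h by (simp add: \<Phi>_def)
      then show ?thesis using D(1)[of k] h c v_pos[of k]
        by (intro disjI1 divide_nonpos_pos mult_nonneg_nonpos) auto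
    next
      case False
      then obtain s where s: "u \<le> s" "s \<le> u + h" "res (y s) $ k \<le> 0" by (auto simp: not_less)
      have ys: "\<bar>y s $ j - y u $ j\<bar> \<le> L1 * h" for j
      proof -
        have "\<bar>y s $ j - y u $ j\<bar> \<le> L1 * \<bar>s - u\<bar>" using s u by (intro L1 reg) auto
        also have "\<dots> \<le> L1 * h" using s L1 by (intro mult_left_mono) auto
        finally show ?thesis .
      qed
      have "res (y u) $ k - res (y s) $ k = (y u $ k - y s $ k) + (\<Sum>j\<in>UNIV. p $ j $ k * (y s $ j - y u $ j))"
        by (simp add: res_nth right_diff_distrib sum_subtractf)
      also have "\<dots> \<le> L1 * h + (\<Sum>j\<in>(UNIV::'k set). 1 * (L1 * h))"
      proof (intro add_mono sum_mono)
        show "y u $ k - y s $ k \<le> L1 * h" using ys[of k] by linarith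
        fix j
        have "p $ j $ k * (y s $ j - y u $ j) \<le> p $ j $ k * (L1 * h)"
          using ys[of j] p_nonneg by (intro mult_left_mono) (auto simp: abs_le_iff)
        also have "\<dots> \<le> 1 * (L1 * h)" using p_le_1[of j k] L1 h by (intro mult_right_mono) auto
        finally show "p $ j $ k * (y s $ j - y u $ j) \<le> 1 * (L1 * h)" .
      qed
      finally have "res (y u) $ k \<le> L1 * (1 + n) * h" using s by (simp add: n_def algebra_simps)
      then have "- dev $ k \<le> L1 * (1 + n) * h + \<beta> * v $ k * m"
        using res_dev[of k] pm[of "- 1" k] by (simp add: sum_negf)
      then have "- (c * dev $ k / v $ k) \<le> c * (L1 * (1 + n) * h) / v $ k + c * (\<beta> * v $ k * m) / v $ k"
      proof -
        assume le: "- dev $ k \<le> L1 * (1 + n) * h + \<beta> * v $ k * m"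
        have "c / v $ k * (- dev $ k) \<le> c / v $ k * (L1 * (1 + n) * h + \<beta> * v $ k * m)"
          using c v_pos[of k] by (intro mult_left_mono le) auto
        then show ?thesis by (simp only: distrib_left mult_minus_right times_divide_eq_left)
      qed
      also have "c * (L1 * (1 + n) * h) / v $ k \<le> t"
        using C sum_mu(1) by (intro scaled_le) simp
      finally have "- (c * dev $ k / v $ k) \<le> \<beta> * (c * m) + t" unfolding beta_le by simp
      moreover have "c * (\<Phi> k - (mu $ k - D k) * h) / v $ k \<le> c * (C * h) / v $ k"
        using \<Phi>(2)[of k] D(1)[of k] h c v_pos[of k] by (intro divide_right_mono mult_left_mono) (auto simp: add_increasing2 diff_le_eq)
      moreover have "c * (C * h) / v $ k \<le> t"
        using sum_mu(1) L1 n by (intro scaled_le) simp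
      ultimately show ?thesis by linarith
    qed
    have one: "(\<integral>\<^sup>+z. ennreal (exp (\<sigma> * (c * ((coord z - y (u + h)) $ k / v $ k)))) \<partial>kern h x) \<le>
        ennreal (exp q * exp (\<sigma> * (c * dev $ k / v $ k) + \<sigma> * (c * ((mu $ k - D k) * h - \<Phi> k) / v $ k)))"
      if \<sigma>: "\<bar>\<sigma>\<bar> = 1" for \<sigma> k
    proof -
      let ?f = "\<lambda>z. \<sigma> * (c * ((coord z - y (u + h)) $ k / v $ k))"
      have jump: "?f (move e z) - ?f z = \<sigma> * c / v $ k * (coord (move e z) $ k - coord z $ k)" for e z
        by (simp add: algebra_simps diff_divide_distrib)
      have "\<bar>?f (move e z) - ?f z\<bar> \<le> \<delta>" for e z
      proof -
        have "\<bar>?f (move e z) - ?f z\<bar> = c / v $ k * \<bar>coord (move e z) $ k - coord z $ k\<bar>"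
          unfolding jump using \<sigma> c v_pos[of k] by (simp add: abs_mult)
        also have "\<dots> \<le> c / l * b" using b(2) l c v_pos[of k]
          by (intro mult_mono divide_left_mono) auto
        finally show ?thesis by (simp add: \<delta>_def)
      qed
      from nn_integral_exp_kern_le[OF this \<delta>, of h x] h(1) Kh h(2)
      have "(\<integral>\<^sup>+z. ennreal (exp (?f z)) \<partial>kern h x) \<le>
          ennreal (exp (?f x + h * (\<Sum>e\<in>UNIV. event_rate e * (?f (move e x) - ?f x)) + total * \<delta>\<^sup>2 * h + 11 * (total * h)\<^sup>2))"
        by (simp add: mult.assoc)
      also have "(\<Sum>e\<in>UNIV. event_rate e * (?f (move e x) - ?f x)) =
          \<sigma> * c / v $ k * (\<Sum>e\<in>UNIV. event_rate e * (coord (move e x) $ k - coord x $ k))"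
        unfolding jump sum_distrib_left by (intro sum.cong refl) (simp add: mult_ac)
      also have "\<dots> = \<sigma> * c / v $ k * (nu $ k - D k)" unfolding coord_drift D_def ..
      also have "?f x + h * (\<sigma> * c / v $ k * (nu $ k - D k)) =
          \<sigma> * c / v $ k * ((coord x - y (u + h)) $ k + h * (nu $ k - D k))"
        by (simp add: algebra_simps diff_divide_distrib add_divide_distrib)
      also have "(coord x - y (u + h)) $ k + h * (nu $ k - D k) = dev $ k + ((mu $ k - D k) * h - \<Phi> k)"
        by (simp add: dev_def \<Phi>_def algebra_simps)
      also have "\<sigma> * c / v $ k * (dev $ k + ((mu $ k - D k) * h - \<Phi> k)) + total * \<delta>\<^sup>2 * h + 11 * (total * h)\<^sup>2 =
          q + (\<sigma> * (c * dev $ k / v $ k) + \<sigma> * (c * ((mu $ k - D k) * h - \<Phi> k) / v $ k))"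
        by (simp add: q_def distrib_left add_divide_distrib)
      finally show ?thesis by (simp only: exp_add)
    qed
    define E where "E \<sigma> k = exp (\<sigma> * (c * dev $ k / v $ k))" for \<sigma> k
    have two: "(\<integral>\<^sup>+z. ennreal (exp (\<sigma> * (c * ((coord z - y (u + h)) $ k / v $ k)))) \<partial>kern h x) \<le>
        ennreal (exp q * (E \<sigma> k + 6 * t * F powr \<beta>))" if \<sigma>: "\<sigma> = 1 \<or> \<sigma> = - 1" for \<sigma> k
    proof -
      have "exp (\<sigma> * (c * dev $ k / v $ k) + \<sigma> * (c * ((mu $ k - D k) * h - \<Phi> k) / v $ k)) \<le>
          E \<sigma> k + 6 * t * F powr \<beta>"
        unfolding E_def
      proof (rule exp_add_le_powr[OF t Fm])
        have "- (c * ((mu $ k - D k) * h - \<Phi> k) / v $ k) = c * (\<Phi> k - (mu $ k - D k) * h) / v $ k"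
          by (simp add: algebra_simps diff_divide_distrib)
        then show "\<sigma> * (c * ((mu $ k - D k) * h - \<Phi> k) / v $ k) \<le> 0 \<or>
            \<sigma> * (c * ((mu $ k - D k) * h - \<Phi> k) / v $ k) \<le> t \<and> \<sigma> * (c * dev $ k / v $ k) \<le> \<beta> * (c * m) + t"
          using \<sigma> plus[of k] minus[of k] by auto
      qed
      then have "ennreal (exp q * exp (\<sigma> * (c * dev $ k / v $ k) + \<sigma> * (c * ((mu $ k - D k) * h - \<Phi> k) / v $ k))) \<le>
          ennreal (exp q * (E \<sigma> k + 6 * t * F powr \<beta>))"
        by (intro ennreal_leI mult_left_mono) auto
      with one[of \<sigma> k] \<sigma> show ?thesis by (auto elim: order_trans)
    qed
    have FE: "F = (\<Sum>k\<in>UNIV. E 1 k + E (- 1) k)"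
      by (simp add: F_def lyap_def E_def dev_def)
    have "(\<integral>\<^sup>+z. ennreal (lyap c (y (u + h)) z + L) \<partial>kern h x) =
        (\<integral>\<^sup>+z. (\<Sum>k\<in>UNIV. ennreal (exp (1 * (c * ((coord z - y (u + h)) $ k / v $ k)))) +
            ennreal (exp (- 1 * (c * ((coord z - y (u + h)) $ k / v $ k))))) + ennreal L \<partial>kern h x)"
    proof (intro nn_integral_cong)
      fix z
      have "ennreal (lyap c (y (u + h)) z) = (\<Sum>k\<in>UNIV. ennreal (exp (1 * (c * ((coord z - y (u + h)) $ k / v $ k))) +
            exp (- 1 * (c * ((coord z - y (u + h)) $ k / v $ k)))))"
        unfolding lyap_def by (subst sum_ennreal) (auto intro: add_nonneg_nonneg)
      then show "ennreal (lyap c (y (u + h)) z + L) = (\<Sum>k\<in>UNIV. ennreal (exp (1 * (c * ((coord z - y (u + h)) $ k / v $ k)))) +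
            ennreal (exp (- 1 * (c * ((coord z - y (u + h)) $ k / v $ k))))) + ennreal L"
        using L lyap_pos[of c "y (u + h)" z] by (simp add: ennreal_plus)
    qed
    also have "\<dots> = (\<Sum>k\<in>UNIV. (\<integral>\<^sup>+z. ennreal (exp (1 * (c * ((coord z - y (u + h)) $ k / v $ k)))) \<partial>kern h x) +
            (\<integral>\<^sup>+z. ennreal (exp (- 1 * (c * ((coord z - y (u + h)) $ k / v $ k)))) \<partial>kern h x)) + ennreal L"
      by (simp add: nn_integral_add nn_integral_sum measure_pmf.emeasure_space_1)
    also have "\<dots> \<le> (\<Sum>k\<in>UNIV. ennreal (exp q * (E 1 k + 6 * t * F powr \<beta>)) + ennreal (exp q * (E (- 1) k + 6 * t * F powr \<beta>))) +
        ennreal (exp q * L)"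
    proof (intro add_mono sum_mono two ennreal_leI)
      show "L \<le> exp q * L" using q L by simp
    qed auto
    also have "\<dots> = ennreal ((\<Sum>k\<in>UNIV. exp q * (E 1 k + 6 * t * F powr \<beta>) + exp q * (E (- 1) k + 6 * t * F powr \<beta>)) + exp q * L)"
    proof -
      have nn: "0 \<le> exp q * (E \<sigma> k + 6 * t * F powr \<beta>)" for \<sigma> k using t by (simp add: E_def add_nonneg_nonneg)
      show ?thesis using nn L by (simp add: sum_nonneg add_nonneg_nonneg ennreal_plus flip: sum_ennreal)
    qed
    \<comment> \<open>Each of the \<open>n\<close> components contributes \<open>6 * t\<close> for
      either sign, hence \<open>12 * n * t\<close>.\<close>
    also have "(\<Sum>k\<in>UNIV. exp q * (E 1 k + 6 * t * F powr \<beta>) + exp q * (E (- 1) k + 6 * t * F powr \<beta>)) + exp q * L =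
        exp q * (F + L + 12 * n * t * F powr \<beta>)"
      unfolding FE by (simp add: sum.distrib n_def algebra_simps flip: sum_distrib_left)
    also have "ennreal (exp q * (F + L + 12 * n * t * F powr \<beta>)) \<le>
        ennreal (exp ((K * c\<^sup>2 + K * c * L powr (\<beta> - 1)) * h + K * h\<^sup>2) * (F + L))"
    proof (rule ennreal_leI)
      have F0: "0 < F" using lyap_pos by (simp add: F_def)
      have "12 * n * t * F powr \<beta> \<le> 12 * n * t * (L powr (\<beta> - 1) * (F + L))"
        using n t F0 L by (intro mult_left_mono powr_le_linear) auto
      then have "F + L + 12 * n * t * F powr \<beta> \<le> (1 + 12 * n * t * L powr (\<beta> - 1)) * (F + L)"
        by (simp add: algebra_simps)
      also have "\<dots> \<le> exp (12 * n * t * L powr (\<beta> - 1)) * (F + L)"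
        using F0 L by (intro mult_right_mono exp_ge_add_one_self) auto
      finally have "exp q * (F + L + 12 * n * t * F powr \<beta>) \<le> exp q * (exp (12 * n * t * L powr (\<beta> - 1)) * (F + L))"
        by simp
      also have "\<dots> = exp (q + 12 * n * t * L powr (\<beta> - 1)) * (F + L)" by (simp add: exp_add)
      also have "\<dots> \<le> exp ((K * c\<^sup>2 + K * c * L powr (\<beta> - 1)) * h + K * h\<^sup>2) * (F + L)"
      proof (intro mult_right_mono)
        have "q = total * (b / l)\<^sup>2 * (c\<^sup>2 * h) + 11 * total\<^sup>2 * h\<^sup>2"
          by (simp add: q_def \<delta>_def power_mult_distrib power_divide)
        also have "\<dots> \<le> K * (c\<^sup>2 * h) + K * h\<^sup>2"
          using K_parts C3 h by (intro add_mono mult_right_mono) (auto simp: K_def)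
        finally have "q \<le> K * (c\<^sup>2 * h) + K * h\<^sup>2" .
        moreover have "12 * n * t * L powr (\<beta> - 1) = 12 * n * C3 * (c * L powr (\<beta> - 1) * h)"
          by (simp add: t_def)
        moreover have "12 * n * C3 * (c * L powr (\<beta> - 1) * h) \<le> K * (c * L powr (\<beta> - 1) * h)"
          using K_parts C3 h c by (intro mult_right_mono) (auto simp: K_def)
        ultimately have "q + 12 * n * t * L powr (\<beta> - 1) \<le> K * (c\<^sup>2 * h) + K * h\<^sup>2 + K * (c * L powr (\<beta> - 1) * h)"
          by linarith
        also have "\<dots> = (K * c\<^sup>2 + K * c * L powr (\<beta> - 1)) * h + K * h\<^sup>2" by (simp add: algebra_simps)
        finally have "q + 12 * n * t * L powr (\<beta> - 1) \<le> (K * c\<^sup>2 + K * c * L powr (\<beta> - 1)) * h + K * h\<^sup>2" .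
        then show "exp (q + 12 * n * t * L powr (\<beta> - 1)) \<le> exp ((K * c\<^sup>2 + K * c * L powr (\<beta> - 1)) * h + K * h\<^sup>2)"
          by simp
      qed (use F0 L in auto)
      finally show "exp q * (F + L + 12 * n * t * F powr \<beta>) \<le>
          exp ((K * c\<^sup>2 + K * c * L powr (\<beta> - 1)) * h + K * h\<^sup>2) * (F + L)" .
    qed
    finally show ?thesis by (simp only: F_def)
  qed
  ultimately show ?thesis by blast
qed

end

lemma exp_decay_tendsto_0:
  fixes b :: real
  assumes "0 < b"
  shows "(\<lambda>n. c * exp (- (b * real n))) \<longlonglongrightarrow> 0"
proof -
  have "exp (- (b * real n)) = exp (- b) ^ n" for n by (simp add: mult.commute flip: exp_of_nat_mult)
  moreover have "(\<lambda>n. exp (- b) ^ n) \<longlonglongrightarrow> 0" using assms by (intro LIMSEQ_power_zero) auto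
  ultimately show ?thesis by (simp add: tendsto_mult_right_zero)
qed

lemma eventually_real_ge: "\<forall>\<^sub>F n in sequentially. X \<le> real n"
  using filterlim_real_sequentially by (simp add: filterlim_at_top)

section \<open>Fluid scaling and the exponential deviation bound\<close>

context network
begin

lemma res_scaleR: "res (c *\<^sub>R y) = c *\<^sub>R res y"
  by (rule linear_scale[OF linear_res])

text \<open>The speed bound \<open>C\<close> survives the scaling, so one pair of constants in
  \<open>lyap_growth\<close> covers all \<open>n\<close>.\<close>

lemma regulated_scale:
  assumes reg: "regulated y C" and n: "0 < n"
  shows "regulated (\<lambda>u. n *\<^sub>R y (u / n)) C"
proof -
  have inc: "(n *\<^sub>R y (t / n)) $ k - (n *\<^sub>R y (s / n)) $ k + (mu $ k - nu $ k) * (t - s) =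
      n * (y (t / n) $ k - y (s / n) $ k + (mu $ k - nu $ k) * (t / n - s / n))" for s t :: real and k
    using n by (simp add: field_simps)
  show ?thesis unfolding regulated_def inc
  proof (intro conjI allI impI)
    show "0 \<le> res (n *\<^sub>R y (t / n)) $ k" if "0 \<le> t" for t k
      using regulatedD(1)[OF reg, of "t / n" k] that n by (simp add: res_scaleR)
    fix s t :: real and k assume st: "0 \<le> s \<and> s \<le> t"
    then have st': "0 \<le> s / n" "s / n \<le> t / n" using n by (auto simp: divide_right_mono)
    show "0 \<le> n * (y (t / n) $ k - y (s / n) $ k + (mu $ k - nu $ k) * (t / n - s / n))"
      using regulatedD(2)[OF reg st'] n by simp
    have "n * (y (t / n) $ k - y (s / n) $ k + (mu $ k - nu $ k) * (t / n - s / n)) \<le> n * (C * (t / n - s / n))"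
      using regulatedD(3)[OF reg st'] n by (intro mult_left_mono) auto
    also have "\<dots> = C * (t - s)" using n by (simp add: field_simps)
    finally show "n * (y (t / n) $ k - y (s / n) $ k + (mu $ k - nu $ k) * (t / n - s / n)) \<le> C * (t - s)" .
    assume pos: "\<forall>u\<in>{s..t}. 0 < res (n *\<^sub>R y (u / n)) $ k"
    have "y (t / n) $ k - y (s / n) $ k + (mu $ k - nu $ k) * (t / n - s / n) = 0"
    proof (rule regulatedD(4)[OF reg st'])
      fix u assume "s / n \<le> u" "u \<le> t / n"
      then have "u * n \<in> {s..t}" using n by (auto simp: field_simps)
      then show "0 < res (y u) $ k" using pos n by (fastforce simp: res_scaleR zero_less_mult_iff)
    qed
    then show "n * (y (t / n) $ k - y (s / n) $ k + (mu $ k - nu $ k) * (t / n - s / n)) = 0" by simp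
  qed
qed

text \<open>Apply \<open>lyap_step\<close> along \<open>N\<close> pieces of length
  \<open>u / N\<close>: the quadratic errors add up to \<open>K * u\<^sup>2 / N\<close> and vanish
  as \<open>N\<close> grows.\<close>

lemma lyap_growth:
  assumes C: "0 \<le> C"
  shows "\<exists>c0>0. \<exists>K\<ge>0. \<forall>c y u x L. 0 < c \<longrightarrow> c \<le> c0 \<longrightarrow> regulated y C \<longrightarrow> 0 \<le> u \<longrightarrow> 1 \<le> L \<longrightarrow>
    (\<integral>\<^sup>+z. ennreal (lyap c (y u) z + L) \<partial>kern u x) \<le>
      ennreal (exp ((K * c\<^sup>2 + K * c * L powr (\<beta> - 1)) * u) * (lyap c (y 0) x + L))"
proof -
  obtain c0 K where c0: "c0 > 0" and K: "K \<ge> 0" and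
    step: "\<And>c y u h x L. 0 < c \<Longrightarrow> c \<le> c0 \<Longrightarrow> regulated y C \<Longrightarrow> 0 \<le> u \<Longrightarrow> 0 \<le> h \<Longrightarrow>
    K * h \<le> 1 \<Longrightarrow> 1 \<le> L \<Longrightarrow>
    (\<integral>\<^sup>+z. ennreal (lyap c (y (u + h)) z + L) \<partial>kern h x) \<le>
      ennreal (exp ((K * c\<^sup>2 + K * c * L powr (\<beta> - 1)) * h + K * h\<^sup>2) * (lyap c (y u) x + L))"
    using lyap_step[OF C] by metis
  have "(\<integral>\<^sup>+z. ennreal (lyap c (y u) z + L) \<partial>kern u x) \<le>
      ennreal (exp ((K * c\<^sup>2 + K * c * L powr (\<beta> - 1)) * u) * (lyap c (y 0) x + L))"
    if c: "0 < c" "c \<le> c0" and reg: "regulated y C" and u: "0 \<le> u" and L: "1 \<le> L" for c y u x L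
  proof -
    define A where "A = K * c\<^sup>2 + K * c * L powr (\<beta> - 1)"
    let ?G = "\<lambda>u z. lyap c (y u) z + L"
    have G0: "0 \<le> ?G u z" for u z using lyap_pos[of c "y u" z] L by linarith
    have bound: "(\<integral>\<^sup>+z. ennreal (?G u z) \<partial>kern u x) \<le> ennreal (exp (A * u + K * u\<^sup>2 * (1 / real N)) * ?G 0 x)"
      if N: "N > 0" "K * u \<le> real N" for N :: nat
    proof -
      define h where "h = u / real N"
      have h: "0 \<le> h" "K * h \<le> 1" using N u by (auto simp: h_def)
      have "(\<integral>\<^sup>+z. ennreal (?G (real j * h) z) \<partial>kern (real j * h) x) \<le> ennreal (exp (real j * (A * h + K * h\<^sup>2)) * ?G 0 x)" for j
      proof (induction j)
        case 0 then show ?case by simp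
      next
        case (Suc j)
        have jh: "0 \<le> real j * h" using h by simp
        have S: "real (Suc j) * h = real j * h + h" by (simp add: algebra_simps)
        have "(\<integral>\<^sup>+z. ennreal (?G (real (Suc j) * h) z) \<partial>kern (real (Suc j) * h) x) =
            (\<integral>\<^sup>+w. (\<integral>\<^sup>+z. ennreal (?G (real j * h + h) z) \<partial>kern h w) \<partial>kern (real j * h) x)"
          unfolding S kern_add[OF jh h(1)] by simp
        also have "\<dots> \<le> (\<integral>\<^sup>+w. ennreal (exp (A * h + K * h\<^sup>2) * ?G (real j * h) w) \<partial>kern (real j * h) x)"
          unfolding A_def by (intro nn_integral_mono step c reg jh h L)
        also have "\<dots> = ennreal (exp (A * h + K * h\<^sup>2)) * (\<integral>\<^sup>+w. ennreal (?G (real j * h) w) \<partial>kern (real j * h) x)"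
          using G0 by (simp add: ennreal_mult nn_integral_cmult)
        also have "\<dots> \<le> ennreal (exp (A * h + K * h\<^sup>2)) * ennreal (exp (real j * (A * h + K * h\<^sup>2)) * ?G 0 x)"
          by (intro mult_left_mono Suc.IH) auto
        also have "\<dots> = ennreal (exp (A * h + K * h\<^sup>2) * exp (real j * (A * h + K * h\<^sup>2)) * ?G 0 x)"
          using G0 by (simp add: ennreal_mult mult.assoc)
        also have "exp (A * h + K * h\<^sup>2) * exp (real j * (A * h + K * h\<^sup>2)) = exp (real (Suc j) * (A * h + K * h\<^sup>2))"
          by (simp add: algebra_simps flip: exp_add)
        finally show ?case .
      qed
      note * = this[of N]
      have "real N * h = u" using N by (simp add: h_def)
      moreover have "real N * (A * h + K * h\<^sup>2) = A * (real N * h) + K * (real N * h)\<^sup>2 * (1 / real N)"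
        using N by (simp add: power2_eq_square field_simps)
      ultimately show ?thesis using * by (simp only:)
    qed
    have "(\<lambda>N. ennreal (exp (A * u + K * u\<^sup>2 * (1 / real N)) * ?G 0 x)) \<longlonglongrightarrow> ennreal (exp (A * u + K * u\<^sup>2 * 0) * ?G 0 x)"
      by (intro tendsto_intros tendsto_ennrealI lim_1_over_n)
    moreover have "\<forall>\<^sub>F N in sequentially. (\<integral>\<^sup>+z. ennreal (?G u z) \<partial>kern u x) \<le> ennreal (exp (A * u + K * u\<^sup>2 * (1 / real N)) * ?G 0 x)"
    proof -
      have "\<forall>\<^sub>F N in sequentially. K * u \<le> real N" by (rule eventually_real_ge)
      then show ?thesis using eventually_gt_at_top[of 0] by eventually_elim (rule bound)
    qed
    ultimately have "(\<integral>\<^sup>+z. ennreal (?G u z) \<partial>kern u x) \<le> ennreal (exp (A * u + K * u\<^sup>2 * 0) * ?G 0 x)"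
      by (intro tendsto_lowerbound[where F = sequentially]) auto
    then show ?thesis by (simp add: A_def)
  qed
  then show ?thesis using c0 K by blast
qed

text \<open>Exponential Markov inequality for \<open>lyap + L\<close>. Neither
  \<open>\<epsilon>\<close> nor \<open>\<gamma>\<close> depends on \<open>x\<close> or
  \<open>t\<close>, which is the uniformity that conditioning on the end point requires.\<close>

lemma regulated_deviation:
  assumes C: "0 \<le> C" and reg: "regulated y C" and T: "0 \<le> T" and \<eta>: "0 < \<eta>"
  shows "\<exists>\<epsilon>>0. \<exists>\<gamma>>0. \<forall>\<^sub>F n in sequentially. \<forall>x. (\<forall>k. \<bar>coord x $ k - real n * y 0 $ k\<bar> \<le> \<epsilon> * real n) \<longrightarrow>
    (\<forall>t\<in>{0..T}. measure_pmf.prob (kern (real n * t) x) {z. \<exists>k. \<eta> * real n \<le> \<bar>coord z $ k - real n * y t $ k\<bar>}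
      \<le> exp (- (\<gamma> * real n)))"
proof -
  obtain c0 K where c0: "c0 > 0" and K: "K \<ge> 0" and
    growth: "\<And>c y u x L. 0 < c \<Longrightarrow> c \<le> c0 \<Longrightarrow> regulated y C \<Longrightarrow> 0 \<le> u \<Longrightarrow> 1 \<le> L \<Longrightarrow>
    (\<integral>\<^sup>+z. ennreal (lyap c (y u) z + L) \<partial>kern u x) \<le>
      ennreal (exp ((K * c\<^sup>2 + K * c * L powr (\<beta> - 1)) * u) * (lyap c (y 0) x + L))"
    using lyap_growth[OF C] by metis
  obtain l where l: "0 < l" "\<And>k. l \<le> v $ k" using finite_pos_lower_bound[of "\<lambda>k. v $ k", OF v_pos] by blast
  obtain i0 where i0: "\<And>k. v $ k \<le> v $ i0" using finite_max_index[of "\<lambda>k. v $ k"] by blast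
  define \<eta>' where "\<eta>' = \<eta> / v $ i0"
  have \<eta>': "0 < \<eta>'" using \<eta> v_pos by (simp add: \<eta>'_def)
  \<comment> \<open>The growth rate contains \<open>K * c\<^sup>2\<close>; relative to the gain,
    which is linear in \<open>c\<close>, it is small for small \<open>c\<close>. Here it consumes at
    most 1/8 of \<open>c * \<eta>' * n\<close> up to time \<open>n * T\<close>.\<close>
  define c where "c = min c0 (\<eta>' / (8 * (K * T + 1)))"
  have KT: "0 \<le> K * T" using K T by simp
  have c: "0 < c" "c \<le> c0" using c0 \<eta>' KT by (auto simp: c_def)
  have cK: "K * c * T \<le> \<eta>' / 8"
  proof -
    have "c * (K * T) \<le> \<eta>' / (8 * (K * T + 1)) * (K * T)"
      using KT by (intro mult_right_mono) (auto simp: c_def)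
    also have "\<dots> \<le> \<eta>' / 8" using KT \<eta>' by (simp add: field_simps)
    finally show ?thesis by (simp add: mult_ac)
  qed
  \<comment> \<open>Budget in units of \<open>c * \<eta>' * n\<close>: the deviation event is worth
    1; the initial state and the growth factor use 1/4 each. The remaining 1/2 is
    \<open>2 * \<gamma> * n\<close>, one half of which absorbs the factor \<open>m\<close>.\<close>
  define \<epsilon> where "\<epsilon> = \<eta>' * l / 4"
  define \<gamma> where "\<gamma> = c * \<eta>' / 4"
  define m where "m = 2 * real CARD('k) + 1"
  have m0: "0 < m" by (simp add: m_def)
  \<comment> \<open>With \<open>L = exp (c * \<eta>' / 4 * n)\<close> the coefficient
    \<open>L powr (\<beta> - 1)\<close> of the pushes is \<open>exp (- (b * n))\<close>.\<close>
  define b where "b = (1 - \<beta>) * (c * \<eta>' / 4)"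
  have b: "0 < b" using beta c \<eta>' by (simp add: b_def)
  have "(\<lambda>n. K * T * exp (- (b * real n))) \<longlonglongrightarrow> 0" by (rule exp_decay_tendsto_0[OF b])
  then have ev1: "\<forall>\<^sub>F n in sequentially. K * T * exp (- (b * real n)) < \<eta>' / 8"
    using \<eta>' by (intro order_tendstoD) auto
  have \<gamma>: "0 < \<gamma>" using c \<eta>' by (simp add: \<gamma>_def)
  have "(\<lambda>n. m * exp (- (\<gamma> * real n))) \<longlonglongrightarrow> 0" by (rule exp_decay_tendsto_0[OF \<gamma>])
  then have ev2: "\<forall>\<^sub>F n in sequentially. m * exp (- (\<gamma> * real n)) < 1"
    by (intro order_tendstoD) auto
  have "0 < \<epsilon>" using \<eta>' l by (simp add: \<epsilon>_def)
  moreover have "\<forall>\<^sub>F n in sequentially. \<forall>x. (\<forall>k. \<bar>coord x $ k - real n * y 0 $ k\<bar> \<le> \<epsilon> * real n) \<longrightarrow>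
    (\<forall>t\<in>{0..T}. measure_pmf.prob (kern (real n * t) x) {z. \<exists>k. \<eta> * real n \<le> \<bar>coord z $ k - real n * y t $ k\<bar>}
      \<le> exp (- (\<gamma> * real n)))"
    using ev1 ev2 eventually_gt_at_top[of 0]
  proof eventually_elim
    case (elim n)
    have n: "0 < real n" using elim(3) by simp
    show ?case
    proof (intro allI impI ballI)
      fix x t assume x: "\<forall>k. \<bar>coord x $ k - real n * y 0 $ k\<bar> \<le> \<epsilon> * real n" and t: "t \<in> {0..T}"
      define Y where "Y u = real n *\<^sub>R y (u / real n)" for u
      have Y: "regulated Y C" unfolding Y_def using regulated_scale[OF reg n] .
      define u where "u = real n * t"
      have u: "0 \<le> u" "u \<le> real n * T" using t by (auto simp: u_def intro: mult_left_mono)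
      have Yu: "Y u = real n *\<^sub>R y t" "Y 0 = real n *\<^sub>R y 0" using n by (auto simp: Y_def u_def)
      define L where "L = exp (c * \<eta>' / 4 * real n)"
      have L: "1 \<le> L" using c \<eta>' by (simp add: L_def)
      have Lp: "L powr (\<beta> - 1) = exp (- (b * real n))"
        by (simp add: L_def b_def powr_def field_simps)
      have lyap0: "lyap c (Y 0) x \<le> 2 * real CARD('k) * L"
      proof -
        have le: "\<sigma> * (c * ((coord x - Y 0) $ k / v $ k)) \<le> c * \<eta>' / 4 * real n" if "\<bar>\<sigma>\<bar> = 1" for k \<sigma>
        proof -
          have "\<sigma> * (c * ((coord x - Y 0) $ k / v $ k)) \<le> \<bar>\<sigma> * (c * ((coord x - Y 0) $ k / v $ k))\<bar>" by (rule abs_ge_self)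
          also have "\<dots> = c * (\<bar>coord x $ k - real n * y 0 $ k\<bar> / v $ k)"
            using that c v_pos[of k] by (simp add: abs_mult Yu)
          also have "\<dots> \<le> c * ((\<epsilon> * real n) / l)"
            using x[rule_format, of k] l(1) l(2)[of k] c v_pos[of k] by (intro mult_left_mono frac_le) auto
          also have "\<dots> = c * \<eta>' / 4 * real n" using l by (simp add: \<epsilon>_def)
          finally show ?thesis .
        qed
        have "lyap c (Y 0) x \<le> (\<Sum>k\<in>(UNIV::'k set). L + L)"
          unfolding lyap_def L_def using le[of 1] le[of "- 1"] by (intro sum_mono add_mono) auto
        then show ?thesis by simp
      qed
      define A where "A = K * c\<^sup>2 + K * c * L powr (\<beta> - 1)"
      have A: "0 \<le> A" using K c by (simp add: A_def)
      have Au: "A * u \<le> c * \<eta>' / 4 * real n"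
      proof -
        have "A * u \<le> A * (real n * T)" using u A by (intro mult_left_mono)
        also have "\<dots> = c * real n * (K * c * T + K * T * exp (- (b * real n)))"
          by (simp add: A_def Lp power2_eq_square algebra_simps)
        also have "\<dots> \<le> c * real n * (\<eta>' / 8 + \<eta>' / 8)"
          using cK elim(1) c by (intro mult_left_mono add_mono) auto
        finally show ?thesis by (simp add: mult_ac)
      qed
      let ?S = "{z. \<exists>k. \<eta> * real n \<le> \<bar>coord z $ k - real n * y t $ k\<bar>}"
      have dev: "exp (c * \<eta>' * real n) \<le> lyap c (Y u) z + L" if "z \<in> ?S" for z
      proof -
        from that obtain k where k: "\<eta> * real n \<le> \<bar>coord z $ k - real n * y t $ k\<bar>" by blast
        have "\<eta>' * real n \<le> \<eta> * real n / v $ k"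
          using i0[of k] v_pos[of k] v_pos[of i0] \<eta> n by (simp add: \<eta>'_def frac_le)
        also have "\<dots> \<le> \<bar>coord z $ k - real n * y t $ k\<bar> / v $ k"
          using k v_pos[of k] by (intro divide_right_mono) auto
        finally have "c * (\<eta>' * real n) \<le> c * (\<bar>coord z $ k - real n * y t $ k\<bar> / v $ k)"
          using c by (intro mult_left_mono) auto
        then have "exp (c * \<eta>' * real n) \<le> exp (c * \<bar>(coord z - Y u) $ k\<bar> / v $ k)"
          by (simp add: Yu mult.assoc)
        also have "\<dots> \<le> lyap c (Y u) z" by (rule exp_abs_le_lyap)
        finally show ?thesis using L by simp
      qed
      have "emeasure (kern u x) ?S = (\<integral>\<^sup>+z. indicator ?S z \<partial>kern u x)" by simp
      also have "\<dots> \<le> (\<integral>\<^sup>+z. ennreal (exp (- (c * \<eta>' * real n))) * ennreal (lyap c (Y u) z + L) \<partial>kern u x)"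
      proof (intro nn_integral_mono)
        fix z
        show "indicator ?S z \<le> ennreal (exp (- (c * \<eta>' * real n))) * ennreal (lyap c (Y u) z + L)"
        proof (cases "z \<in> ?S")
          case True
          have "exp (- (c * \<eta>' * real n)) * exp (c * \<eta>' * real n) \<le> exp (- (c * \<eta>' * real n)) * (lyap c (Y u) z + L)"
            using dev[OF True] by (intro mult_left_mono) auto
          then have "1 \<le> exp (- (c * \<eta>' * real n)) * (lyap c (Y u) z + L)" by (simp flip: exp_add)
          then have "ennreal 1 \<le> ennreal (exp (- (c * \<eta>' * real n)) * (lyap c (Y u) z + L))" by (rule ennreal_leI)
          then show ?thesis using True lyap_pos[of c "Y u" z] L by (simp add: ennreal_mult)
        qed simp
      qed
      also have "\<dots> = ennreal (exp (- (c * \<eta>' * real n))) * (\<integral>\<^sup>+z. ennreal (lyap c (Y u) z + L) \<partial>kern u x)"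
        by (rule nn_integral_cmult) simp
      also have "\<dots> \<le> ennreal (exp (- (c * \<eta>' * real n))) * ennreal (exp (A * u) * (lyap c (Y 0) x + L))"
        unfolding A_def by (intro mult_left_mono growth c Y u L) auto
      also have "\<dots> = ennreal (exp (- (c * \<eta>' * real n)) * (exp (A * u) * (lyap c (Y 0) x + L)))"
        using lyap_pos[of c "Y 0" x] L by (simp add: ennreal_mult)
      also have "\<dots> \<le> ennreal (exp (- (\<gamma> * real n)))"
      proof (rule ennreal_leI)
        have "exp (A * u) * (lyap c (Y 0) x + L) \<le> exp (c * \<eta>' / 4 * real n) * (m * L)"
          using Au lyap0 lyap_pos[of c "Y 0" x] L by (intro mult_mono) (auto simp: m_def algebra_simps)
        then have "exp (- (c * \<eta>' * real n)) * (exp (A * u) * (lyap c (Y 0) x + L)) \<le>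
            exp (- (c * \<eta>' * real n)) * (exp (c * \<eta>' / 4 * real n) * (m * L))"
          by (intro mult_left_mono) auto
        also have "\<dots> = m * exp (- (\<gamma> * real n)) * exp (- (\<gamma> * real n))"
        proof -
          have "exp (- (c * \<eta>' * real n)) * (exp (c * \<eta>' / 4 * real n) * L) = exp (- (\<gamma> * real n)) * exp (- (\<gamma> * real n))"
            unfolding L_def \<gamma>_def by (simp add: field_simps flip: exp_add)
          then show ?thesis by (simp add: mult_ac)
        qed
        also have "\<dots> \<le> 1 * exp (- (\<gamma> * real n))"
          using elim(2) by (intro mult_right_mono) auto
        finally show "exp (- (c * \<eta>' * real n)) * (exp (A * u) * (lyap c (Y 0) x + L)) \<le> exp (- (\<gamma> * real n))" by simp
      qed
      finally have "emeasure (kern u x) ?S \<le> ennreal (exp (- (\<gamma> * real n)))" .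
      then show "measure_pmf.prob (kern (real n * t) x) ?S \<le> exp (- (\<gamma> * real n))"
        by (simp add: measure_pmf.emeasure_eq_measure u_def)
    qed
  qed
  ultimately show ?thesis using \<gamma> by blast
qed

text \<open>Queue lengths and coordinates determine each other through a fixed invertible matrix, so
  the bound transfers with changed constants only.\<close>

theorem fluid_deviation:
  assumes fluid: "fluid_trajectory a mu p r q" and T: "0 \<le> T" and \<delta>: "0 < \<delta>"
  shows "\<exists>\<epsilon>>0. \<exists>\<gamma>>0. \<forall>\<^sub>F n in sequentially. \<forall>x. norm (vec_of x /\<^sub>R real n - r) \<le> \<epsilon> \<longrightarrow>
    (\<forall>t\<in>{0..T}. measure_pmf.prob (kern (real n * t) x) {z. \<delta> \<le> norm (vec_of z /\<^sub>R real n - q t)}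
      \<le> exp (- (\<gamma> * real n)))"
proof -
  obtain y C where C: "0 \<le> C" and reg: "regulated y C" and q: "\<And>t. 0 \<le> t \<Longrightarrow> q t = res (y t)"
    using fluid_trajectory_regulated[OF fluid] by metis
  have q0: "q 0 = r"
  proof -
    from fluid obtain phi where "\<forall>t\<ge>0. q t = r + t *\<^sub>R (a - (mat 1 - transpose p) *v mu) + (mat 1 - transpose p) *v phi t"
      "phi 0 = 0" unfolding fluid_trajectory_def by blast
    then show ?thesis by simp
  qed
  let ?B = "(*v) (matrix_inv (mat 1 - transpose p))"
  obtain b where b: "b > 0" "\<And>x. norm (?B x) \<le> b * norm x"
    using linear_bounded_pos[OF matrix_vector_mul_linear[of "matrix_inv (mat 1 - transpose p)"]] by blast
  obtain b' where b': "b' > 0" "\<And>x. norm (res x) \<le> b' * norm x"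
    using linear_bounded_pos[OF linear_res] by blast
  define \<eta> where "\<eta> = \<delta> / (b' * (real CARD('k) + 1))"
  have card: "0 < real CARD('k) + 1" by (simp add: add_nonneg_pos)
  have \<eta>: "0 < \<eta>" using \<delta> b' card by (simp add: \<eta>_def)
  obtain \<epsilon> \<gamma> where \<epsilon>: "0 < \<epsilon>" and \<gamma>: "0 < \<gamma>" and
    ev: "\<forall>\<^sub>F n in sequentially. \<forall>x. (\<forall>k. \<bar>coord x $ k - real n * y 0 $ k\<bar> \<le> \<epsilon> * real n) \<longrightarrow>
    (\<forall>t\<in>{0..T}. measure_pmf.prob (kern (real n * t) x) {z. \<exists>k. \<eta> * real n \<le> \<bar>coord z $ k - real n * y t $ k\<bar>}
      \<le> exp (- (\<gamma> * real n)))"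
    using regulated_deviation[OF C reg T \<eta>] by blast
  have "\<forall>\<^sub>F n in sequentially. \<forall>x. norm (vec_of x /\<^sub>R real n - r) \<le> \<epsilon> / b \<longrightarrow>
    (\<forall>t\<in>{0..T}. measure_pmf.prob (kern (real n * t) x) {z. \<delta> \<le> norm (vec_of z /\<^sub>R real n - q t)}
      \<le> exp (- (\<gamma> * real n)))"
    using ev eventually_gt_at_top[of 0]
  proof eventually_elim
    case (elim n)
    have n: "0 < real n" using elim(2) by simp
    show ?case
    proof (intro allI impI ballI)
      fix x t assume x: "norm (vec_of x /\<^sub>R real n - r) \<le> \<epsilon> / b" and t: "t \<in> {0..T}"
      have "\<bar>coord x $ k - real n * y 0 $ k\<bar> \<le> \<epsilon> * real n" for k
      proof -
        have y0: "?B r = y 0"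
          using q[of 0] q0 matrix_inv_mult_cancel(2)[OF invertible_I_minus_pT] by (simp add: res_eq_matrix)
        have eq: "coord x - real n *\<^sub>R y 0 = real n *\<^sub>R ?B (vec_of x /\<^sub>R real n - r)"
          using n by (simp add: matrix_vector_mult_diff_distrib matrix_vector_mult_scaleR y0 coord_def scaleR_right_diff_distrib)
        have "\<bar>(coord x - real n *\<^sub>R y 0) $ k\<bar> \<le> norm (coord x - real n *\<^sub>R y 0)"
          by (rule component_le_norm_cart)
        also have "\<dots> \<le> real n * (b * norm (vec_of x /\<^sub>R real n - r))"
          unfolding eq norm_scaleR using n b(2) by (simp add: mult_left_mono)
        also have "\<dots> \<le> real n * (b * (\<epsilon> / b))"
          using n b(1) x by (intro mult_left_mono) auto
        finally show ?thesis using b by (simp add: mult.commute)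
      qed
      with elim(1) t have le: "measure_pmf.prob (kern (real n * t) x) {z. \<exists>k. \<eta> * real n \<le> \<bar>coord z $ k - real n * y t $ k\<bar>}
          \<le> exp (- (\<gamma> * real n))" by blast
      have "measure_pmf.prob (kern (real n * t) x) {z. \<delta> \<le> norm (vec_of z /\<^sub>R real n - q t)} \<le>
         measure_pmf.prob (kern (real n * t) x) {z. \<exists>k. \<eta> * real n \<le> \<bar>coord z $ k - real n * y t $ k\<bar>}"
      proof (intro measure_pmf.finite_measure_mono subsetI CollectI)
        fix z assume z: "z \<in> {z. \<delta> \<le> norm (vec_of z /\<^sub>R real n - q t)}"
        show "\<exists>k. \<eta> * real n \<le> \<bar>coord z $ k - real n * y t $ k\<bar>"
        proof (rule ccontr)
          assume "\<not> ?thesis"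
          then have less: "\<bar>(coord z - real n *\<^sub>R y t) $ k\<bar> \<le> \<eta> * real n" for k by (simp add: not_le less_imp_le)
          have "norm (coord z - real n *\<^sub>R y t) \<le> (\<Sum>k\<in>UNIV. \<bar>(coord z - real n *\<^sub>R y t) $ k\<bar>)"
            by (rule norm_le_l1_cart)
          also have "\<dots> \<le> (\<Sum>k\<in>(UNIV::'k set). \<eta> * real n)" by (intro sum_mono less)
          also have "\<dots> = real CARD('k) * \<eta> * real n" by simp
          finally have "b' * norm (coord z - real n *\<^sub>R y t) \<le> b' * (real CARD('k) * \<eta> * real n)"
            using b' by (intro mult_left_mono) auto
          also have "\<dots> < b' * ((real CARD('k) + 1) * \<eta> * real n)"
            using b' \<eta> n by (intro mult_strict_left_mono mult_strict_right_mono) auto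
          also have "\<dots> = \<delta> * real n" using b' card by (simp add: \<eta>_def)
          finally have "norm (res (coord z - real n *\<^sub>R y t)) < \<delta> * real n"
            using b'(2)[of "coord z - real n *\<^sub>R y t"] by linarith
          moreover have "res (coord z - real n *\<^sub>R y t) = real n *\<^sub>R (vec_of z /\<^sub>R real n - q t)"
            using n t by (simp add: res_diff res_coord res_scaleR q scaleR_right_diff_distrib)
          ultimately have "norm (vec_of z /\<^sub>R real n - q t) < \<delta>" using n by (simp add: mult.commute)
          with z show False by simp
        qed
      qed auto
      with le show "measure_pmf.prob (kern (real n * t) x) {z. \<delta> \<le> norm (vec_of z /\<^sub>R real n - q t)} \<le> exp (- (\<gamma> * real n))"
        by linarith
    qed
  qed
  moreover have "0 < \<epsilon> / b" using \<epsilon> b by simp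
  ultimately show ?thesis using \<gamma> by blast
qed

end

section \<open>Finite-dimensional distributions and oscillations\<close>

lemma nn_integral_exp_pois:
  assumes T: "0 \<le> T"
  shows "(\<integral>\<^sup>+n. ennreal (exp \<delta> ^ n) \<partial>pois T) = ennreal (exp (T * (exp \<delta> - 1)))"
proof -
  have "(\<integral>\<^sup>+n. ennreal (exp \<delta> ^ n) \<partial>pois T) = (\<integral>\<^sup>+n. ennreal (exp (- T) * ((T * exp \<delta>) ^ n /\<^sub>R fact n)) \<partial>count_space UNIV)"
    unfolding nn_integral_measure_pmf
    by (intro nn_integral_cong)
       (use T in \<open>simp add: pmf_pois power_mult_distrib divide_inverse mult_ac flip: ennreal_mult\<close>)
  also have "\<dots> = ennreal (exp (- T) * exp (T * exp \<delta>))"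
    unfolding nn_integral_count_space_nat
  proof (rule suminf_ennreal_eq)
    show "0 \<le> exp (- T) * ((T * exp \<delta>) ^ i /\<^sub>R fact i)" for i using T by simp
    show "(\<lambda>i. exp (- T) * ((T * exp \<delta>) ^ i /\<^sub>R fact i)) sums (exp (- T) * exp (T * exp \<delta>))"
      by (intro sums_mult exp_converges)
  qed
  also have "exp (- T) * exp (T * exp \<delta>) = exp (T * (exp \<delta> - 1))"
    by (simp add: algebra_simps flip: exp_add)
  finally show ?thesis .
qed

section \<open>Path length along a time grid\<close>

definition l1_dist :: "nat ^ 'k \<Rightarrow> nat ^ 'k \<Rightarrow> real" where
  "l1_dist x y = (\<Sum>k\<in>UNIV. \<bar>real (x $ k) - real (y $ k)\<bar>)"

lemma l1_dist_nonneg [simp]: "0 \<le> l1_dist x y"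
  by (simp add: l1_dist_def sum_nonneg)

lemma l1_dist_self [simp]: "l1_dist x x = 0"
  by (simp add: l1_dist_def)

lemma l1_dist_triangle: "l1_dist x z \<le> l1_dist x y + l1_dist y z"
  unfolding l1_dist_def by (simp flip: sum.distrib) (intro sum_mono, linarith)

lemma l1_dist_move_le: "l1_dist (move e z) z \<le> 2"
proof (cases "enabled (fst e) z")
  case True
  have u: "unit_state s $ j = of_bool (s = Some j)" for s :: "'a option" and j
    by (cases s) (auto simp: unit_state_def axis_def)
  have one: "(\<Sum>j\<in>UNIV. of_bool (s = Some j)) \<le> (1 :: real)" for s :: "'a option"
    by (cases s) auto
  have "l1_dist (move e z) z \<le> (\<Sum>j\<in>UNIV. of_bool (fst e = Some j) + of_bool (snd e = Some j))"
    unfolding l1_dist_def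
  proof (rule sum_mono)
    fix j
    show "\<bar>real (move e z $ j) - real (z $ j)\<bar> \<le> of_bool (fst e = Some j) + of_bool (snd e = Some j)"
      using unit_state_le[OF True, of j] True by (auto simp: move_def u)
  qed
  also have "\<dots> \<le> 1 + 1" unfolding sum.distrib by (intro add_mono one)
  finally show ?thesis by simp
next
  case False
  then have "move e z = z" by (simp add: move_def)
  then show ?thesis by simp
qed

lemma l1_dist_vec_of: "norm (vec_of x - vec_of y) \<le> l1_dist x y"
  using norm_le_l1_cart[of "vec_of x - vec_of y"] by (simp add: l1_dist_def)

text \<open>The newest state comes first, so that \<open>hd\<close> is the state from which the
  Markov property continues.\<close>

primrec history :: "(nat \<Rightarrow> 's) \<Rightarrow> nat \<Rightarrow> 's list" where
  "history x 0 = [x 0]"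
| "history x (Suc m) = x (Suc m) # history x m"

lemma history_eq_iff: "history x m = history y m \<longleftrightarrow> (\<forall>i\<le>m. x i = y i)"
  by (induction m) (auto simp: le_Suc_eq)

lemma length_history [simp]: "length (history x m) = Suc m"
  by (induction m) auto

lemma hd_history [simp]: "hd (history x m) = x m"
  by (cases m) auto

lemma history_surj: "length xs = Suc m \<Longrightarrow> \<exists>x. xs = history x m"
proof (induction m arbitrary: xs)
  case 0
  then show ?case by (auto simp: length_Suc_conv)
next
  case (Suc m)
  then obtain y ys where xs: "xs = y # ys" "length ys = Suc m" by (auto simp: length_Suc_conv)
  with Suc obtain x where x: "ys = history x m" by blast
  have "history (x(Suc m := y)) m = history x m" by (simp add: history_eq_iff)
  then have "xs = history (x(Suc m := y)) (Suc m)" using xs x by (simp only: history.simps fun_upd_same)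
  then show ?case by blast
qed

text \<open>The increment away from the initial state, at the end of the list, is left out.\<close>

fun variation :: "(nat ^ 'k) list \<Rightarrow> real" where
  "variation (y # x # z # zs) = l1_dist y x + variation (x # z # zs)"
| "variation _ = 0"

text \<open>Index 0 is reserved for the time origin, and index 1 is the left end of the window whose
  oscillation is measured; the rest is the triangle inequality.\<close>

lemma l1_dist_le_variation:
  assumes "i \<le> m"
  shows "l1_dist (x (Suc i)) (x 1) \<le> variation (history x (Suc m))"
proof -
  have step: "variation (history x (Suc (Suc m))) = l1_dist (x (Suc (Suc m))) (x (Suc m)) + variation (history x (Suc m))" for m
    by (cases m) auto
  have *: "l1_dist (x (Suc i)) (x 1) \<le> variation (history x (Suc i))" for i
  proof (induction i)
    case (Suc i)
    have "l1_dist (x (Suc (Suc i))) (x 1) \<le> l1_dist (x (Suc (Suc i))) (x (Suc i)) + l1_dist (x (Suc i)) (x 1)"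
      by (rule l1_dist_triangle)
    then show ?case unfolding step using Suc.IH by linarith
  qed simp
  have "variation (history x (Suc i)) \<le> variation (history x (Suc m))"
    using assms by (induction m rule: dec_induct) (auto simp only: step intro: order_trans add_increasing l1_dist_nonneg)
  with * show ?thesis by (rule order_trans)
qed

context jackson
begin

lemma nn_integral_exp_l1_dist_kern:
  assumes \<theta>: "0 \<le> \<theta>" and h: "0 \<le> h"
  shows "(\<integral>\<^sup>+z. ennreal (exp (\<theta> * l1_dist z x)) \<partial>kern h x) \<le> ennreal (exp (total * h * (exp (2 * \<theta>) - 1)))"
proof -
  have "\<theta> * l1_dist (move e z) x \<le> \<theta> * l1_dist z x + 2 * \<theta>" for e z
  proof -
    have "l1_dist (move e z) x \<le> 2 + l1_dist z x"
      using l1_dist_triangle[of "move e z" x z] l1_dist_move_le[of e z] by linarith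
    from mult_left_mono[OF this \<theta>] show ?thesis by (simp add: algebra_simps)
  qed
  then have "(\<integral>\<^sup>+z. ennreal (exp (\<theta> * l1_dist z x)) \<partial>steps n x) \<le> ennreal (exp (\<theta> * l1_dist x x) * exp (2 * \<theta>) ^ n)" for n
    by (rule nn_integral_exp_steps_le)
  then have "(\<integral>\<^sup>+z. ennreal (exp (\<theta> * l1_dist z x)) \<partial>kern h x) \<le> (\<integral>\<^sup>+n. ennreal (exp (2 * \<theta>) ^ n) \<partial>pois (total * h))"
    unfolding kern_def by (auto intro!: nn_integral_mono)
  also have "\<dots> = ennreal (exp (total * h * (exp (2 * \<theta>) - 1)))"
    using h total_pos by (intro nn_integral_exp_pois) auto
  finally show ?thesis .
qed

primrec paths :: "(nat \<Rightarrow> real) \<Rightarrow> nat \<Rightarrow> (nat ^ 'k) list pmf" where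
  "paths t 0 = return_pmf [0]"
| "paths t (Suc m) = bind_pmf (paths t m) (\<lambda>xs. map_pmf (\<lambda>y. y # xs) (kern (t (Suc m) - t m) (hd xs)))"

lemma set_paths: "xs \<in> set_pmf (paths t m) \<Longrightarrow> length xs = Suc m"
  by (induction m arbitrary: xs) auto

lemma pmf_paths_Cons: "pmf (paths t (Suc m)) (y # xs) = pmf (paths t m) xs * pmf (kern (t (Suc m) - t m) (hd xs)) y"
proof -
  let ?K = "\<lambda>xs. map_pmf (\<lambda>y. y # xs) (kern (t (Suc m) - t m) (hd xs))"
  have "pmf (paths t (Suc m)) (y # xs) = (\<integral>xs'. pmf (?K xs') (y # xs) \<partial>paths t m)"
    by (simp add: pmf_bind)
  also have "\<dots> = (\<Sum>xs'\<in>{xs}. pmf (?K xs') (y # xs) * pmf (paths t m) xs')"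
  proof (rule integral_measure_pmf_real)
    fix xs' assume "pmf (?K xs') (y # xs) \<noteq> 0"
    then have "y # xs \<in> set_pmf (?K xs')" unfolding set_pmf_iff .
    then show "xs' \<in> {xs}" by auto
  qed simp
  also have "\<dots> = pmf (paths t m) xs * pmf (?K xs) (y # xs)" by simp
  also have "pmf (?K xs) (y # xs) = pmf (kern (t (Suc m) - t m) (hd xs)) y"
    by (rule pmf_map_inj') (auto intro: injI)
  finally show ?thesis .
qed

text \<open>Given the past, each increment contributes at most a Poisson moment factor, and the
  exponents add up to the length of the time window. The number of grid points does not enter, so
  the grid may be refined at no cost.\<close>

lemma nn_integral_exp_variation_paths:
  assumes \<theta>: "0 \<le> \<theta>" and t: "\<And>i. t i \<le> t (Suc i)"
  shows "(\<integral>\<^sup>+xs. ennreal (exp (\<theta> * variation xs)) \<partial>paths t (Suc m)) \<le>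
    ennreal (exp (total * (t (Suc m) - t 1) * (exp (2 * \<theta>) - 1)))"
proof (induction m)
  case 0
  have "(\<integral>\<^sup>+xs. ennreal (exp (\<theta> * variation xs)) \<partial>paths t (Suc 0)) = 1"
    by (simp add: bind_return_pmf measure_pmf.emeasure_space_1)
  then show ?case by simp
next
  case (Suc m)
  let ?c = "exp (2 * \<theta>) - 1"
  let ?h = "t (Suc (Suc m)) - t (Suc m)"
  have "(\<integral>\<^sup>+xs. ennreal (exp (\<theta> * variation xs)) \<partial>paths t (Suc (Suc m))) =
      (\<integral>\<^sup>+xs. (\<integral>\<^sup>+y. ennreal (exp (\<theta> * variation (y # xs))) \<partial>kern ?h (hd xs)) \<partial>paths t (Suc m))"
    by (subst paths.simps(2)) (simp only: nn_integral_bind_pmf nn_integral_map_pmf)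
  also have "\<dots> \<le> (\<integral>\<^sup>+xs. ennreal (exp (\<theta> * variation xs)) * ennreal (exp (total * ?h * ?c)) \<partial>paths t (Suc m))"
  proof (rule nn_integral_mono_AE, unfold AE_measure_pmf_iff, intro ballI)
    fix xs assume "xs \<in> set_pmf (paths t (Suc m))"
    then have "length xs = Suc (Suc m)" by (rule set_paths)
    then obtain x z zs where xs: "xs = x # z # zs" by (auto simp: length_Suc_conv)
    have "(\<integral>\<^sup>+y. ennreal (exp (\<theta> * variation (y # xs))) \<partial>kern ?h (hd xs)) =
        (\<integral>\<^sup>+y. ennreal (exp (\<theta> * variation xs)) * ennreal (exp (\<theta> * l1_dist y x)) \<partial>kern ?h x)"
      by (simp add: xs distrib_left exp_add ennreal_mult mult.commute)
    also have "\<dots> = ennreal (exp (\<theta> * variation xs)) * (\<integral>\<^sup>+y. ennreal (exp (\<theta> * l1_dist y x)) \<partial>kern ?h x)"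
      by (rule nn_integral_cmult) simp
    also have "\<dots> \<le> ennreal (exp (\<theta> * variation xs)) * ennreal (exp (total * ?h * ?c))"
      using t[of "Suc m"] by (intro mult_left_mono nn_integral_exp_l1_dist_kern \<theta>) auto
    finally show "(\<integral>\<^sup>+y. ennreal (exp (\<theta> * variation (y # xs))) \<partial>kern ?h (hd xs)) \<le>
        ennreal (exp (\<theta> * variation xs)) * ennreal (exp (total * ?h * ?c))" .
  qed
  also have "\<dots> = (\<integral>\<^sup>+xs. ennreal (exp (\<theta> * variation xs)) \<partial>paths t (Suc m)) * ennreal (exp (total * ?h * ?c))"
    by (rule nn_integral_multc) simp
  also have "\<dots> \<le> ennreal (exp (total * (t (Suc m) - t 1) * ?c)) * ennreal (exp (total * ?h * ?c))"
    by (intro mult_right_mono Suc.IH) auto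
  also have "\<dots> = ennreal (exp (total * (t (Suc (Suc m)) - t 1) * ?c))"
    by (simp add: algebra_simps flip: ennreal_mult exp_add)
  finally show ?case .
qed

end

section \<open>The law of the given chain on grids and its oscillations\<close>

locale jackson_chain = jackson a mu p + prob_space M
  for a mu :: "real ^ 'k" and p :: "real ^ 'k ^ 'k" and M :: "'w measure" +
  fixes Q :: "real \<Rightarrow> 'w \<Rightarrow> nat ^ 'k"
  assumes chain: "markov_chain M (jackson_rate a mu p) Q" and start: "AE w in M. Q 0 w = 0"
begin

lemma Q_measurable: "0 \<le> t \<Longrightarrow> Q t \<in> measurable M (count_space UNIV)"
  using chain unfolding markov_chain_def by blast

lemma Q_eq_sets: "0 \<le> t \<Longrightarrow> {w\<in>space M. Q t w = x} \<in> sets M"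
  using measurable_sets[OF Q_measurable, of t "{x}"] by (simp add: vimage_def Collect_conj_eq Int_commute)

text \<open>In a discrete topology convergence from the right is eventual equality, and finitely
  many components can be treated together.\<close>

lemma Q_right_constant:
  assumes w: "w \<in> space M" and t: "0 \<le> t"
  shows "\<exists>d>0. \<forall>s. t \<le> s \<longrightarrow> s < t + d \<longrightarrow> Q s w = Q t w"
proof -
  have "((\<lambda>s. Q s w) \<longlongrightarrow> Q t w) (at_right t)"
    using chain w t unfolding markov_chain_def continuous_within by blast
  then have "((\<lambda>s. Q s w $ k) \<longlongrightarrow> Q t w $ k) (at_right t)" for k
    by (rule tendsto_vec_nth)
  then have "\<forall>\<^sub>F s in at_right t. Q s w $ k = Q t w $ k" for k
    by (rule tendsto_discrete[THEN iffD1])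
  then have "\<forall>\<^sub>F s in at_right t. \<forall>k. Q s w $ k = Q t w $ k"
    by (simp add: eventually_all_finite)
  then obtain b where b: "b > t" "\<And>s. t < s \<Longrightarrow> s < b \<Longrightarrow> \<forall>k. Q s w $ k = Q t w $ k"
    by (auto simp: eventually_at_right_field)
  have "Q s w = Q t w" if "t \<le> s" "s < t + (b - t)" for s
    using b(2)[of s] that by (cases "s = t") (auto simp: vec_eq_iff)
  moreover have "0 < b - t" using b(1) by simp
  ultimately show ?thesis by blast
qed

text \<open>Here the unspecified transition function of \<open>markov_chain\<close> is replaced by
  the explicit kernel through \<open>tr_eq_kern\<close>; from then on all laws are pmfs.\<close>

lemma finite_dimensional:
  assumes t: "t 0 = 0" "\<And>i. t i \<le> t (Suc i)"
  shows "\<P>(w in M. \<forall>i\<le>m. Q (t i) w = x i) = pmf (paths t m) (history x m)"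
proof -
  obtain tr where tr: "transition_function tr" and rates: "has_transition_rates tr (jackson_rate a mu p)"
    and markov: "\<And>n t x. 0 \<le> t 0 \<Longrightarrow> (\<And>i. i \<le> n \<Longrightarrow> t i \<le> t (Suc i)) \<Longrightarrow>
           \<P>(w in M. \<forall>i\<le>Suc n. Q (t i) w = x i) =
           \<P>(w in M. \<forall>i\<le>n. Q (t i) w = x i) * tr (t (Suc n) - t n) (x n) (x (Suc n))"
    using chain unfolding markov_chain_def by blast
  show ?thesis
  proof (induction m)
    case 0
    have "\<P>(w in M. \<forall>i\<le>0. Q (t i) w = x i) = \<P>(w in M. 0 = x 0)"
      using start t(1) by (intro finite_measure_eq_AE) (auto simp: Q_eq_sets)
    also have "\<dots> = pmf (paths t 0) (history x 0)"
      using prob_space by (auto simp: indicator_def)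
    finally show ?case .
  next
    case (Suc m)
    have "\<P>(w in M. \<forall>i\<le>Suc m. Q (t i) w = x i) = \<P>(w in M. \<forall>i\<le>m. Q (t i) w = x i) * tr (t (Suc m) - t m) (x m) (x (Suc m))"
      using t by (intro markov) auto
    also have "\<dots> = pmf (paths t m) (history x m) * pmf (kern (t (Suc m) - t m) (x m)) (x (Suc m))"
      using t(2)[of m] by (simp add: Suc.IH tr_eq_kern[OF tr rates])
    finally show ?case by (simp only: history.simps pmf_paths_Cons hd_history)
  qed
qed

lemma history_measurable:
  assumes "\<And>i. 0 \<le> t i"
  shows "(\<lambda>w. history (\<lambda>i. Q (t i) w) m) \<in> measurable M (count_space UNIV)"
proof (subst measurable_count_space_eq2_countable, intro conjI ballI)
  fix xs :: "(nat ^ 'k) list"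
  show "(\<lambda>w. history (\<lambda>i. Q (t i) w) m) -` {xs} \<inter> space M \<in> sets M"
  proof (cases "length xs = Suc m")
    case True
    then obtain x where x: "xs = history x m" using history_surj by blast
    have "(\<lambda>w. history (\<lambda>i. Q (t i) w) m) -` {xs} \<inter> space M = {w\<in>space M. \<forall>i\<in>{..m}. Q (t i) w = x i}"
      by (auto simp: x history_eq_iff)
    also have "\<dots> \<in> sets M" using Q_eq_sets assms by (intro sets.sets_Collect_finite_All) auto
    finally show ?thesis .
  next
    case False
    then have "(\<lambda>w. history (\<lambda>i. Q (t i) w) m) -` {xs} \<inter> space M = {}" by auto
    then show ?thesis by simp
  qed
qed auto

theorem history_distr:
  assumes t: "t 0 = 0" "\<And>i. t i \<le> t (Suc i)"
  shows "distr M (count_space UNIV) (\<lambda>w. history (\<lambda>i. Q (t i) w) m) = measure_pmf (paths t m)"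
proof (rule measure_eqI_countable[where A = UNIV])
  have t0: "0 \<le> t i" for i using t by (induction i) (auto intro: order_trans)
  let ?H = "\<lambda>w. history (\<lambda>i. Q (t i) w) m"
  fix xs :: "(nat ^ 'k) list"
  have "emeasure (distr M (count_space UNIV) ?H) {xs} = emeasure M (?H -` {xs} \<inter> space M)"
    by (intro emeasure_distr history_measurable t0) auto
  also have "\<dots> = emeasure (paths t m) {xs}"
  proof (cases "length xs = Suc m")
    case True
    then obtain x where x: "xs = history x m" using history_surj by blast
    have "?H -` {xs} \<inter> space M = {w\<in>space M. \<forall>i\<le>m. Q (t i) w = x i}"
      by (auto simp: x history_eq_iff)
    then show ?thesis
      using finite_dimensional[OF t, of m x] by (simp add: emeasure_eq_measure emeasure_pmf_single x)
  next
    case False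
    then have "?H -` {xs} \<inter> space M = {}" by auto
    moreover have "pmf (paths t m) xs = 0" using False set_paths by (auto simp: pmf_eq_0_set_pmf)
    ultimately show ?thesis by (simp add: emeasure_pmf_single)
  qed
  finally show "emeasure (distr M (count_space UNIV) ?H) {xs} = emeasure (measure_pmf (paths t m)) {xs}" .
qed auto

lemma prob_history:
  assumes t: "t 0 = 0" "\<And>i. t i \<le> t (Suc i)"
  shows "{w\<in>space M. history (\<lambda>i. Q (t i) w) m \<in> A} \<in> sets M"
    and "\<P>(w in M. history (\<lambda>i. Q (t i) w) m \<in> A) = measure_pmf.prob (paths t m) A"
proof -
  have t0: "0 \<le> t i" for i using t by (induction i) (auto intro: order_trans)
  have eq: "{w\<in>space M. history (\<lambda>i. Q (t i) w) m \<in> A} = (\<lambda>w. history (\<lambda>i. Q (t i) w) m) -` A \<inter> space M" by auto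
  show "{w\<in>space M. history (\<lambda>i. Q (t i) w) m \<in> A} \<in> sets M"
    unfolding eq by (rule measurable_sets[OF history_measurable[OF t0]]) simp
  have "measure_pmf.prob (paths t m) A = measure (distr M (count_space UNIV) (\<lambda>w. history (\<lambda>i. Q (t i) w) m)) A"
    by (simp add: history_distr[OF t])
  also have "\<dots> = measure M ((\<lambda>w. history (\<lambda>i. Q (t i) w) m) -` A \<inter> space M)"
    by (rule measure_distr[OF history_measurable[OF t0]]) simp
  finally show "\<P>(w in M. history (\<lambda>i. Q (t i) w) m \<in> A) = measure_pmf.prob (paths t m) A" by (simp add: eq)
qed

lemma oscillation_grid:
  assumes \<theta>: "0 \<le> \<theta>" and s: "0 \<le> s" and h: "0 \<le> h" and N: "0 < N"
  shows "{w\<in>space M. \<exists>i\<le>N. D \<le> l1_dist (Q (s + real i * h / real N) w) (Q s w)} \<in> sets M" (is "?B \<in> _")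
    and "\<P>(w in M. \<exists>i\<le>N. D \<le> l1_dist (Q (s + real i * h / real N) w) (Q s w))
      \<le> exp (total * h * (exp (2 * \<theta>) - 1) - \<theta> * D)"
proof -
  \<comment> \<open>The list of times has to begin at 0, where the state is known; hence the window
    starts at index 1 and its \<open>i\<close>-th grid point has index \<open>Suc i\<close>.\<close>
  define t where "t i = (case i of 0 \<Rightarrow> 0 | Suc j \<Rightarrow> s + real j * h / real N)" for i
  have t: "t 0 = 0" "t i \<le> t (Suc i)" for i
    using s h N by (auto simp: t_def divide_right_mono mult_right_mono split: nat.split)
  let ?H = "\<lambda>w. history (\<lambda>i. Q (t i) w) (Suc N)"
  have sub: "w \<in> ?B \<Longrightarrow> D \<le> variation (?H w)" for w
  proof -
    assume "w \<in> ?B"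
    then obtain i where i: "i \<le> N" "D \<le> l1_dist (Q (s + real i * h / real N) w) (Q s w)" by blast
    have "l1_dist (Q (t (Suc i)) w) (Q (t 1) w) \<le> variation (?H w)"
      by (rule l1_dist_le_variation[OF i(1), of "\<lambda>i. Q (t i) w"])
    then show ?thesis using i(2) by (simp add: t_def)
  qed
  have sets: "{w\<in>space M. D \<le> l1_dist (Q (s + real i * h / real N) w) (Q s w)} \<in> sets M" for i
  proof -
    have "(\<lambda>w. (Q (s + real i * h / real N) w, Q s w)) \<in> measurable M (count_space UNIV)"
    proof (subst measurable_count_space_eq2_countable, intro conjI ballI)
      fix xy :: "(nat ^ 'k) \<times> (nat ^ 'k)"
      have "(\<lambda>w. (Q (s + real i * h / real N) w, Q s w)) -` {xy} \<inter> space M =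
          {w\<in>space M. Q (s + real i * h / real N) w = fst xy} \<inter> {w\<in>space M. Q s w = snd xy}"
        by (cases xy) auto
      also have "\<dots> \<in> sets M" using s h by (intro sets.Int Q_eq_sets) auto
      finally show "(\<lambda>w. (Q (s + real i * h / real N) w, Q s w)) -` {xy} \<inter> space M \<in> sets M" .
    qed auto
    from measurable_sets[OF this, of "{(x, y). D \<le> l1_dist x y}"]
    show ?thesis by (simp add: vimage_def Collect_conj_eq Int_commute)
  qed
  have "?B = (\<Union>i\<in>{..N}. {w\<in>space M. D \<le> l1_dist (Q (s + real i * h / real N) w) (Q s w)})" by auto
  then show "?B \<in> sets M" using sets by auto
  let ?V = "{xs. D \<le> variation xs}"
  have "measure M ?B \<le> \<P>(w in M. ?H w \<in> ?V)"
  proof (rule finite_measure_mono)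
    show "{w\<in>space M. ?H w \<in> ?V} \<in> sets M" by (rule prob_history(1)[OF t])
    show "?B \<subseteq> {w\<in>space M. ?H w \<in> ?V}" using sub by blast
  qed
  also have "\<dots> = measure_pmf.prob (paths t (Suc N)) ?V" by (rule prob_history(2)[OF t])
  also have "\<dots> \<le> exp (total * h * (exp (2 * \<theta>) - 1) - \<theta> * D)"
  proof -
    have "emeasure (paths t (Suc N)) ?V = (\<integral>\<^sup>+xs. indicator ?V xs \<partial>paths t (Suc N))"
      by (rule nn_integral_indicator[symmetric]) simp
    also have "\<dots> \<le> (\<integral>\<^sup>+xs. ennreal (exp (- (\<theta> * D))) * ennreal (exp (\<theta> * variation xs)) \<partial>paths t (Suc N))"
    proof (intro nn_integral_mono)
      fix xs
      show "indicator ?V xs \<le> ennreal (exp (- (\<theta> * D))) * ennreal (exp (\<theta> * variation xs))"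
      proof (cases "xs \<in> ?V")
        case True
        then have "\<theta> * D \<le> \<theta> * variation xs" using \<theta> by (intro mult_left_mono) auto
        then have "ennreal 1 \<le> ennreal (exp (- (\<theta> * D)) * exp (\<theta> * variation xs))"
          by (intro ennreal_leI) (simp flip: exp_add)
        then show ?thesis using True by (simp add: ennreal_mult)
      qed simp
    qed
    also have "\<dots> = ennreal (exp (- (\<theta> * D))) * (\<integral>\<^sup>+xs. ennreal (exp (\<theta> * variation xs)) \<partial>paths t (Suc N))"
      by (rule nn_integral_cmult) simp
    also have "\<dots> \<le> ennreal (exp (- (\<theta> * D))) * ennreal (exp (total * (t (Suc N) - t 1) * (exp (2 * \<theta>) - 1)))"
      by (intro mult_left_mono nn_integral_exp_variation_paths \<theta> t) auto
    also have "\<dots> = ennreal (exp (total * h * (exp (2 * \<theta>) - 1) - \<theta> * D))"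
      using N by (simp add: t_def algebra_simps flip: ennreal_mult exp_add)
    finally show ?thesis by (simp add: measure_pmf.emeasure_eq_measure)
  qed
  finally show "measure M ?B \<le> exp (total * h * (exp (2 * \<theta>) - 1) - \<theta> * D)" .
qed

text \<open>Dyadic grids are nested, so the grid events increase and their union inherits the
  uniform bound. Right-continuity makes this union cover all times of the window. A measurable cover
  \<open>B\<close> is produced because the oscillation event itself involves uncountably many
  times.\<close>

theorem oscillation:
  assumes \<theta>: "0 \<le> \<theta>" and s: "0 \<le> s" and h: "0 \<le> h"
  shows "\<exists>B\<in>sets M. measure M B \<le> exp (total * h * (exp (2 * \<theta>) - 1) - \<theta> * D) \<and>
    (\<forall>w\<in>space M. \<forall>t\<in>{s..s + h}. D \<le> l1_dist (Q t w) (Q s w) \<longrightarrow> w \<in> B)"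
proof -
  define A where "A j = {w\<in>space M. \<exists>i\<le>2 ^ j. D \<le> l1_dist (Q (s + real i * h / real (2 ^ j)) w) (Q s w)}" for j :: nat
  have A: "A j \<in> sets M" "measure M (A j) \<le> exp (total * h * (exp (2 * \<theta>) - 1) - \<theta> * D)" for j
    unfolding A_def by (rule oscillation_grid[OF \<theta> s h], simp)+
  have inc: "incseq A"
  proof (rule incseq_SucI, rule subsetI)
    fix j w assume "w \<in> A j"
    then obtain i where i: "w \<in> space M" "i \<le> 2 ^ j" "D \<le> l1_dist (Q (s + real i * h / real (2 ^ j)) w) (Q s w)"
      by (auto simp: A_def)
    have "real (2 * i) * h / real (2 ^ Suc j) = real i * h / real (2 ^ j)" by simp
    then show "w \<in> A (Suc j)" using i by (auto simp: A_def intro!: exI[of _ "2 * i"])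
  qed
  have "(\<lambda>j. measure M (A j)) \<longlonglongrightarrow> measure M (\<Union>j. A j)"
    using A(1) inc by (intro finite_Lim_measure_incseq) auto
  then have "measure M (\<Union>j. A j) \<le> exp (total * h * (exp (2 * \<theta>) - 1) - \<theta> * D)"
    by (rule LIMSEQ_le_const2) (use A(2) in auto)
  moreover have "w \<in> (\<Union>j. A j)" if w: "w \<in> space M" and t: "t \<in> {s..s + h}" and D: "D \<le> l1_dist (Q t w) (Q s w)" for w t
  \<comment> \<open>To the right of the last time there is no grid point to approximate from, but it
    lies on every grid.\<close>
  proof (cases "t = s + h")
    case True
    then have "w \<in> A 0" using w D by (auto simp: A_def intro!: exI[of _ 1])
    then show ?thesis by blast
  next
    case False
    then have h0: "0 < h" and t': "s \<le> t" "t < s + h" using t by auto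
    obtain d where d: "d > 0" "\<And>u. t \<le> u \<Longrightarrow> u < t + d \<Longrightarrow> Q u w = Q t w"
      using Q_right_constant[OF w, of t] t' s by auto
    \<comment> \<open>A mesh below \<open>d\<close> puts the next grid point to the right of
      \<open>t\<close> inside the interval on which the path keeps the value
      \<open>Q t w\<close>.\<close>
    obtain j where j: "h / d < 2 ^ j" using real_arch_pow[of 2 "h / d"] by auto
    define z where "z = (t - s) / h * 2 ^ j"
    have "(t - s) / h \<le> 1" using t' h0 by simp
    then have z: "0 \<le> z" "z \<le> 2 ^ j"
      using t' h0 mult_right_mono[of "(t - s) / h" 1 "2 ^ j"] by (auto simp: z_def)
    define i where "i = nat \<lceil>z\<rceil>"
    have i: "z \<le> real i" "real i < z + 1" using z by (auto simp: i_def) linarith+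
    have "i \<le> 2 ^ j"
    proof -
      have "\<lceil>z\<rceil> \<le> 2 ^ j" using z(2) by (simp add: ceiling_le_iff)
      then have "int i \<le> int (2 ^ j)" using z by (simp add: i_def)
      then show ?thesis by (simp only: of_nat_le_iff)
    qed
    define u where "u = s + real i * h / real (2 ^ j)"
    have tz: "t = s + z * h / 2 ^ j" using h0 by (simp add: z_def)
    have "t \<le> u" unfolding tz u_def using i(1) h0 by (simp add: divide_right_mono)
    moreover have "u < t + d"
    proof -
      have "real i * h / 2 ^ j < (z + 1) * h / 2 ^ j" using i(2) h0 by (simp add: divide_strict_right_mono)
      also have "\<dots> = z * h / 2 ^ j + h / 2 ^ j" by (simp add: field_simps)
      also have "h / 2 ^ j < d" using j d(1) by (simp add: field_simps)
      finally show ?thesis by (simp add: tz u_def)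
    qed
    ultimately have "Q u w = Q t w" by (rule d(2))
    then have "w \<in> A j" using w D \<open>i \<le> 2 ^ j\<close> by (auto simp: A_def u_def)
    then show ?thesis by blast
  qed
  ultimately show ?thesis using A(1) by (intro bexI[of _ "\<Union>j. A j"]) auto
qed

lemma prob_two_times:
  assumes "0 \<le> s" "s \<le> t"
  shows "{w\<in>space M. Q s w \<in> A \<and> Q t w = x} \<in> sets M"
    and "ennreal \<P>(w in M. Q s w \<in> A \<and> Q t w = x) =
      (\<integral>\<^sup>+y. indicator A y * ennreal (pmf (kern (t - s) y) x) \<partial>kern s 0)"
proof -
  define \<tau> where "\<tau> i = (if i = 0 then 0 else if i = 1 then s else t)" for i :: nat
  have \<tau>: "\<tau> 0 = 0" "\<tau> i \<le> \<tau> (Suc i)" for i using assms by (auto simp: \<tau>_def)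
  let ?X = "{xs. xs ! 1 \<in> A \<and> xs ! 0 = x}"
  have eq: "{w\<in>space M. Q s w \<in> A \<and> Q t w = x} = {w\<in>space M. history (\<lambda>i. Q (\<tau> i) w) 2 \<in> ?X}"
    by (simp add: numeral_2_eq_2 \<tau>_def)
  show "{w\<in>space M. Q s w \<in> A \<and> Q t w = x} \<in> sets M"
    unfolding eq by (rule prob_history(1)[OF \<tau>])
  have "ennreal \<P>(w in M. Q s w \<in> A \<and> Q t w = x) = emeasure (paths \<tau> 2) ?X"
    unfolding eq prob_history(2)[OF \<tau>] by (simp add: measure_pmf.emeasure_eq_measure)
  also have "\<dots> = (\<integral>\<^sup>+y. (\<integral>\<^sup>+z. indicator A y * indicator {x} z \<partial>kern (t - s) y) \<partial>kern s 0)"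
  proof -
    have "emeasure (paths \<tau> 2) ?X = (\<integral>\<^sup>+xs. indicator ?X xs \<partial>paths \<tau> 2)" by simp
    also have "\<dots> = (\<integral>\<^sup>+y. (\<integral>\<^sup>+z. indicator ?X [z, y, 0] \<partial>kern (t - s) y) \<partial>kern s 0)"
      by (simp only: numeral_2_eq_2 paths.simps nn_integral_bind_pmf nn_integral_map_pmf bind_return_pmf list.sel)
         (simp add: \<tau>_def)
    also have "\<dots> = (\<integral>\<^sup>+y. (\<integral>\<^sup>+z. indicator A y * indicator {x} z \<partial>kern (t - s) y) \<partial>kern s 0)"
      by (intro nn_integral_cong) (auto simp: indicator_def)
    finally show ?thesis .
  qed
  also have "\<dots> = (\<integral>\<^sup>+y. indicator A y * ennreal (pmf (kern (t - s) y) x) \<partial>kern s 0)"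
    by (simp add: nn_integral_cmult emeasure_pmf_single)
  finally show "ennreal \<P>(w in M. Q s w \<in> A \<and> Q t w = x) =
      (\<integral>\<^sup>+y. indicator A y * ennreal (pmf (kern (t - s) y) x) \<partial>kern s 0)" .
qed

lemma prob_one_time:
  assumes "0 \<le> t"
  shows "\<P>(w in M. Q t w = x) = pmf (kern t 0) x"
proof -
  have "ennreal \<P>(w in M. Q 0 w \<in> UNIV \<and> Q t w = x) = ennreal (pmf (kern t 0) x)"
    unfolding prob_two_times(2)[OF order_refl assms] by simp
  then show ?thesis by simp
qed

end

section \<open>Large deviations of the reversed network\<close>

lemma is_norm_equivalent:
  fixes N :: "real ^ 'k \<Rightarrow> real"
  assumes N: "is_norm N"
  shows "\<exists>c1>0. \<exists>c2>0. \<forall>x. c1 * norm x \<le> N x \<and> N x \<le> c2 * norm x"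
proof -
  have N0: "0 \<le> N x" and Nz: "N x = 0 \<longleftrightarrow> x = 0" and Ns: "N (c *\<^sub>R x) = \<bar>c\<bar> * N x"
    and Nt: "N (x + y) \<le> N x + N y" for x y c
    using N unfolding is_norm_def by blast+
  have Nsum: "N (\<Sum>k\<in>A. f k) \<le> (\<Sum>k\<in>A. N (f k))" if "finite A" for f and A :: "'k set"
    using that
  proof (induction A rule: finite_induct)
    case (insert k A)
    then show ?case using Nt[of "f k" "\<Sum>k\<in>A. f k"] by simp
  qed (use Nz[of 0] in simp)
  define c2 where "c2 = (\<Sum>k\<in>UNIV. N (axis k 1)) + 1"
  have c2: "0 < c2" unfolding c2_def by (intro add_nonneg_pos sum_nonneg N0) auto
  have upper: "N x \<le> c2 * norm x" for x
  proof -
    have "N x = N (\<Sum>k\<in>UNIV. (x $ k) *\<^sub>R axis k 1)"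
      by (simp only: basis_expansion flip: scalar_mult_eq_scaleR)
    also have "\<dots> \<le> (\<Sum>k\<in>UNIV. N ((x $ k) *\<^sub>R axis k 1))" by (rule Nsum) simp
    also have "\<dots> \<le> (\<Sum>k\<in>UNIV. norm x * N (axis k 1))"
      unfolding Ns by (intro sum_mono mult_right_mono component_le_norm_cart N0)
    also have "\<dots> = (c2 - 1) * norm x" by (simp add: c2_def sum_distrib_left mult.commute)
    also have "\<dots> \<le> c2 * norm x" by (intro mult_right_mono) auto
    finally show ?thesis .
  qed
  have diff: "\<bar>N x - N y\<bar> \<le> c2 * norm (x - y)" for x y
  proof -
    have "N x \<le> N y + N (x - y)" "N y \<le> N x + N (y - x)" using Nt[of y "x - y"] Nt[of x "y - x"] by auto
    then show ?thesis using upper[of "x - y"] upper[of "y - x"] by (simp add: abs_le_iff norm_minus_commute)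
  qed
  have "c2-lipschitz_on (sphere 0 1) N"
    using c2 diff by (intro lipschitz_onI) (auto simp: dist_real_def dist_norm)
  then have cont: "continuous_on (sphere 0 1) N" by (rule lipschitz_on_continuous_on)
  have "axis undefined 1 \<in> sphere (0 :: real ^ 'k) 1" by simp
  then have ne: "sphere (0 :: real ^ 'k) 1 \<noteq> {}" by blast
  obtain z where z: "z \<in> sphere 0 1" "\<And>x. x \<in> sphere 0 1 \<Longrightarrow> N z \<le> N x"
    using continuous_attains_inf[OF compact_sphere ne cont] by blast
  have "N z \<noteq> 0" using z(1) by (auto simp: Nz)
  then have Nz0: "0 < N z" using N0[of z] by simp
  have "N z * norm x \<le> N x" for x
  proof (cases "x = 0")
    case False
    then have "x /\<^sub>R norm x \<in> sphere 0 1" by simp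
    then have "N z \<le> N (x /\<^sub>R norm x)" by (rule z(2))
    also have "\<dots> = N x / norm x" by (simp add: Ns divide_inverse mult.commute)
    finally show ?thesis using False by (simp add: pos_le_divide_eq)
  qed (simp add: N0)
  then show ?thesis using Nz0 c2 upper by blast
qed

lemma box_card:
  "finite {x :: nat ^ 'k. \<forall>k. x $ k \<le> m}" "card {x :: nat ^ 'k. \<forall>k. x $ k \<le> m} \<le> (m + 1) ^ CARD('k)"
proof -
  let ?F = "PiE (UNIV :: 'k set) (\<lambda>_. {..m})"
  have F: "finite ?F" by (intro finite_PiE) auto
  have eq: "{x :: nat ^ 'k. \<forall>k. x $ k \<le> m} = vec_lambda ` ?F"
  proof
    show "{x :: nat ^ 'k. \<forall>k. x $ k \<le> m} \<subseteq> vec_lambda ` ?F"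
    proof
      fix x :: "nat ^ 'k" assume "x \<in> {x. \<forall>k. x $ k \<le> m}"
      then have "($) x \<in> ?F" by (auto simp: PiE_def)
      moreover have "x = vec_lambda (($) x)" by (simp add: vec_eq_iff)
      ultimately show "x \<in> vec_lambda ` ?F" by blast
    qed
  qed auto
  show "finite {x :: nat ^ 'k. \<forall>k. x $ k \<le> m}" unfolding eq using F by simp
  show "card {x :: nat ^ 'k. \<forall>k. x $ k \<le> m} \<le> (m + 1) ^ CARD('k)"
    unfolding eq using card_image_le[OF F, of vec_lambda] by (simp add: card_PiE)
qed

text \<open>Lets the number of lattice states within a ball at scale \<open>n\<close> be absorbed by
  an arbitrarily small exponential rate.\<close>

lemma poly_le_exp:
  fixes \<kappa> R :: real
  assumes \<kappa>: "0 < \<kappa>" and R: "0 \<le> R" and K: "0 < K"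
  shows "\<forall>\<^sub>F n in sequentially. (R * real n + 1) ^ K \<le> exp (\<kappa> * real n)"
proof -
  define b where "b = \<kappa> / real K"
  have b: "0 < b" using \<kappa> K by (simp add: b_def)
  have "(\<lambda>n. real n * exp (- b) ^ n) \<longlonglongrightarrow> 0" using b by (intro powser_times_n_limit_0) auto
  then have "(\<lambda>n. R * (real n * exp (- b) ^ n) + 1 * exp (- (b * real n))) \<longlonglongrightarrow> R * 0 + 0"
    by (intro tendsto_intros exp_decay_tendsto_0 b)
  then have "\<forall>\<^sub>F n in sequentially. R * (real n * exp (- b) ^ n) + 1 * exp (- (b * real n)) < 1"
    by (intro order_tendstoD) auto
  then show ?thesis
  proof eventually_elim
    case (elim n)
    have "exp (- b) ^ n = exp (- (b * real n))" by (simp add: mult.commute flip: exp_of_nat_mult)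
    then have "(R * real n + 1) * exp (- (b * real n)) \<le> 1" using elim by (simp add: algebra_simps)
    then have "R * real n + 1 \<le> exp (b * real n)" by (simp add: exp_minus field_simps)
    then have "(R * real n + 1) ^ K \<le> exp (b * real n) ^ K" using R by (intro power_mono) auto
    also have "\<dots> = exp (\<kappa> * real n)" using K by (simp add: b_def flip: exp_of_nat_mult)
    finally show ?case .
  qed
qed

lemma scaled_queue_eq: "scaled_queue Q n t w = vec_of (Q (real n * t) w) /\<^sub>R real n"
  by (simp add: scaled_queue_def vec_eq_iff divide_inverse mult.commute)

lemma (in network) fluid_trajectory_lipschitz:
  assumes fluid: "fluid_trajectory a mu p r q"
  shows "\<exists>L\<ge>0. \<forall>s\<ge>0. \<forall>t\<ge>0. norm (q t - q s) \<le> L * \<bar>t - s\<bar>"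
proof -
  obtain y C where C: "0 \<le> C" and reg: "regulated y C" and q: "\<And>t. 0 \<le> t \<Longrightarrow> q t = res (y t)"
    using fluid_trajectory_regulated[OF fluid] by metis
  obtain L where L: "0 \<le> L" "\<And>s t k. 0 \<le> s \<Longrightarrow> 0 \<le> t \<Longrightarrow> \<bar>y t $ k - y s $ k\<bar> \<le> L * \<bar>t - s\<bar>"
    using regulated_uniformly_lipschitz[of C] reg by blast
  obtain b' where b': "b' > 0" "\<And>x. norm (res x) \<le> b' * norm x"
    using linear_bounded_pos[OF linear_res] by blast
  have "norm (q t - q s) \<le> b' * (real CARD('k) * L) * \<bar>t - s\<bar>" if "0 \<le> s" "0 \<le> t" for s t
  proof -
    have "norm (y t - y s) \<le> (\<Sum>k\<in>UNIV. \<bar>(y t - y s) $ k\<bar>)" by (rule norm_le_l1_cart)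
    also have "\<dots> \<le> (\<Sum>k\<in>(UNIV::'k set). L * \<bar>t - s\<bar>)" using L(2)[OF that] by (intro sum_mono) simp
    finally have "b' * norm (y t - y s) \<le> b' * (real CARD('k) * L * \<bar>t - s\<bar>)"
      using b'(1) by (intro mult_left_mono) auto
    then show ?thesis using b'(2)[of "y t - y s"] q that by (simp add: res_diff mult.assoc)
  qed
  then show ?thesis using b' L by (intro exI[of _ "b' * (real CARD('k) * L)"]) auto
qed

text \<open>The zero set is nonempty by \<open>regulated_reaches_zero\<close> and closed by
  Lipschitz continuity, so the infimum is attained.\<close>

lemma (in network) emptying_time_reached:
  assumes fluid: "fluid_trajectory a mu p r q" and stable: "\<And>k. nu $ k < mu $ k"
  shows "0 \<le> emptying_time q" "q (emptying_time q) = 0"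
proof -
  obtain y C where C: "0 \<le> C" and reg: "regulated y C" and q: "\<And>t. 0 \<le> t \<Longrightarrow> q t = res (y t)"
    using fluid_trajectory_regulated[OF fluid] by metis
  obtain t where "0 \<le> t" "y t = 0" using regulated_reaches_zero[OF reg stable] by blast
  then have ne: "{t. 0 \<le> t \<and> q t = 0} \<noteq> {}" using q by force
  obtain L where L: "0 \<le> L" "\<forall>s\<ge>0. \<forall>t\<ge>0. norm (q t - q s) \<le> L * \<bar>t - s\<bar>"
    using fluid_trajectory_lipschitz[OF fluid] by blast
  have "L-lipschitz_on {0..} q"
    using L by (intro lipschitz_onI) (auto simp: dist_norm dist_real_def)
  then have "closed {t \<in> {0..}. q t = 0}"
    by (intro continuous_closed_preimage_constant lipschitz_on_continuous_on) auto
  then have "closed {t. 0 \<le> t \<and> q t = 0}" by simp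
  moreover have "bdd_below {t. 0 \<le> t \<and> q t = 0}" by (auto intro!: bdd_belowI[of _ 0])
  ultimately have "Inf {t. 0 \<le> t \<and> q t = 0} \<in> {t. 0 \<le> t \<and> q t = 0}"
    using closed_contains_Inf[OF ne] by blast
  then show "0 \<le> emptying_time q" "q (emptying_time q) = 0" by (auto simp: emptying_time_def)
qed

section \<open>Probabilities of terminal states via reversal\<close>

locale reversed_network =
  duality: jackson_duality lam a mu P p rho + bw: network a mu p nu v \<beta> + chain: jackson_chain lam mu P M Q
  for lam a mu :: "real ^ 'k" and P p :: "real ^ 'k ^ 'k" and rho nu v :: "real ^ 'k" and \<beta> :: real
    and M :: "'w measure" and Q :: "real \<Rightarrow> 'w \<Rightarrow> nat ^ 'k" +
  fixes q :: "real \<Rightarrow> real ^ 'k" and r :: "real ^ 'k" and T :: real and theta :: "real ^ 'k"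
  assumes lam_pos: "0 < lam $ k" and stable: "nu $ k < mu $ k" and rho_less_1: "rho $ k < 1"
    and fluid: "fluid_trajectory a mu p r q" and r_nonneg: "0 \<le> r $ k"
    and T_def: "T = emptying_time q" and theta_def: "theta = (\<chi> k. - ln (rho $ k))"
begin

lemma T_nonneg: "0 \<le> T" and q_T: "q T = 0"
  using bw.emptying_time_reached[OF fluid stable] by (auto simp: T_def)

lemma q_0: "q 0 = r"
proof -
  from fluid obtain phi where "\<forall>t\<ge>0. q t = r + t *\<^sub>R (a - (mat 1 - transpose p) *v mu) + (mat 1 - transpose p) *v phi t"
    "phi 0 = 0" unfolding fluid_trajectory_def by blast
  then show ?thesis by simp
qed

lemma theta_nonneg: "0 \<le> theta $ k"
  using duality.rho_pos[of k] rho_less_1[of k] by (simp add: theta_def)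

lemma wt_eq: "duality.wt x = exp (- (theta \<bullet> vec_of x))"
proof -
  have "rho $ k ^ x $ k = exp (- (theta $ k * real (x $ k)))" for k
    using duality.rho_pos[of k] by (simp add: theta_def exp_of_nat_mult mult.commute[of "ln _"])
  then have "duality.wt x = (\<Prod>k\<in>UNIV. exp (- (theta $ k * real (x $ k))))"
    unfolding duality.wt_def by (intro prod.cong) auto
  also have "\<dots> = exp (\<Sum>k\<in>UNIV. - (theta $ k * real (x $ k)))" by (rule exp_sum[symmetric]) simp
  finally show ?thesis by (simp add: inner_vec_def sum_negf)
qed

lemma wt_le_1: "duality.wt x \<le> 1"
  unfolding wt_eq using theta_nonneg by (simp add: inner_vec_def sum_nonneg)

lemma kern_reverse_0: "pmf (duality.fw.kern s 0) x = duality.wt x * pmf (duality.bw.kern s x) 0"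
  using duality.kern_reverse[of 0 s x] by simp

text \<open>By reversal the probability of ending at \<open>x\<close> is \<open>wt x\<close> times
  the probability that the dual network started at \<open>x\<close> is empty at time
  \<open>n * T\<close>. The fluid limit carries the dual network to time \<open>T - s\<close>, where
  the queue is of order \<open>s * n\<close>; the exact hit of the origin during the remaining time
  costs \<open>exp (- (C * (n * s)))\<close>, and \<open>s\<close> is chosen small.\<close>

lemma prob_end_ge:
  assumes \<eta>: "0 < \<eta>"
  shows "\<forall>\<^sub>F n in sequentially. \<exists>x. norm (vec_of x /\<^sub>R real n - r) \<le> \<eta> \<and>
    exp (- (real n * (theta \<bullet> r + \<eta>))) \<le> \<P>(w in M. Q (real n * T) w = x)"
proof -
  \<comment> \<open>Rounding down keeps \<open>X n\<close> below \<open>n * r\<close>; since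
    \<open>theta\<close> is nonnegative, its weight is then at least
    \<open>exp (- (n * (theta \<bullet> r)))\<close> with no rounding error.\<close>
  define X where "X n = (\<chi> k. nat \<lfloor>real n * r $ k\<rfloor>)" for n :: nat
  have X: "real (X n $ k) \<le> real n * r $ k" "real n * r $ k - 1 \<le> real (X n $ k)" for n k
  proof -
    have "0 \<le> real n * r $ k" using r_nonneg by simp
    then have "real (X n $ k) = of_int \<lfloor>real n * r $ k\<rfloor>" by (simp add: X_def)
    then show "real (X n $ k) \<le> real n * r $ k" "real n * r $ k - 1 \<le> real (X n $ k)" by linarith+
  qed
  have X_close: "norm (vec_of (X n) /\<^sub>R real n - r) \<le> real CARD('k) * (1 / real n)" if "0 < n" for n
  proof -
    have "\<bar>(vec_of (X n) /\<^sub>R real n - r) $ k\<bar> \<le> 1 / real n" for k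
    proof -
      have "(vec_of (X n) /\<^sub>R real n - r) $ k = (real (X n $ k) - real n * r $ k) / real n"
        using that by (simp add: field_simps)
      moreover have "\<bar>real (X n $ k) - real n * r $ k\<bar> \<le> 1" using X[of n k] by linarith
      ultimately show ?thesis by (simp add: divide_right_mono)
    qed
    then have "(\<Sum>k\<in>UNIV. \<bar>(vec_of (X n) /\<^sub>R real n - r) $ k\<bar>) \<le> (\<Sum>k\<in>(UNIV::'k set). 1 / real n)"
      by (intro sum_mono)
    then show ?thesis using norm_le_l1_cart[of "vec_of (X n) /\<^sub>R real n - r"] by simp
  qed
  have lim: "(\<lambda>n. real CARD('k) * (1 / real n)) \<longlonglongrightarrow> 0"
    by (intro tendsto_mult_right_zero lim_1_over_n)
  have close: "\<forall>\<^sub>F n in sequentially. norm (vec_of (X n) /\<^sub>R real n - r) \<le> \<epsilon>" if "0 < \<epsilon>" for \<epsilon>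
    using order_tendstoD(2)[OF lim that] eventually_gt_at_top[of 0]
  proof eventually_elim
    case (elim n)
    then show ?case using X_close[of n] by linarith
  qed
  have wtX: "exp (- (real n * (theta \<bullet> r))) \<le> duality.wt (X n)" for n
  proof -
    have "theta \<bullet> vec_of (X n) \<le> theta \<bullet> (real n *\<^sub>R r)"
      unfolding inner_vec_def using X theta_nonneg by (intro sum_mono) (simp add: mult_left_mono)
    then show ?thesis by (simp add: wt_eq)
  qed
  show ?thesis
  proof (cases "T = 0")
    case True
    then have r: "r = 0" using q_0 q_T by simp
    have "pmf (duality.fw.kern 0 0) 0 = 1" by simp
    then have "\<P>(w in M. Q (real n * T) w = 0) = 1" for n
      using chain.prob_one_time[of 0 0] True by simp
    moreover have "vec_of 0 = (0 :: real ^ 'k)" by (simp add: vec_eq_iff)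
    ultimately show ?thesis using \<eta> by (intro always_eventually allI exI[of _ 0]) (simp add: r)
  next
    case False
    then have T: "0 < T" using T_nonneg by simp
    obtain L where L: "0 \<le> L" "\<And>s t. 0 \<le> s \<Longrightarrow> 0 \<le> t \<Longrightarrow> norm (q t - q s) \<le> L * \<bar>t - s\<bar>"
      using bw.fluid_trajectory_lipschitz[OF fluid] by blast
    \<comment> \<open>A state within \<open>s\<close> of the scaled fluid at time
      \<open>T - s\<close> has norm at most \<open>(L + 1) * s * n\<close>; summing over the
      components gives \<open>C0 * (n * s)\<close> customers.\<close>
    define C0 where "C0 = real CARD('k) * (L + 1)"
    obtain C where C: "0 \<le> C" "\<And>t y. 0 \<le> t \<Longrightarrow> real (\<Sum>k\<in>UNIV. y $ k) \<le> C0 * t \<Longrightarrow> exp (- (C * t)) \<le> pmf (duality.fw.kern t 0) y"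
      using duality.fw.pmf_kern_from_0_ge[OF lam_pos, of C0] by blast
    \<comment> \<open>Half of the tolerated rate \<open>\<eta>\<close> pays for the last stretch;
      the other half will absorb the factor 1/2.\<close>
    define s where "s = min T (\<eta> / (2 * (C + 1)))"
    have s: "0 < s" "s \<le> T" "C * s \<le> \<eta> / 2"
    proof -
      show "0 < s" "s \<le> T" using T \<eta> C by (auto simp: s_def)
      have "C * s \<le> C * (\<eta> / (2 * (C + 1)))" using C by (intro mult_left_mono) (auto simp: s_def)
      also have "\<dots> \<le> \<eta> / 2" using C \<eta> by (simp add: field_simps)
      finally show "C * s \<le> \<eta> / 2" .
    qed
    \<comment> \<open>The tolerance is the remaining time \<open>s\<close> itself, which keeps the
      good states at time \<open>T - s\<close> of order \<open>s\<close>.\<close>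
    obtain \<epsilon> \<gamma> where \<epsilon>: "0 < \<epsilon>" and \<gamma>: "0 < \<gamma>" and
      dev: "\<forall>\<^sub>F n in sequentially. \<forall>x. norm (vec_of x /\<^sub>R real n - r) \<le> \<epsilon> \<longrightarrow>
        (\<forall>t\<in>{0..T}. measure_pmf.prob (duality.bw.kern (real n * t) x) {z. s \<le> norm (vec_of z /\<^sub>R real n - q t)} \<le> exp (- (\<gamma> * real n)))"
      using bw.fluid_deviation[OF fluid T_nonneg s(1)] by blast
    have half: "\<forall>\<^sub>F n in sequentially. exp (- (\<gamma> * real n)) < 1 / 2" "\<forall>\<^sub>F n in sequentially. exp (- (\<eta> / 2 * real n)) < 1 / 2"
      using order_tendstoD(2)[OF exp_decay_tendsto_0[OF \<gamma>, of 1], of "1 / 2"]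
        order_tendstoD(2)[OF exp_decay_tendsto_0[of "\<eta> / 2" 1], of "1 / 2"] \<eta> by auto
    show ?thesis
      using dev half close[OF \<epsilon>] close[OF \<eta>] eventually_gt_at_top[of 0]
    proof eventually_elim
      case (elim n)
      have n: "0 < real n" using elim(6) by simp
      let ?S = "{z. s \<le> norm (vec_of z /\<^sub>R real n - q (T - s))}"
      have "measure_pmf.prob (duality.bw.kern (real n * (T - s)) (X n)) ?S \<le> exp (- (\<gamma> * real n))"
        using elim(1) elim(4) s by auto
      then have good: "1 / 2 \<le> measure_pmf.prob (duality.bw.kern (real n * (T - s)) (X n)) (- ?S)"
        using elim(2) measure_pmf.prob_compl[of ?S "duality.bw.kern (real n * (T - s)) (X n)"] by (simp add: Compl_eq_Diff_UNIV)
      \<comment> \<open>A second reversal: emptying the dual network from \<open>z\<close> is at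
        least as likely as filling the forward network from 0 to \<open>z\<close>, because
        \<open>wt z \<le> 1\<close>, and filling is possible by arrivals alone.\<close>
      have home: "exp (- (C * (real n * s))) \<le> pmf (duality.bw.kern (real n * s) z) 0" if "z \<in> - ?S" for z
      proof -
        have "norm (q (T - s)) \<le> L * s" using L(2)[of "T - s" T] s by (simp add: q_T)
        moreover have "norm (vec_of z /\<^sub>R real n) \<le> norm (vec_of z /\<^sub>R real n - q (T - s)) + norm (q (T - s))"
          by (metis diff_add_cancel norm_triangle_ineq)
        ultimately have "norm (vec_of z /\<^sub>R real n) \<le> (L + 1) * s" using that by (simp add: algebra_simps)
        then have nz: "norm (vec_of z) \<le> (L + 1) * s * real n" using n by (simp add: field_simps)
        have "real (\<Sum>k\<in>UNIV. z $ k) = (\<Sum>k\<in>UNIV. \<bar>vec_of z $ k\<bar>)" by simp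
        also have "\<dots> \<le> (\<Sum>k\<in>(UNIV::'k set). (L + 1) * s * real n)"
          by (intro sum_mono order_trans[OF component_le_norm_cart nz])
        also have "\<dots> = C0 * (real n * s)" by (simp add: C0_def)
        finally have "exp (- (C * (real n * s))) \<le> pmf (duality.fw.kern (real n * s) 0) z"
          using n s by (intro C(2)) auto
        also have "\<dots> \<le> pmf (duality.bw.kern (real n * s) z) 0"
          unfolding kern_reverse_0 using wt_le_1[of z] duality.wt_pos[of z] by (intro mult_left_le_one_le) auto
        finally show ?thesis .
      qed
      have "exp (- (C * (real n * s))) * (1 / 2) \<le> pmf (duality.bw.kern (real n * T) (X n)) 0"
      proof -
        have "real n * T = real n * (T - s) + real n * s" by (simp add: algebra_simps)
        then have kT: "duality.bw.kern (real n * T) (X n) = bind_pmf (duality.bw.kern (real n * (T - s)) (X n)) (duality.bw.kern (real n * s))"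
          using duality.bw.kern_add[of "real n * (T - s)" "real n * s" "X n"] n s by simp
        have "ennreal (exp (- (C * (real n * s))) * (1 / 2)) \<le>
            ennreal (exp (- (C * (real n * s))) * measure_pmf.prob (duality.bw.kern (real n * (T - s)) (X n)) (- ?S))"
          using good by (intro ennreal_leI mult_left_mono) auto
        also have "\<dots> = (\<integral>\<^sup>+z. ennreal (exp (- (C * (real n * s)))) * indicator (- ?S) z \<partial>duality.bw.kern (real n * (T - s)) (X n))"
          by (subst nn_integral_cmult_indicator) (auto simp: ennreal_mult measure_pmf.emeasure_eq_measure)
        also have "\<dots> \<le> (\<integral>\<^sup>+z. ennreal (pmf (duality.bw.kern (real n * s) z) 0) \<partial>duality.bw.kern (real n * (T - s)) (X n))"
        proof (intro nn_integral_mono)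
          fix z
          show "ennreal (exp (- (C * (real n * s)))) * indicator (- ?S) z \<le> ennreal (pmf (duality.bw.kern (real n * s) z) 0)"
            using home[of z] by (cases "z \<in> - ?S") (auto intro: ennreal_leI)
        qed
        also have "\<dots> = ennreal (pmf (duality.bw.kern (real n * T) (X n)) 0)" unfolding kT ennreal_pmf_bind ..
        finally show ?thesis by simp
      qed
      then have "exp (- (real n * (theta \<bullet> r))) * (exp (- (C * (real n * s))) * (1 / 2)) \<le> duality.wt (X n) * pmf (duality.bw.kern (real n * T) (X n)) 0"
        using wtX[of n] duality.wt_pos[of "X n"] by (intro mult_mono) auto
      also have "\<dots> = \<P>(w in M. Q (real n * T) w = X n)"
        using chain.prob_one_time[of "real n * T" "X n"] n T by (simp add: kern_reverse_0)
      also have "exp (- (real n * (theta \<bullet> r + \<eta>))) \<le> exp (- (real n * (theta \<bullet> r))) * (exp (- (C * (real n * s))) * (1 / 2))"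
      proof -
        have "exp (- (real n * (theta \<bullet> r + \<eta>))) = exp (- (real n * (theta \<bullet> r))) * (exp (- (real n * (\<eta> / 2))) * exp (- (\<eta> / 2 * real n)))"
          by (simp add: algebra_simps flip: exp_add)
        also have "\<dots> \<le> exp (- (real n * (theta \<bullet> r))) * (exp (- (C * (real n * s))) * (1 / 2))"
        proof (intro mult_left_mono mult_mono)
          have "real n * (C * s) \<le> real n * (\<eta> / 2)" using s(3) n by (intro mult_left_mono) auto
          then show "exp (- (real n * (\<eta> / 2))) \<le> exp (- (C * (real n * s)))" by (simp add: mult_ac)
        qed (use elim(3) in auto)
        finally show ?thesis .
      qed
      finally show ?case using elim(5) by blast
    qed
  qed
qed

lemma wt_le_near:
  assumes "norm (vec_of x /\<^sub>R real n - r) \<le> e" "0 < n"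
  shows "duality.wt x \<le> exp (- (real n * (theta \<bullet> r - norm theta * e)))"
proof -
  have "theta \<bullet> r - theta \<bullet> (vec_of x /\<^sub>R real n) \<le> norm theta * e"
  proof -
    have "theta \<bullet> r - theta \<bullet> (vec_of x /\<^sub>R real n) = theta \<bullet> (r - vec_of x /\<^sub>R real n)" by (simp only: inner_diff_right)
    also have "\<dots> \<le> norm theta * norm (r - vec_of x /\<^sub>R real n)" by (rule norm_cauchy_schwarz)
    also have "\<dots> \<le> norm theta * e" using assms by (intro mult_left_mono) (auto simp: norm_minus_commute)
    finally show ?thesis .
  qed
  then have "real n * (theta \<bullet> r - norm theta * e) \<le> real n * (theta \<bullet> (vec_of x /\<^sub>R real n))"
    by (intro mult_left_mono) auto
  also have "\<dots> = theta \<bullet> vec_of x" using assms by simp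
  finally show ?thesis by (simp add: wt_eq)
qed

lemma near_states:
  assumes n: "0 < n" and e: "e \<le> 1"
  shows "finite {x :: nat ^ 'k. norm (vec_of x /\<^sub>R real n - r) \<le> e}"
    "real (card {x :: nat ^ 'k. norm (vec_of x /\<^sub>R real n - r) \<le> e}) \<le> ((norm r + 1) * real n + 1) ^ CARD('k)"
proof -
  define m where "m = nat \<lfloor>(norm r + 1) * real n\<rfloor>"
  have sub: "{x :: nat ^ 'k. norm (vec_of x /\<^sub>R real n - r) \<le> e} \<subseteq> {x. \<forall>k. x $ k \<le> m}"
  proof (intro subsetI CollectI allI)
    fix x :: "nat ^ 'k" and k assume "x \<in> {x. norm (vec_of x /\<^sub>R real n - r) \<le> e}"
    then have "norm (vec_of x /\<^sub>R real n) \<le> norm r + 1"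
      using norm_triangle_ineq[of "vec_of x /\<^sub>R real n - r" r] e by simp
    then have "\<bar>(vec_of x /\<^sub>R real n) $ k\<bar> \<le> norm r + 1"
      using component_le_norm_cart[of "vec_of x /\<^sub>R real n" k] by linarith
    then have "real (x $ k) \<le> (norm r + 1) * real n" using n by (simp add: field_simps)
    then show "x $ k \<le> m" unfolding m_def by (simp add: le_nat_iff le_floor_iff)
  qed
  show "finite {x :: nat ^ 'k. norm (vec_of x /\<^sub>R real n - r) \<le> e}"
    by (rule finite_subset[OF sub box_card(1)])
  have "card {x :: nat ^ 'k. norm (vec_of x /\<^sub>R real n - r) \<le> e} \<le> (m + 1) ^ CARD('k)"
    using card_mono[OF box_card(1) sub] box_card(2)[where 'k = 'k, of m] by linarith
  then have "real (card {x :: nat ^ 'k. norm (vec_of x /\<^sub>R real n - r) \<le> e}) \<le> (real m + 1) ^ CARD('k)"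
    by (metis (mono_tags, lifting) of_nat_1 of_nat_add of_nat_le_iff of_nat_power)
  also have "\<dots> \<le> ((norm r + 1) * real n + 1) ^ CARD('k)"
  proof (intro power_mono add_right_mono)
    have "0 \<le> (norm r + 1) * real n" by simp
    then show "real m \<le> (norm r + 1) * real n" unfolding m_def by linarith
  qed auto
  finally show "real (card {x :: nat ^ 'k. norm (vec_of x /\<^sub>R real n - r) \<le> e}) \<le> ((norm r + 1) * real n + 1) ^ CARD('k)" .
qed

text \<open>The first leg from the origin to \<open>y\<close> has probability at most
  \<open>wt y\<close>, and the weight turns the second leg into the dual kernel started at
  \<open>x\<close>. In dual terms, the requirement that the path should finally be at the origin is
  given up.\<close>

lemma prob_joint_le:
  assumes "0 \<le> s" "s \<le> t"
  shows "\<P>(w in M. Q s w \<in> A \<and> Q t w = x) \<le> duality.wt x * measure_pmf.prob (duality.bw.kern (t - s) x) A"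
proof -
  have "ennreal \<P>(w in M. Q s w \<in> A \<and> Q t w = x) =
      (\<integral>\<^sup>+y. ennreal (pmf (duality.fw.kern s 0) y) * (indicator A y * ennreal (pmf (duality.fw.kern (t - s) y) x)) \<partial>count_space UNIV)"
    unfolding chain.prob_two_times(2)[OF assms] nn_integral_measure_pmf ..
  also have "\<dots> \<le> (\<integral>\<^sup>+y. ennreal (duality.wt x) * (ennreal (pmf (duality.bw.kern (t - s) x) y) * indicator A y) \<partial>count_space UNIV)"
  proof (intro nn_integral_mono)
    fix y
    have "pmf (duality.fw.kern s 0) y * pmf (duality.fw.kern (t - s) y) x \<le> duality.wt y * pmf (duality.fw.kern (t - s) y) x"
      unfolding kern_reverse_0 using duality.wt_pos[of y]
      by (intro mult_right_mono mult_left_le) (auto simp: pmf_le_1)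
    also have "\<dots> = duality.wt x * pmf (duality.bw.kern (t - s) x) y" by (rule duality.kern_reverse)
    finally have "ennreal (pmf (duality.fw.kern s 0) y * pmf (duality.fw.kern (t - s) y) x) \<le> ennreal (duality.wt x * pmf (duality.bw.kern (t - s) x) y)"
      by (rule ennreal_leI)
    then show "ennreal (pmf (duality.fw.kern s 0) y) * (indicator A y * ennreal (pmf (duality.fw.kern (t - s) y) x)) \<le>
        ennreal (duality.wt x) * (ennreal (pmf (duality.bw.kern (t - s) x) y) * indicator A y)"
      using duality.wt_pos[of x] by (cases "y \<in> A") (auto simp: ennreal_mult)
  qed
  also have "\<dots> = ennreal (duality.wt x) * (\<integral>\<^sup>+y. indicator A y \<partial>duality.bw.kern (t - s) x)"
    by (simp add: nn_integral_cmult nn_integral_measure_pmf)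
  also have "\<dots> = ennreal (duality.wt x * measure_pmf.prob (duality.bw.kern (t - s) x) A)"
    using duality.wt_pos[of x] by (simp add: ennreal_mult measure_pmf.emeasure_eq_measure)
  finally show ?thesis using duality.wt_pos[of x] by simp
qed

text \<open>Union bound over the polynomially many end states near \<open>r\<close>. A set
  \<open>A\<close> of deviating states yields the numerator of the conditional probability;
  \<open>A = UNIV\<close> with \<open>g = 1\<close> yields the upper bound for the terminal
  event.\<close>

lemma prob_end_near_le:
  assumes n: "0 < n" and e: "e \<le> 1" and s: "0 \<le> s" "s \<le> T" and g0: "0 \<le> g"
    and g: "\<And>x. norm (vec_of x /\<^sub>R real n - r) \<le> e \<Longrightarrow> measure_pmf.prob (duality.bw.kern (real n * (T - s)) x) A \<le> g"
  shows "{w\<in>space M. Q (real n * s) w \<in> A \<and> norm (vec_of (Q (real n * T) w) /\<^sub>R real n - r) \<le> e} \<in> sets M"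
    "\<P>(w in M. Q (real n * s) w \<in> A \<and> norm (vec_of (Q (real n * T) w) /\<^sub>R real n - r) \<le> e) \<le>
      ((norm r + 1) * real n + 1) ^ CARD('k) * (exp (- (real n * (theta \<bullet> r - norm theta * e))) * g)"
proof -
  let ?X = "{x :: nat ^ 'k. norm (vec_of x /\<^sub>R real n - r) \<le> e}"
  let ?E = "\<lambda>x. {w\<in>space M. Q (real n * s) w \<in> A \<and> Q (real n * T) w = x}"
  have times: "0 \<le> real n * s" "real n * s \<le> real n * T" using s by (auto intro: mult_left_mono)
  have E: "?E x \<in> sets M" for x by (rule chain.prob_two_times(1)[OF times])
  have X: "finite ?X" by (rule near_states[OF n e])
  have eq: "{w\<in>space M. Q (real n * s) w \<in> A \<and> norm (vec_of (Q (real n * T) w) /\<^sub>R real n - r) \<le> e} = (\<Union>x\<in>?X. ?E x)" by auto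
  show "{w\<in>space M. Q (real n * s) w \<in> A \<and> norm (vec_of (Q (real n * T) w) /\<^sub>R real n - r) \<le> e} \<in> sets M"
    unfolding eq using X E by auto
  let ?b = "exp (- (real n * (theta \<bullet> r - norm theta * e)))"
  show "\<P>(w in M. Q (real n * s) w \<in> A \<and> norm (vec_of (Q (real n * T) w) /\<^sub>R real n - r) \<le> e) \<le>
      ((norm r + 1) * real n + 1) ^ CARD('k) * (?b * g)"
  proof -
    have "measure M (\<Union>x\<in>?X. ?E x) \<le> (\<Sum>x\<in>?X. measure M (?E x))"
      using X E by (intro chain.finite_measure_subadditive_finite) auto
    also have "\<dots> \<le> (\<Sum>x\<in>?X. ?b * g)"
    proof (rule sum_mono)
      fix x assume x: "x \<in> ?X"
      have "measure M (?E x) \<le> duality.wt x * measure_pmf.prob (duality.bw.kern (real n * T - real n * s) x) A"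
        by (rule prob_joint_le[OF times])
      also have "\<dots> \<le> ?b * g"
        using g[of x] x wt_le_near[OF _ n, of x e] g0 by (intro mult_mono) (auto simp: right_diff_distrib)
      finally show "measure M (?E x) \<le> ?b * g" .
    qed
    also have "\<dots> = real (card ?X) * (?b * g)" by simp
    also have "\<dots> \<le> ((norm r + 1) * real n + 1) ^ CARD('k) * (?b * g)"
      using near_states(2)[OF n e] g0 by (intro mult_right_mono) auto
    finally show ?thesis unfolding eq .
  qed
qed

end

section \<open>Conditional probability of a deviation\<close>

context reversed_network
begin

lemma Q_end_sets: "{w\<in>space M. S (Q (real n * T) w)} \<in> sets M"
proof -
  have "{w\<in>space M. S (Q (real n * T) w)} = Q (real n * T) -` Collect S \<inter> space M" by auto
  also have "\<dots> \<in> sets M"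
    using T_nonneg by (intro measurable_sets[OF chain.Q_measurable]) auto
  finally show ?thesis .
qed

text \<open>Numerator and denominator have separate radii \<open>\<epsilon>\<close> and
  \<open>\<epsilon>'\<close> because a ball of another norm is only squeezed between Euclidean
  balls. The numerator is any subset \<open>A\<close>: it is estimated through measurable covers, so
  the supremum over uncountably many times causes no trouble. The rate \<open>b\<close> is fixed
  before the radii.\<close>

lemma conditional_deviation_bound:
  assumes d: "0 < d"
  shows "\<exists>\<epsilon>0>0. \<exists>b>0. \<exists>C. \<forall>\<epsilon>>0. \<epsilon> \<le> \<epsilon>0 \<longrightarrow> (\<forall>\<epsilon>'>0. \<forall>\<^sub>F n in sequentially. \<forall>A. \<forall>B\<in>sets M.
    A \<subseteq> {w\<in>space M. norm (vec_of (Q (real n * T) w) /\<^sub>R real n - r) \<le> \<epsilon> \<and>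
        (\<exists>t\<in>{0..T}. 3 * d < norm (vec_of (Q (real n * t) w) /\<^sub>R real n - q (T - t)))} \<longrightarrow>
    {w\<in>space M. norm (vec_of (Q (real n * T) w) /\<^sub>R real n - r) \<le> \<epsilon>'} \<subseteq> B \<longrightarrow>
    measure M A / measure M B \<le> C * exp (- (b * real n)))"
proof -
  obtain L where L: "0 \<le> L" "\<And>s t. 0 \<le> s \<Longrightarrow> 0 \<le> t \<Longrightarrow> norm (q t - q s) \<le> L * \<bar>t - s\<bar>"
    using bw.fluid_trajectory_lipschitz[OF fluid] by blast
  \<comment> \<open>Oscillations have to be rarer than the terminal event:
    \<open>\<theta> * d = theta \<bullet> r + 3\<close> leaves the rate
    \<open>theta \<bullet> r + 2\<close> after a loss of at most 1 to the moment factor.\<close>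
  define \<theta> where "\<theta> = (theta \<bullet> r + 3) / d"
  have r0: "0 \<le> theta \<bullet> r" unfolding inner_vec_def using theta_nonneg r_nonneg by (intro sum_nonneg) auto
  have \<theta>: "0 \<le> \<theta>" "\<theta> * d = theta \<bullet> r + 3" using r0 d by (auto simp: \<theta>_def)
  define \<Lambda> where "\<Lambda> = duality.fw.total * (exp (2 * \<theta>) - 1)"
  have \<Lambda>: "0 \<le> \<Lambda>" using duality.fw.total_pos \<theta> by (simp add: \<Lambda>_def)
  \<comment> \<open>The number of grid cells, independent of \<open>n\<close>: with mesh
    \<open>h = T / m\<close> the moment factor costs at most \<open>exp n\<close>, and the fluid
    moves by at most \<open>d\<close> within a cell.\<close>
  obtain m :: nat where m: "T * (\<Lambda> + L / d) < real m" using reals_Archimedean2 by blast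
  have m0: "0 < real m"
    using m T_nonneg \<Lambda> L d by (smt (verit) divide_nonneg_pos mult_nonneg_nonneg)
  define h where "h = T / real m"
  have h: "0 \<le> h" using T_nonneg by (simp add: h_def)
  have h\<Lambda>: "h * \<Lambda> \<le> 1" "L * h \<le> d"
  proof -
    have "h * (\<Lambda> + L / d) \<le> 1" using m m0 by (simp add: h_def field_simps)
    moreover have "0 \<le> h * \<Lambda>" "0 \<le> h * (L / d)" using h \<Lambda> L d by auto
    ultimately have "h * \<Lambda> \<le> 1" "h * (L / d) \<le> 1" unfolding distrib_left by linarith+
    then show "h * \<Lambda> \<le> 1" "L * h \<le> d" using d by (auto simp: field_simps)
  qed
  define ti where "ti i = real i * h" for i :: nat
  have ti: "0 \<le> ti i" "i \<le> m \<Longrightarrow> ti i \<le> T" for i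
  proof -
    show "0 \<le> ti i" using h by (simp add: ti_def)
    assume "i \<le> m"
    then have "real i * h \<le> real m * h" using h by (intro mult_right_mono) auto
    then show "ti i \<le> T" using m0 by (simp add: ti_def h_def)
  qed
  have cover: "\<exists>i\<le>m. ti i \<le> t \<and> t \<le> ti i + h" if "t \<in> {0..T}" for t
  proof (cases "h = 0")
    case True
    then have "T = 0" using m0 by (simp add: h_def)
    then show ?thesis using that True by (intro exI[of _ 0]) (auto simp: ti_def)
  next
    case False
    then have h0: "0 < h" using h by simp
    define z where "z = t / h"
    have z: "0 \<le> z" "z \<le> real m" using that h0 m0 by (auto simp: z_def h_def field_simps)
    define i where "i = nat \<lfloor>z\<rfloor>"
    have i: "real i \<le> z" "z \<le> real i + 1" using z by (auto simp: i_def)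
    have "real i * h \<le> z * h" "z * h \<le> (real i + 1) * h" using i h0 by (auto intro: mult_right_mono)
    moreover have "z * h = t" using h0 by (simp add: z_def)
    moreover have "i \<le> m" using i z by linarith
    ultimately show ?thesis by (intro exI[of _ i]) (auto simp: ti_def algebra_simps)
  qed
  obtain \<epsilon>1 \<gamma> where \<epsilon>1: "0 < \<epsilon>1" and \<gamma>: "0 < \<gamma>" and
    dev: "\<forall>\<^sub>F n in sequentially. \<forall>x. norm (vec_of x /\<^sub>R real n - r) \<le> \<epsilon>1 \<longrightarrow>
      (\<forall>t\<in>{0..T}. measure_pmf.prob (duality.bw.kern (real n * t) x) {z. d \<le> norm (vec_of z /\<^sub>R real n - q t)} \<le> exp (- (\<gamma> * real n)))"
    using bw.fluid_deviation[OF fluid T_nonneg d] by blast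
  \<comment> \<open>The gain \<open>\<gamma>\<close> at a grid time exceeds the losses:
    \<open>\<gamma> / 4\<close> for the number of end states and, by this choice,
    \<open>\<gamma> / 4\<close> for the variation of the weight over the ball. The rate
    \<open>\<gamma> / 2\<close> remains.\<close>
  define \<epsilon>0 where "\<epsilon>0 = min \<epsilon>1 (min 1 (\<gamma> / (4 * (norm theta + 1))))"
  have n1: "0 < norm theta + 1" by (simp add: add_nonneg_pos)
  have \<epsilon>0: "0 < \<epsilon>0" using \<epsilon>1 \<gamma> n1 by (simp add: \<epsilon>0_def)
  have cancel: "X * (\<gamma> / (4 * X)) = \<gamma> / 4" if "0 < X" for X using that by simp
  have \<epsilon>0\<theta>: "norm theta * \<epsilon> \<le> \<gamma> / 4" if "0 < \<epsilon>" "\<epsilon> \<le> \<epsilon>0" for \<epsilon>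
  proof -
    have "norm theta * \<epsilon> \<le> (norm theta + 1) * (\<gamma> / (4 * (norm theta + 1)))"
      using that by (intro mult_mono) (auto simp: \<epsilon>0_def)
    also have "\<dots> = \<gamma> / 4" by (rule cancel[OF n1])
    finally show ?thesis .
  qed
  \<comment> \<open>Oscillations (rate 2) and grid deviations (rate \<open>\<gamma> / 2\<close>)
    both beat \<open>exp (- (n * (theta \<bullet> r)))\<close> by the rate \<open>2 * b\<close>,
    while the lower bound for the denominator loses only \<open>b\<close>.\<close>
  define b where "b = min 1 (\<gamma> / 4)"
  have b: "0 < b" "b \<le> 1" "b \<le> \<gamma> / 4" using \<gamma> by (auto simp: b_def)
  define C where "C = 2 * (real m + 1)"
  have "\<forall>\<^sub>F n in sequentially. \<forall>A. \<forall>B\<in>sets M.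
    A \<subseteq> {w\<in>space M. norm (vec_of (Q (real n * T) w) /\<^sub>R real n - r) \<le> \<epsilon> \<and>
        (\<exists>t\<in>{0..T}. 3 * d < norm (vec_of (Q (real n * t) w) /\<^sub>R real n - q (T - t)))} \<longrightarrow>
    {w\<in>space M. norm (vec_of (Q (real n * T) w) /\<^sub>R real n - r) \<le> \<epsilon>'} \<subseteq> B \<longrightarrow>
    measure M A / measure M B \<le> C * exp (- (b * real n))"
    if \<epsilon>: "0 < \<epsilon>" "\<epsilon> \<le> \<epsilon>0" and \<epsilon>': "0 < \<epsilon>'" for \<epsilon> \<epsilon>'
  proof -
    have poly: "\<forall>\<^sub>F n in sequentially. ((norm r + 1) * real n + 1) ^ CARD('k) \<le> exp (\<gamma> / 4 * real n)"
      using \<gamma> by (intro poly_le_exp) auto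
    have "0 < min b \<epsilon>'" using b \<epsilon>' by simp
    from prob_end_ge[OF this] dev poly eventually_gt_at_top[of 0]
    show ?thesis
    proof eventually_elim
      case (elim n)
      have n: "0 < n" "0 < real n" using elim(4) by auto
      show ?case
      proof (intro allI ballI impI)
        fix A B
        assume A: "A \<subseteq> {w\<in>space M. norm (vec_of (Q (real n * T) w) /\<^sub>R real n - r) \<le> \<epsilon> \<and>
            (\<exists>t\<in>{0..T}. 3 * d < norm (vec_of (Q (real n * t) w) /\<^sub>R real n - q (T - t)))}"
          and B: "B \<in> sets M" "{w\<in>space M. norm (vec_of (Q (real n * T) w) /\<^sub>R real n - r) \<le> \<epsilon>'} \<subseteq> B"
        define u where "u = exp (- (real n * (theta \<bullet> r)))"
        have u: "0 < u" by (simp add: u_def)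
        have lower: "u * exp (- (b * real n)) \<le> measure M B"
        proof -
          obtain x where x: "norm (vec_of x /\<^sub>R real n - r) \<le> min b \<epsilon>'"
            "exp (- (real n * (theta \<bullet> r + min b \<epsilon>'))) \<le> \<P>(w in M. Q (real n * T) w = x)"
            using elim(1) by blast
          have "real n * min b \<epsilon>' \<le> real n * b" using n by (intro mult_left_mono) auto
          then have "u * exp (- (b * real n)) \<le> exp (- (real n * (theta \<bullet> r + min b \<epsilon>')))"
            by (simp add: u_def algebra_simps flip: exp_add)
          also note x(2)
          also have "\<P>(w in M. Q (real n * T) w = x) \<le> measure M B"
            using x(1) B by (intro chain.finite_measure_mono) auto
          finally show ?thesis .
        qed
        have "\<forall>i. \<exists>O'\<in>sets M. measure M O' \<le> exp (duality.fw.total * (real n * h) * (exp (2 * \<theta>) - 1) - \<theta> * (d * real n)) \<and>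
            (\<forall>w\<in>space M. \<forall>t\<in>{real n * ti i..real n * ti i + real n * h}. d * real n \<le> l1_dist (Q t w) (Q (real n * ti i) w) \<longrightarrow> w \<in> O')"
          using chain.oscillation[OF \<theta>(1)] ti(1) h by simp
        then obtain Osc where Osc: "\<And>i. Osc i \<in> sets M"
          "\<And>i. measure M (Osc i) \<le> exp (duality.fw.total * (real n * h) * (exp (2 * \<theta>) - 1) - \<theta> * (d * real n))"
          "\<And>i w t. w \<in> space M \<Longrightarrow> t \<in> {real n * ti i..real n * ti i + real n * h} \<Longrightarrow>
             d * real n \<le> l1_dist (Q t w) (Q (real n * ti i) w) \<Longrightarrow> w \<in> Osc i"
          by metis
        have Osc_le: "measure M (Osc i) \<le> u * exp (- (2 * real n))" for i
        proof -
          have "duality.fw.total * (real n * h) * (exp (2 * \<theta>) - 1) = real n * (h * \<Lambda>)"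
            by (simp add: \<Lambda>_def)
          also have "\<dots> \<le> real n * 1" using h\<Lambda>(1) n by (intro mult_left_mono) auto
          finally have "duality.fw.total * (real n * h) * (exp (2 * \<theta>) - 1) - \<theta> * (d * real n) \<le> real n - (theta \<bullet> r + 3) * real n"
            by (simp add: mult.assoc flip: \<theta>(2))
          also have "\<dots> = - (real n * (theta \<bullet> r)) - 2 * real n" by (simp add: algebra_simps)
          finally have "exp (duality.fw.total * (real n * h) * (exp (2 * \<theta>) - 1) - \<theta> * (d * real n)) \<le>
              exp (- (real n * (theta \<bullet> r)) - 2 * real n)" by simp
          with Osc(2)[of i] have "measure M (Osc i) \<le> exp (- (real n * (theta \<bullet> r)) - 2 * real n)"
            by (rule order_trans)
          then show ?thesis by (simp add: u_def flip: exp_add)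
        qed
        define Bad where "Bad i = {w\<in>space M. Q (real n * ti i) w \<in> {z. d \<le> norm (vec_of z /\<^sub>R real n - q (T - ti i))} \<and>
            norm (vec_of (Q (real n * T) w) /\<^sub>R real n - r) \<le> \<epsilon>}" for i
        have Bad: "Bad i \<in> sets M" "measure M (Bad i) \<le> u * exp (- (\<gamma> / 2 * real n))" if i: "i \<le> m" for i
        proof -
          have g: "measure_pmf.prob (duality.bw.kern (real n * (T - ti i)) x) {z. d \<le> norm (vec_of z /\<^sub>R real n - q (T - ti i))} \<le> exp (- (\<gamma> * real n))"
            if "norm (vec_of x /\<^sub>R real n - r) \<le> \<epsilon>" for x
            using elim(2) that \<epsilon> ti(1)[of i] ti(2)[OF i] by (auto simp: \<epsilon>0_def)
          have e1: "\<epsilon> \<le> 1" using \<epsilon> by (simp add: \<epsilon>0_def)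
          note near = prob_end_near_le[OF n(1) e1 ti(1) ti(2)[OF i] _ g]
          show "Bad i \<in> sets M" unfolding Bad_def by (rule near(1)) auto
          have "measure M (Bad i) \<le> ((norm r + 1) * real n + 1) ^ CARD('k) * (exp (- (real n * (theta \<bullet> r - norm theta * \<epsilon>))) * exp (- (\<gamma> * real n)))"
            unfolding Bad_def by (rule near(2)) auto
          also have "\<dots> \<le> exp (\<gamma> / 4 * real n) * (exp (- (real n * (theta \<bullet> r - norm theta * \<epsilon>))) * exp (- (\<gamma> * real n)))"
            using elim(3) by (intro mult_right_mono) auto
          also have "\<dots> = u * exp (real n * (norm theta * \<epsilon>) - 3 / 4 * \<gamma> * real n)"
            by (simp add: u_def algebra_simps flip: exp_add)
          also have "\<dots> \<le> u * exp (- (\<gamma> / 2 * real n))"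
          proof -
            have "real n * (norm theta * \<epsilon>) \<le> real n * (\<gamma> / 4)" using \<epsilon>0\<theta>[OF \<epsilon>] n by (intro mult_left_mono) auto
            then show ?thesis using u by (simp add: algebra_simps)
          qed
          finally show "measure M (Bad i) \<le> u * exp (- (\<gamma> / 2 * real n))" .
        qed
        \<comment> \<open>Of a deviation above \<open>3 * d\<close>, the chain accounts for at most
          \<open>d\<close> between grid points unless it oscillates, and the fluid for at most
          \<open>d\<close>; the rest is a deviation of at least \<open>d\<close> at a grid
          time.\<close>
        have "A \<subseteq> (\<Union>i\<in>{..m}. Osc i \<union> Bad i)"
        proof
          fix w assume "w \<in> A"
          then obtain t where w: "w \<in> space M" "norm (vec_of (Q (real n * T) w) /\<^sub>R real n - r) \<le> \<epsilon>"
            and t: "t \<in> {0..T}" "3 * d < norm (vec_of (Q (real n * t) w) /\<^sub>R real n - q (T - t))" using A by blast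
          obtain i where i: "i \<le> m" "ti i \<le> t" "t \<le> ti i + h" using cover[OF t(1)] by blast
          show "w \<in> (\<Union>i\<in>{..m}. Osc i \<union> Bad i)"
          proof (cases "d * real n \<le> l1_dist (Q (real n * t) w) (Q (real n * ti i) w)")
            case True
            have "real n * t \<in> {real n * ti i..real n * ti i + real n * h}"
              using i n by (auto simp flip: distrib_left)
            then have "w \<in> Osc i" using Osc(3)[OF w(1)] True by blast
            then show ?thesis using i(1) by blast
          next
            case False
            let ?V = "\<lambda>t. vec_of (Q (real n * t) w)"
            have "norm (?V t /\<^sub>R real n - ?V (ti i) /\<^sub>R real n) = norm (?V t - ?V (ti i)) / real n"
              by (simp add: divide_inverse mult.commute flip: scaleR_right_diff_distrib)
            also have "\<dots> \<le> d"
              using False l1_dist_vec_of[of "Q (real n * t) w" "Q (real n * ti i) w"] n by (simp add: pos_divide_le_eq)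
            finally have 1: "norm (?V t /\<^sub>R real n - ?V (ti i) /\<^sub>R real n) \<le> d" .
            have "norm (q (T - ti i) - q (T - t)) \<le> L * \<bar>(T - ti i) - (T - t)\<bar>"
              using t(1) ti(2)[OF i(1)] by (intro L) auto
            also have "\<dots> \<le> L * h" using i L by (intro mult_left_mono) auto
            finally have 2: "norm (q (T - ti i) - q (T - t)) \<le> d" using h\<Lambda>(2) by linarith
            have "?V t /\<^sub>R real n - q (T - t) = (?V t /\<^sub>R real n - ?V (ti i) /\<^sub>R real n) +
                (?V (ti i) /\<^sub>R real n - q (T - ti i)) + (q (T - ti i) - q (T - t))" by simp
            then have "norm (?V t /\<^sub>R real n - q (T - t)) \<le> norm (?V t /\<^sub>R real n - ?V (ti i) /\<^sub>R real n) +
                norm (?V (ti i) /\<^sub>R real n - q (T - ti i)) + norm (q (T - ti i) - q (T - t))"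
              by (metis norm_triangle_le norm_triangle_ineq add_right_mono)
            then have "d \<le> norm (?V (ti i) /\<^sub>R real n - q (T - ti i))" using 1 2 t(2) by linarith
            then have "w \<in> Bad i" using w by (simp add: Bad_def)
            then show ?thesis using i(1) by blast
          qed
        qed
        then have "measure M A \<le> measure M (\<Union>i\<in>{..m}. Osc i \<union> Bad i)"
          using Osc(1) Bad(1) by (intro chain.finite_measure_mono sets.finite_UN) auto
        also have "\<dots> \<le> (\<Sum>i\<le>m. measure M (Osc i \<union> Bad i))"
          using Osc(1) Bad(1) by (intro chain.finite_measure_subadditive_finite) auto
        also have "\<dots> \<le> (\<Sum>i\<le>m. u * (2 * exp (- (2 * b * real n))))"
        proof (rule sum_mono)
          fix i assume i: "i \<in> {..m}"
          have "measure M (Osc i \<union> Bad i) \<le> measure M (Osc i) + measure M (Bad i)"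
            using Osc(1) Bad(1) i by (intro measure_Un_le) auto
          also have "\<dots> \<le> u * exp (- (2 * real n)) + u * exp (- (\<gamma> / 2 * real n))"
            using Osc_le Bad(2) i by (intro add_mono) auto
          also have "\<dots> \<le> u * exp (- (2 * b * real n)) + u * exp (- (2 * b * real n))"
          proof (intro add_mono mult_left_mono)
            have "2 * b * real n \<le> 2 * real n" "2 * b * real n \<le> \<gamma> / 2 * real n"
              using b by (intro mult_right_mono; simp)+
            then show "exp (- (2 * real n)) \<le> exp (- (2 * b * real n))" "exp (- (\<gamma> / 2 * real n)) \<le> exp (- (2 * b * real n))"
              by auto
          qed (use u in auto)
          finally show "measure M (Osc i \<union> Bad i) \<le> u * (2 * exp (- (2 * b * real n)))" by simp
        qed
        also have "\<dots> = (C * exp (- (b * real n))) * (u * exp (- (b * real n)))"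
        proof -
          have "exp (- (2 * b * real n)) = exp (- (b * real n)) * exp (- (b * real n))" by (simp flip: exp_add)
          then show ?thesis by (simp add: C_def algebra_simps)
        qed
        also have "\<dots> \<le> (C * exp (- (b * real n))) * measure M B"
          using lower by (intro mult_left_mono) (auto simp: C_def)
        finally have le: "measure M A \<le> (C * exp (- (b * real n))) * measure M B" .
        have "0 < measure M B" using lower u by (smt (verit) exp_gt_zero mult_pos_pos)
        with le show "measure M A / measure M B \<le> C * exp (- (b * real n))" by (simp add: pos_divide_le_eq)
      qed
    qed
  qed
  then show ?thesis using \<epsilon>0 b(1) by blast
qed

end

section \<open>Logarithmic limits and verification of the duality\<close>

lemma ln_prob_ge:
  assumes "exp (- (real n * c)) \<le> p" "0 < n"
  shows "ereal (- c) \<le> ereal (1 / real n) * ln_prob p"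
proof -
  have p: "0 < p" using assms(1) exp_gt_zero less_le_trans by blast
  then have "- (real n * c) \<le> ln p" using assms(1) by (simp add: ln_ge_iff)
  then have "- c \<le> 1 / real n * ln p" using assms(2) by (simp add: field_simps)
  then show ?thesis using p by (simp add: ln_prob_def)
qed

lemma ln_prob_le:
  assumes "p \<le> exp (real n * c)" "0 < n" "0 \<le> p"
  shows "ereal (1 / real n) * ln_prob p \<le> ereal c"
proof (cases "p = 0")
  case True
  then show ?thesis using assms(2) by (simp add: ln_prob_def)
next
  case False
  then have p: "0 < p" using assms(3) by simp
  then have "ln p \<le> real n * c" using assms(1) by (metis ln_exp ln_le_cancel_iff exp_gt_zero)
  then have "1 / real n * ln p \<le> c" using assms(2) by (simp add: field_simps)
  then show ?thesis using p by (simp add: ln_prob_def)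
qed

text \<open>The supremum need not be attained, so a strictly smaller threshold is used.\<close>

lemma ereal_SUP_ge_imp_exists:
  assumes "ereal \<delta> \<le> (SUP t\<in>A. ereal (f t))" "\<delta>' < \<delta>"
  shows "\<exists>t\<in>A. \<delta>' < f t"
proof -
  have "ereal \<delta>' < (SUP t\<in>A. ereal (f t))" using assms by (meson ereal_less_le less_ereal.simps(1) less_le_trans)
  then show ?thesis by (auto simp: less_SUP_iff)
qed

text \<open>For positivity, the negative part of the solution of the traffic equations is
  subinvariant and hence zero; the strictly positive arrivals then make every component
  positive.\<close>

lemma throughput_properties:
  assumes net: "ergodic_jackson_network lam mu P"
  shows "throughput lam P $ k = lam $ k + (\<Sum>l\<in>UNIV. P $ l $ k * throughput lam P $ l)"
    and "0 < throughput lam P $ k"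
proof -
  have lam: "0 < lam $ k" for k using net by (simp add: ergodic_jackson_network_def)
  have P: "substochastic P" "spectral_radius P < 1" using net by (auto simp: ergodic_jackson_network_def)
  have P0: "0 \<le> P $ k $ l" for k l using P by (simp add: substochastic_def)
  obtain w \<beta> where w: "\<And>k. 0 < w $ k" and \<beta>: "0 \<le> \<beta>" "\<beta> < 1"
    and Pw: "\<And>k. (\<Sum>l\<in>UNIV. P $ k $ l * w $ l) \<le> \<beta> * w $ k"
    using substochastic_superharmonic[OF P] by metis
  define nu where "nu = throughput lam P"
  have "(mat 1 - transpose P) *v nu = lam"
    unfolding nu_def throughput_def
    by (rule matrix_inv_mult_cancel(1)[OF invertible_I_minus_transpose[OF P0 w \<beta>(2) Pw]])
  then have "lam $ k = nu $ k - (\<Sum>l\<in>UNIV. P $ l $ k * nu $ l)" for k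
    using I_minus_transpose_mult_nth by metis
  then have eq: "nu $ k = lam $ k + (\<Sum>l\<in>UNIV. P $ l $ k * nu $ l)" for k by (simp add: algebra_simps)
  have "(\<chi> k. max 0 (- nu $ k)) = 0"
  proof (rule subinvariant_zero[OF w \<beta>(2) Pw])
    fix k
    have "- nu $ k \<le> (\<Sum>l\<in>UNIV. P $ l $ k * - nu $ l)"
      using eq[of k] lam[of k] by (simp add: sum_negf)
    also have "\<dots> \<le> (\<Sum>l\<in>UNIV. P $ l $ k * max 0 (- nu $ l))"
      using P0 by (intro sum_mono mult_left_mono) auto
    finally have "- nu $ k \<le> (\<Sum>l\<in>UNIV. P $ l $ k * max 0 (- nu $ l))" .
    moreover have "0 \<le> (\<Sum>l\<in>UNIV. P $ l $ k * max 0 (- nu $ l))" using P0 by (intro sum_nonneg) auto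
    ultimately show "(\<chi> k. max 0 (- nu $ k)) $ k \<le> (\<Sum>l\<in>UNIV. P $ l $ k * (\<chi> k. max 0 (- nu $ k)) $ l)" by simp
  qed simp
  then have "max 0 (- nu $ k) = 0" for k by (metis vec_lambda_beta zero_index)
  then have nu0: "0 \<le> nu $ k" for k by (metis max.cobounded2 neg_le_0_iff_le)
  have "0 \<le> (\<Sum>l\<in>UNIV. P $ l $ k * nu $ l)" using P0 nu0 by (intro sum_nonneg) auto
  then show "0 < throughput lam P $ k" using eq[of k] lam[of k] by (simp add: nu_def)
  show "throughput lam P $ k = lam $ k + (\<Sum>l\<in>UNIV. P $ l $ k * throughput lam P $ l)"
    using eq[of k] by (simp only: nu_def)
qed

text \<open>Reduces to identities between \<open>P\<close> and the dual routing, all of them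
  consequences of the traffic equations; the throughput of the dual network is again
  \<open>nu\<close>, and stability is \<open>rho k < 1\<close> read as
  \<open>nu k < mu k\<close>.\<close>

lemma reversed_networkI:
  fixes lam mu r :: "real ^ 'k" and P :: "real ^ 'k ^ 'k" and M :: "'w measure" and Q :: "real \<Rightarrow> 'w \<Rightarrow> nat ^ 'k"
  assumes net: "ergodic_jackson_network lam mu P"
    and chain: "markov_chain M (jackson_rate lam mu P) Q"
    and start: "AE w in M. Q 0 w = 0"
    and r_nonneg: "\<forall>k. 0 \<le> r $ k"
    and fluid: "fluid_trajectory (dual_arrival lam P) mu (dual_routing lam P) r q"
  shows "\<exists>v \<beta>. reversed_network lam (dual_arrival lam P) mu P (dual_routing lam P) (load lam mu P) (throughput lam P) v \<beta>
    M Q q r (emptying_time q) (decay_rate lam mu P)"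
proof -
  define nu where "nu = throughput lam P"
  define a where "a = dual_arrival lam P"
  define p where "p = dual_routing lam P"
  have lam: "0 < lam $ k" and mu: "0 < mu $ k" and rho: "load lam mu P $ k < 1" for k
    using net by (auto simp: ergodic_jackson_network_def)
  have P: "substochastic P" "spectral_radius P < 1" using net by (auto simp: ergodic_jackson_network_def)
  have P0: "0 \<le> P $ k $ l" and P1: "(\<Sum>l\<in>UNIV. P $ k $ l) \<le> 1" for k l using P by (auto simp: substochastic_def)
  obtain w \<beta> where w: "\<And>k. 0 < w $ k" and \<beta>: "0 \<le> \<beta>" "\<beta> < 1"
    and Pw: "\<And>k. (\<Sum>l\<in>UNIV. P $ k $ l * w $ l) \<le> \<beta> * w $ k"
    using substochastic_superharmonic[OF P] by metis
  have eq: "nu $ k = lam $ k + (\<Sum>l\<in>UNIV. P $ l $ k * nu $ l)" and nu: "0 < nu $ k" for k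
    using throughput_properties[OF net, of k] by (simp_all only: nu_def)
  have ak: "a $ k = nu $ k * (1 - (\<Sum>l\<in>UNIV. P $ k $ l))" for k by (simp add: a_def dual_arrival_def nu_def)
  have pkl: "p $ k $ l = nu $ l * P $ l $ k / nu $ k" for k l by (simp add: p_def dual_routing_def nu_def)
  have load: "load lam mu P $ k = nu $ k / mu $ k" for k by (simp add: load_def nu_def)
  have prow: "nu $ k * (\<Sum>l\<in>UNIV. p $ k $ l) = nu $ k - lam $ k" for k
  proof -
    have "nu $ k * (\<Sum>l\<in>UNIV. p $ k $ l) = (\<Sum>l\<in>UNIV. P $ l $ k * nu $ l)"
      using nu[of k] by (simp add: sum_distrib_left pkl mult.commute)
    then show ?thesis using eq[of k] by linarith
  qed
  \<comment> \<open>In the dual routing the factors \<open>nu\<close> cancel so that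
    \<open>p\<^sup>T (nu w) = nu (P w)\<close> componentwise, which transfers the contraction of
    \<open>w\<close>.\<close>
  define v where "v = (\<chi> k. nu $ k * w $ k)"
  have fw: "jackson lam mu P"
    using lam mu P0 P1 by unfold_locales (auto intro: less_imp_le)
  have bw: "jackson a mu p"
  proof
    show "0 \<le> a $ k" for k using nu[of k] P1[of k] by (simp add: ak)
    show "0 \<le> p $ k $ l" for k l using nu P0 by (simp add: pkl less_imp_le)
    show "(\<Sum>l\<in>UNIV. p $ k $ l) \<le> 1" for k
    proof -
      have "nu $ k * (\<Sum>l\<in>UNIV. p $ k $ l) \<le> nu $ k * 1" using prow[of k] lam[of k] by linarith
      then show ?thesis using nu[of k] by (simp only: mult_le_cancel_left_pos)
    qed
  qed (rule mu)
  have net': "network a mu p nu v \<beta>"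
  proof (intro network.intro network_axioms.intro bw \<beta>)
    show "0 < v $ k" for k using nu w by (simp add: v_def)
    show "(\<Sum>j\<in>UNIV. p $ j $ k * v $ j) \<le> \<beta> * v $ k" for k
    proof -
      have "(\<Sum>j\<in>UNIV. p $ j $ k * v $ j) = (\<Sum>j\<in>UNIV. nu $ k * (P $ k $ j * w $ j))"
        using nu by (intro sum.cong refl) (simp add: pkl v_def less_imp_neq[symmetric])
      also have "\<dots> = nu $ k * (\<Sum>j\<in>UNIV. P $ k $ j * w $ j)" by (rule sum_distrib_left[symmetric])
      also have "\<dots> \<le> nu $ k * (\<beta> * w $ k)" using nu[of k] Pw[of k] by (intro mult_left_mono) auto
      finally show ?thesis by (simp add: v_def mult_ac)
    qed
    show "nu $ k = a $ k + (\<Sum>j\<in>UNIV. p $ j $ k * nu $ j)" for k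
    proof -
      have "(\<Sum>j\<in>UNIV. p $ j $ k * nu $ j) = (\<Sum>j\<in>UNIV. nu $ k * P $ k $ j)"
        using nu by (intro sum.cong refl) (simp add: pkl less_imp_neq[symmetric])
      then show ?thesis by (simp add: ak right_diff_distrib flip: sum_distrib_left)
    qed
  qed
  have dual: "jackson_duality lam a mu P p (load lam mu P)"
  proof (intro jackson_duality.intro jackson_duality_axioms.intro fw bw)
    show "0 < load lam mu P $ k" for k using nu mu by (simp add: load)
    show "lam $ k = load lam mu P $ k * (mu $ k * (1 - (\<Sum>l\<in>UNIV. p $ k $ l)))" for k
      using mu[of k] prow[of k] by (simp add: load right_diff_distrib)
    show "load lam mu P $ k * (mu $ k * (1 - (\<Sum>l\<in>UNIV. P $ k $ l))) = a $ k" for k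
      using mu[of k] by (simp add: load ak)
    show "load lam mu P $ k * (mu $ k * P $ k $ l) = load lam mu P $ l * (mu $ l * p $ l $ k)" for k l
      using mu[of k] mu[of l] nu[of l] by (simp add: load pkl)
    \<comment> \<open>In equilibrium the total inflow equals the total outflow, and the outflow of
      the network is the inflow of its dual.\<close>
    show "(\<Sum>k\<in>UNIV. lam $ k) = (\<Sum>k\<in>UNIV. a $ k)"
    proof -
      have "(\<Sum>k\<in>UNIV. a $ k) = (\<Sum>k\<in>UNIV. nu $ k) - (\<Sum>k\<in>UNIV. \<Sum>l\<in>UNIV. P $ k $ l * nu $ k)"
        by (simp add: ak right_diff_distrib sum_subtractf sum_distrib_left mult.commute)
      also have "(\<Sum>k\<in>UNIV. \<Sum>l\<in>UNIV. P $ k $ l * nu $ k) = (\<Sum>l\<in>UNIV. \<Sum>k\<in>UNIV. P $ k $ l * nu $ k)"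
        by (rule sum.swap)
      also have "\<dots> = (\<Sum>l\<in>UNIV. nu $ l - lam $ l)"
      proof (rule sum.cong[OF refl])
        fix l
        show "(\<Sum>k\<in>UNIV. P $ k $ l * nu $ k) = nu $ l - lam $ l" using eq[of l] by linarith
      qed
      finally show ?thesis by (simp add: sum_subtractf)
    qed
  qed
  have prob: "prob_space M" using chain by (simp add: markov_chain_def)
  have chn: "jackson_chain lam mu P M Q"
    by (intro jackson_chain.intro jackson_chain_axioms.intro fw prob chain start)
  have "reversed_network lam a mu P p (load lam mu P) nu v \<beta> M Q q r (emptying_time q) (decay_rate lam mu P)"
  proof (intro reversed_network.intro reversed_network_axioms.intro dual net' chn)
    show "nu $ k < mu $ k" for k using rho[of k] mu[of k] by (simp add: load)
    show "fluid_trajectory a mu p r q" using fluid by (simp add: a_def p_def)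
    show "decay_rate lam mu P = (\<chi> k. - ln (load lam mu P $ k))" by (simp add: decay_rate_def)
  qed (use lam rho r_nonneg in auto)
  then show ?thesis unfolding a_def p_def nu_def by blast
qed

theorem mainTheorem4:
  fixes lam mu r :: "real ^ 'k"
    and P :: "real ^ 'k ^ 'k"
    and N :: "real ^ 'k \<Rightarrow> real"
    and M :: "'w measure"
    and Q :: "real \<Rightarrow> 'w \<Rightarrow> nat ^ 'k"
    and qbar qstar :: "real \<Rightarrow> real ^ 'k"
    and T :: real
  assumes norm: "is_norm N"
    and network: "ergodic_jackson_network lam mu P"
    and chain: "markov_chain M (jackson_rate lam mu P) Q"
    and start: "AE w in M. Q 0 w = 0"
    and r_nonneg: "\<forall>k. 0 \<le> r $ k"
    and fluid: "fluid_trajectory (dual_arrival lam P) mu (dual_routing lam P) r qbar"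
    and T: "T = emptying_time qbar"
    and qstar: "\<forall>t\<in>{0..T}. qstar t = qbar (T - t)"
  shows "(\<forall>\<delta>>0.
            ((\<lambda>\<epsilon>. limsup (\<lambda>n. ereal
                \<P>(w in M. ereal \<delta> \<le> (SUP t\<in>{0..T}. ereal (N (scaled_queue Q n t w - qstar t)))
                  \<bar> N (scaled_queue Q n T w - r) \<le> \<epsilon>)))
              \<longlongrightarrow> 0) (at_right 0))
       \<and> ((\<lambda>\<epsilon>. limsup (\<lambda>n. ereal (1 / real n) *
                ln_prob \<P>(w in M. N (scaled_queue Q n T w - r) \<le> \<epsilon>)))
              \<longlongrightarrow> ereal (- (decay_rate lam mu P \<bullet> r))) (at_right 0)
       \<and> ((\<lambda>\<epsilon>. liminf (\<lambda>n. ereal (1 / real n) *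
                ln_prob \<P>(w in M. N (scaled_queue Q n T w - r) \<le> \<epsilon>)))
              \<longlongrightarrow> ereal (- (decay_rate lam mu P \<bullet> r))) (at_right 0)"
proof -
  define theta where "theta = decay_rate lam mu P"
  obtain v \<beta> where "reversed_network lam (dual_arrival lam P) mu P (dual_routing lam P) (load lam mu P) (throughput lam P) v \<beta>
    M Q qbar r T theta"
    using reversed_networkI[OF network chain start r_nonneg fluid] unfolding T theta_def by blast
  then interpret rn: reversed_network lam "dual_arrival lam P" mu P "dual_routing lam P" "load lam mu P" "throughput lam P" v \<beta>
    M Q qbar r T theta .
  obtain c1 c2 where c: "0 < c1" "0 < c2" and N: "\<And>x. c1 * norm x \<le> N x" "\<And>x. N x \<le> c2 * norm x"
    using is_norm_equivalent[OF norm] by blast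
  have N_le: "N x \<le> \<epsilon>" if "norm x \<le> \<epsilon> / c2" for x \<epsilon>
  proof -
    have "c2 * norm x \<le> \<epsilon>" using that c by (simp add: pos_le_divide_eq mult.commute)
    with N(2)[of x] show ?thesis by linarith
  qed
  have norm_le: "norm x \<le> \<epsilon> / c1" if "N x \<le> \<epsilon>" for x \<epsilon>
  proof -
    have "norm x * c1 \<le> \<epsilon>" using N(1)[of x] that by (simp add: mult.commute)
    then show ?thesis using c by (simp add: pos_le_divide_eq)
  qed
  let ?B = "\<lambda>n \<epsilon>. {w\<in>space M. N (scaled_queue Q n T w - r) \<le> \<epsilon>}"
  have B_sets: "?B n \<epsilon> \<in> sets M" for n \<epsilon>
    using rn.Q_end_sets[of "\<lambda>x. N (vec_of x /\<^sub>R real n - r) \<le> \<epsilon>" n] by (simp add: scaled_queue_eq)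
  have B_super: "{w\<in>space M. norm (vec_of (Q (real n * T) w) /\<^sub>R real n - r) \<le> \<epsilon> / c2} \<subseteq> ?B n \<epsilon>" for n \<epsilon>
    unfolding scaled_queue_eq using N_le by blast
  have B_sub: "w \<in> ?B n \<epsilon> \<Longrightarrow> norm (vec_of (Q (real n * T) w) /\<^sub>R real n - r) \<le> \<epsilon> / c1" for n \<epsilon> w
    unfolding scaled_queue_eq using norm_le by blast
  have conditional: "((\<lambda>\<epsilon>. limsup (\<lambda>n. ereal
                \<P>(w in M. ereal \<delta> \<le> (SUP t\<in>{0..T}. ereal (N (scaled_queue Q n t w - qstar t)))
                  \<bar> N (scaled_queue Q n T w - r) \<le> \<epsilon>)))
              \<longlongrightarrow> 0) (at_right 0)" if \<delta>: "0 < \<delta>" for \<delta>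
  proof -
    \<comment> \<open>A supremum of at least \<open>\<delta>\<close> gives a time with
      \<open>N\<close> above \<open>\<delta> / 2\<close>, hence Euclidean norm above
      \<open>\<delta> / (2 * c2) = 3 * d\<close>.\<close>
    define d where "d = \<delta> / (6 * c2)"
    have d: "0 < d" using \<delta> c by (simp add: d_def)
    obtain \<epsilon>0 b C where \<epsilon>0: "0 < \<epsilon>0" and b: "0 < b" and bound: "\<forall>\<epsilon>>0. \<epsilon> \<le> \<epsilon>0 \<longrightarrow> (\<forall>\<epsilon>'>0. \<forall>\<^sub>F n in sequentially. \<forall>A. \<forall>B\<in>sets M.
        A \<subseteq> {w\<in>space M. norm (vec_of (Q (real n * T) w) /\<^sub>R real n - r) \<le> \<epsilon> \<and>
            (\<exists>t\<in>{0..T}. 3 * d < norm (vec_of (Q (real n * t) w) /\<^sub>R real n - qbar (T - t)))} \<longrightarrow>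
        {w\<in>space M. norm (vec_of (Q (real n * T) w) /\<^sub>R real n - r) \<le> \<epsilon>'} \<subseteq> B \<longrightarrow>
        measure M A / measure M B \<le> C * exp (- (b * real n)))"
      using rn.conditional_deviation_bound[OF d] by (elim exE conjE) (rule that)
    \<comment> \<open>For every small \<open>\<epsilon>\<close> the inner limit superior is already
      0, because the conditional probability decays exponentially.\<close>
    have "limsup (\<lambda>n. ereal \<P>(w in M. ereal \<delta> \<le> (SUP t\<in>{0..T}. ereal (N (scaled_queue Q n t w - qstar t)))
                  \<bar> N (scaled_queue Q n T w - r) \<le> \<epsilon>)) = 0" if \<epsilon>: "0 < \<epsilon>" "\<epsilon> < c1 * \<epsilon>0" for \<epsilon>
    proof -
      let ?p = "\<lambda>n. \<P>(w in M. ereal \<delta> \<le> (SUP t\<in>{0..T}. ereal (N (scaled_queue Q n t w - qstar t)))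
                  \<bar> N (scaled_queue Q n T w - r) \<le> \<epsilon>)"
      have "0 < \<epsilon> / c1" "\<epsilon> / c1 \<le> \<epsilon>0" "0 < \<epsilon> / c2" using \<epsilon> c by (auto simp: field_simps)
      from bound[rule_format, OF this] have ev: "\<forall>\<^sub>F n in sequentially. ?p n \<le> C * exp (- (b * real n))"
      proof eventually_elim
        case (elim n)
        let ?A = "{w\<in>space M. (ereal \<delta> \<le> (SUP t\<in>{0..T}. ereal (N (scaled_queue Q n t w - qstar t)))) \<and> N (scaled_queue Q n T w - r) \<le> \<epsilon>}"
        have "?A \<subseteq> {w\<in>space M. norm (vec_of (Q (real n * T) w) /\<^sub>R real n - r) \<le> \<epsilon> / c1 \<and>
            (\<exists>t\<in>{0..T}. 3 * d < norm (vec_of (Q (real n * t) w) /\<^sub>R real n - qbar (T - t)))}"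
        proof
          fix w assume w: "w \<in> ?A"
          then obtain t where t: "t \<in> {0..T}" "\<delta> / 2 < N (scaled_queue Q n t w - qstar t)"
            using ereal_SUP_ge_imp_exists[of \<delta> "\<lambda>t. N (scaled_queue Q n t w - qstar t)" "{0..T}" "\<delta> / 2"] \<delta> by auto
          have "\<delta> / 2 < c2 * norm (scaled_queue Q n t w - qstar t)" using t(2) N(2) less_le_trans by blast
          then have "3 * d < norm (scaled_queue Q n t w - qstar t)" using c by (simp add: d_def field_simps)
          then show "w \<in> {w\<in>space M. norm (vec_of (Q (real n * T) w) /\<^sub>R real n - r) \<le> \<epsilon> / c1 \<and>
            (\<exists>t\<in>{0..T}. 3 * d < norm (vec_of (Q (real n * t) w) /\<^sub>R real n - qbar (T - t)))}"
            using t(1) w B_sub[of w n \<epsilon>] qstar by (auto simp: scaled_queue_eq)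
        qed
        then have "measure M ?A / measure M (?B n \<epsilon>) \<le> C * exp (- (b * real n))"
          using elim B_sets[of n \<epsilon>] B_super[of n \<epsilon>] by blast
        then show ?case by (simp add: cond_prob_def)
      qed
      have "?p \<longlonglongrightarrow> 0"
      proof (rule tendsto_sandwich[OF _ ev tendsto_const exp_decay_tendsto_0[OF b]])
        show "\<forall>\<^sub>F n in sequentially. 0 \<le> ?p n" by (simp add: cond_prob_def)
      qed
      then have "(\<lambda>n. ereal (?p n)) \<longlonglongrightarrow> ereal 0" by (rule tendsto_ereal)
      then show ?thesis using lim_imp_Limsup[of sequentially "\<lambda>n. ereal (?p n)"] by (simp add: zero_ereal_def)
    qed
    moreover have "\<forall>\<^sub>F \<epsilon> in at_right 0. 0 < \<epsilon> \<and> \<epsilon> < c1 * \<epsilon>0"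
      using eventually_at_right_real[of 0 "c1 * \<epsilon>0"] c \<epsilon>0 by (auto elim: eventually_mono)
    ultimately show ?thesis
      by (intro tendsto_eventually) (auto elim!: eventually_mono)
  qed
  let ?X = "\<lambda>\<epsilon> n. ereal (1 / real n) * ln_prob \<P>(w in M. N (scaled_queue Q n T w - r) \<le> \<epsilon>)"
  \<comment> \<open>\<open>norm theta / c1\<close> is the variation of the weight over the ball, and
    1 comes from bounding the number of end states by \<open>exp (\<epsilon> * n)\<close>.\<close>
  define c3 where "c3 = norm theta / c1 + 1"
  have lower: "ereal (- (theta \<bullet> r) - \<epsilon>) \<le> liminf (?X \<epsilon>)" if \<epsilon>: "0 < \<epsilon>" for \<epsilon>
  proof (rule Liminf_bounded)
    have "0 < min \<epsilon> (\<epsilon> / c2)" using \<epsilon> c by simp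
    from rn.prob_end_ge[OF this] eventually_gt_at_top[of 0]
    show "\<forall>\<^sub>F n in sequentially. ereal (- (theta \<bullet> r) - \<epsilon>) \<le> ?X \<epsilon> n"
    proof eventually_elim
      case (elim n)
      then obtain x where x: "norm (vec_of x /\<^sub>R real n - r) \<le> min \<epsilon> (\<epsilon> / c2)"
        "exp (- (real n * (theta \<bullet> r + min \<epsilon> (\<epsilon> / c2)))) \<le> \<P>(w in M. Q (real n * T) w = x)" by blast
      have "exp (- (real n * (theta \<bullet> r + \<epsilon>))) \<le> exp (- (real n * (theta \<bullet> r + min \<epsilon> (\<epsilon> / c2))))"
        by (simp add: mult_left_mono)
      also note x(2)
      also have "\<P>(w in M. Q (real n * T) w = x) \<le> measure M (?B n \<epsilon>)"
        using x(1) B_super[of n \<epsilon>] B_sets by (intro rn.chain.finite_measure_mono) auto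
      finally show ?case using ln_prob_ge[of n "theta \<bullet> r + \<epsilon>"] elim by simp
    qed
  qed
  have upper: "limsup (?X \<epsilon>) \<le> ereal (- (theta \<bullet> r) + c3 * \<epsilon>)" if \<epsilon>: "0 < \<epsilon>" "\<epsilon> < c1" for \<epsilon>
  proof (rule Limsup_bounded)
    have "\<forall>\<^sub>F n in sequentially. ((norm r + 1) * real n + 1) ^ CARD('k) \<le> exp (\<epsilon> * real n)"
      using \<epsilon> by (intro poly_le_exp) auto
    then show "\<forall>\<^sub>F n in sequentially. ?X \<epsilon> n \<le> ereal (- (theta \<bullet> r) + c3 * \<epsilon>)"
      using eventually_gt_at_top[of 0]
    proof eventually_elim
      case (elim n)
      have e1: "\<epsilon> / c1 \<le> 1" using \<epsilon> c by simp
      \<comment> \<open>With no constraint on the path: time \<open>s = 0\<close>,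
        \<open>A = UNIV\<close> and the trivial bound 1.\<close>
      note near = rn.prob_end_near_le[OF elim(2) e1 order_refl rn.T_nonneg, of 1 UNIV]
      have "measure M (?B n \<epsilon>) \<le> \<P>(w in M. Q (real n * 0) w \<in> UNIV \<and> norm (vec_of (Q (real n * T) w) /\<^sub>R real n - r) \<le> \<epsilon> / c1)"
      proof (rule rn.chain.finite_measure_mono)
        show "?B n \<epsilon> \<subseteq> {w\<in>space M. Q (real n * 0) w \<in> UNIV \<and> norm (vec_of (Q (real n * T) w) /\<^sub>R real n - r) \<le> \<epsilon> / c1}"
          using B_sub[of _ n \<epsilon>] by blast
        show "{w\<in>space M. Q (real n * 0) w \<in> UNIV \<and> norm (vec_of (Q (real n * T) w) /\<^sub>R real n - r) \<le> \<epsilon> / c1} \<in> sets M"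
          by (rule near(1)) simp_all
      qed
      also have "\<dots> \<le> ((norm r + 1) * real n + 1) ^ CARD('k) * (exp (- (real n * (theta \<bullet> r - norm theta * (\<epsilon> / c1)))) * 1)"
        by (rule near(2)) auto
      also have "\<dots> \<le> exp (\<epsilon> * real n) * (exp (- (real n * (theta \<bullet> r - norm theta * (\<epsilon> / c1)))) * 1)"
        using elim(1) by (intro mult_right_mono) auto
      also have "\<dots> = exp (real n * (- (theta \<bullet> r) + c3 * \<epsilon>))"
        by (simp add: c3_def algebra_simps flip: exp_add)
      finally show ?case by (intro ln_prob_le elim(2)) auto
    qed
  qed
  have range: "\<forall>\<^sub>F \<epsilon> in at_right 0. 0 < \<epsilon> \<and> \<epsilon> < c1"
    using eventually_at_right_real[of 0 c1] c by (auto elim: eventually_mono)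
  have le: "liminf (?X \<epsilon>) \<le> limsup (?X \<epsilon>)" for \<epsilon> by (rule Liminf_le_Limsup) simp
  have lim_l: "((\<lambda>\<epsilon>. ereal (- (theta \<bullet> r) - \<epsilon>)) \<longlongrightarrow> ereal (- (theta \<bullet> r))) (at_right 0)"
    by (intro tendsto_ereal) (auto intro!: tendsto_eq_intros)
  have lim_u: "((\<lambda>\<epsilon>. ereal (- (theta \<bullet> r) + c3 * \<epsilon>)) \<longlongrightarrow> ereal (- (theta \<bullet> r))) (at_right 0)"
    by (intro tendsto_ereal) (auto intro!: tendsto_eq_intros)
  have ev_l: "\<forall>\<^sub>F \<epsilon> in at_right 0. ereal (- (theta \<bullet> r) - \<epsilon>) \<le> liminf (?X \<epsilon>)"
    using range by eventually_elim (rule lower, blast)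
  have ev_u: "\<forall>\<^sub>F \<epsilon> in at_right 0. limsup (?X \<epsilon>) \<le> ereal (- (theta \<bullet> r) + c3 * \<epsilon>)"
    using range by eventually_elim (rule upper, blast+)
  have ev_l': "\<forall>\<^sub>F \<epsilon> in at_right 0. ereal (- (theta \<bullet> r) - \<epsilon>) \<le> limsup (?X \<epsilon>)"
    using ev_l by eventually_elim (rule order_trans[OF _ le])
  have ev_u': "\<forall>\<^sub>F \<epsilon> in at_right 0. liminf (?X \<epsilon>) \<le> ereal (- (theta \<bullet> r) + c3 * \<epsilon>)"
    using ev_u by eventually_elim (rule order_trans[OF le])
  have "((\<lambda>\<epsilon>. limsup (?X \<epsilon>)) \<longlongrightarrow> ereal (- (theta \<bullet> r))) (at_right 0)"
    by (rule tendsto_sandwich[OF ev_l' ev_u lim_l lim_u])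
  moreover have "((\<lambda>\<epsilon>. liminf (?X \<epsilon>)) \<longlongrightarrow> ereal (- (theta \<bullet> r))) (at_right 0)"
    by (rule tendsto_sandwich[OF ev_l ev_u' lim_l lim_u])
  ultimately show ?thesis using conditional unfolding theta_def by blast
qed

end
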